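(* Let $G$ be a finite soluble group with all Sylow subgroups of nilpotency class at most two. Suppose that $G$ is $2$-nilpotent. Then $G$ is an IYB-group.
   Context: A set-theoretic solution of the Yang–Baxter equation is a pair $(X,r)$ with $X$ a nonempty set and $r:X\times X\to X\times X$ a map such that $r_{12}r_{23}r_{12}=r_{23}r_{12}r_{23}$, where $r_{12}=r\times \mathrm{Id}_X$ and $r_{23}=\mathrm{Id}_X\times r$ are maps $X^3\to X^3$. Write $r(x,y)=(f_x(y),g_y(x))$. The solution is involutive if $r^2=\mathrm{id}_{X\times X}$, and non-degenerate if $f_x$ and $g_y$ are bijections of $X$ for all $x,y\in X$. The permutation group of an involutive non-degenerate solution $(X,r)$ is $\mathcal{G}(X,r)=\langle f_x\mid x\in X\rangle\le \mathrm{Sym}(X)$. A group $G$ is an involutive Yang–Baxter group (IYB-group) if $G\cong\mathcal{G}(X,r)$ for some involutive non-degenerate set-theoretic solution $(X,r)$ of the Yang–Baxter equation. A finite group is $2$-nilpotent if it has a normal subgroup of odd order whose index is a power of $2$ (a normal Sylow $2$-complement). *)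

theory Defs
  imports
    "HOL-Algebra.Bij"
    "HOL-Algebra.Coset"
    "HOL-Algebra.Generated_Groups"
    "HOL-Algebra.Solvable_Groups"
    "HOL-Computational_Algebra.Primes"
begin

section \<open>Set-theoretic solutions of the Yang--Baxter equation\<close>

text \<open>
  Solutions live on a carrier set \<open>X\<close>; the values of \<open>r\<close> outside \<open>X \<times> X\<close> are irrelevant.
  Triples are \<open>(x, (y, z))\<close>.
\<close>

definition r12 :: "('x \<times> 'x \<Rightarrow> 'x \<times> 'x) \<Rightarrow> 'x \<times> 'x \<times> 'x \<Rightarrow> 'x \<times> 'x \<times> 'x" where
  "r12 r = (\<lambda>(x, y, z). case r (x, y) of (u, v) \<Rightarrow> (u, v, z))"

definition r23 :: "('x \<times> 'x \<Rightarrow> 'x \<times> 'x) \<Rightarrow> 'x \<times> 'x \<times> 'x \<Rightarrow> 'x \<times> 'x \<times> 'x" where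
  "r23 r = map_prod id r"

definition YB_solution :: "'x set \<Rightarrow> ('x \<times> 'x \<Rightarrow> 'x \<times> 'x) \<Rightarrow> bool" where
  "YB_solution X r \<longleftrightarrow>
     X \<noteq> {} \<and> r \<in> X \<times> X \<rightarrow> X \<times> X \<and>
     (\<forall>t \<in> X \<times> X \<times> X. (r12 r \<circ> r23 r \<circ> r12 r) t = (r23 r \<circ> r12 r \<circ> r23 r) t)"

text \<open>The component maps in \<open>r (x, y) = (f\<^sub>x y, g\<^sub>y x)\<close>.\<close>

definition YB_f :: "('x \<times> 'x \<Rightarrow> 'x \<times> 'x) \<Rightarrow> 'x \<Rightarrow> 'x \<Rightarrow> 'x" where
  "YB_f r x y = fst (r (x, y))"

definition YB_g :: "('x \<times> 'x \<Rightarrow> 'x \<times> 'x) \<Rightarrow> 'x \<Rightarrow> 'x \<Rightarrow> 'x" where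
  "YB_g r y x = snd (r (x, y))"

definition YB_involutive :: "'x set \<Rightarrow> ('x \<times> 'x \<Rightarrow> 'x \<times> 'x) \<Rightarrow> bool" where
  "YB_involutive X r \<longleftrightarrow> (\<forall>p \<in> X \<times> X. r (r p) = p)"

definition YB_nondegenerate :: "'x set \<Rightarrow> ('x \<times> 'x \<Rightarrow> 'x \<times> 'x) \<Rightarrow> bool" where
  "YB_nondegenerate X r \<longleftrightarrow>
     (\<forall>x \<in> X. bij_betw (YB_f r x) X X) \<and> (\<forall>y \<in> X. bij_betw (YB_g r y) X X)"

text \<open>
  \<open>BijGroup X\<close> is the symmetric group on \<open>X\<close>; its elements are extensional functions,
  hence the restriction of \<open>f\<^sub>x\<close> to \<open>X\<close>.
\<close>

definition YB_permutation_group ::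
    "'x set \<Rightarrow> ('x \<times> 'x \<Rightarrow> 'x \<times> 'x) \<Rightarrow> ('x \<Rightarrow> 'x) monoid" where
  "YB_permutation_group X r =
     subgroup_generated (BijGroup X) ((\<lambda>x. restrict (YB_f r x) X) ` X)"

text \<open>
  HOL cannot quantify existentially over the type of the elements of \<open>X\<close>, so \<open>X\<close> is taken to be
  a (finite or infinite) set of natural numbers. For finite \<open>G\<close> this is no restriction. If
  \<open>G\<close> is the permutation group of a solution on an arbitrary set \<open>X\<close>, then all its orbits on \<open>X\<close>
  are finite, and there is a finite \<open>G\<close>-invariant nonempty \<open>Y \<subseteq> X\<close> on which \<open>G\<close> acts faithfully
  and which meets every fibre of \<open>x \<mapsto> f\<^sub>x\<close>. As \<open>g\<^sub>y x\<close> is the preimage of \<open>x\<close> under \<open>f\<close> indexed by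
  \<open>f\<^sub>x y\<close>, the solution restricts to \<open>Y\<close>, with permutation group isomorphic to \<open>G\<close>.
\<close>

definition IYB_group :: "('a, 'b) monoid_scheme \<Rightarrow> bool" where
  "IYB_group G \<longleftrightarrow>
     (\<exists>(X :: nat set) r. YB_solution X r \<and> YB_involutive X r \<and> YB_nondegenerate X r \<and>
        G \<cong> YB_permutation_group X r)"


section \<open>Nilpotency class, Sylow subgroups, 2-nilpotent groups\<close>

definition commutator_subgroup :: "('a, 'b) monoid_scheme \<Rightarrow> 'a set \<Rightarrow> 'a set \<Rightarrow> 'a set" where
  "commutator_subgroup G H K =
     generate G (\<Union>h \<in> H. \<Union>k \<in> K. {h \<otimes>\<^bsub>G\<^esub> k \<otimes>\<^bsub>G\<^esub> inv\<^bsub>G\<^esub> h \<otimes>\<^bsub>G\<^esub> inv\<^bsub>G\<^esub> k})"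

text \<open>Indexed from \<open>0\<close>: \<open>lower_central G n\<close> is the term usually written \<open>\<gamma>\<close> with index \<open>n + 1\<close>.\<close>

primrec lower_central :: "('a, 'b) monoid_scheme \<Rightarrow> nat \<Rightarrow> 'a set" where
  "lower_central G 0 = carrier G"
| "lower_central G (Suc n) = commutator_subgroup G (lower_central G n) (carrier G)"

definition nilpotency_class_le :: "('a, 'b) monoid_scheme \<Rightarrow> nat \<Rightarrow> bool" where
  "nilpotency_class_le G c \<longleftrightarrow> lower_central G c = {\<one>\<^bsub>G\<^esub>}"

definition sylow_subgroup :: "nat \<Rightarrow> 'a set \<Rightarrow> ('a, 'b) monoid_scheme \<Rightarrow> bool" where
  "sylow_subgroup p P G \<longleftrightarrow>
     prime p \<and> subgroup P G \<and> card P = p ^ multiplicity p (order G)"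

definition two_nilpotent :: "('a, 'b) monoid_scheme \<Rightarrow> bool" where
  "two_nilpotent G \<longleftrightarrow>
     (\<exists>N. N \<lhd> G \<and> odd (card N) \<and> (\<exists>k. card (rcosets\<^bsub>G\<^esub> N) = 2 ^ k))"

end

theory Submission
  imports Defs "HOL-Algebra.Sylow" "HOL-Algebra.Multiplicative_Group" "HOL-Algebra.Group_Action"
    "HOL-Algebra.Elementary_Groups"
begin

text \<open>
  The theorem is reduced to one-cocycles. If \<open>A\<close> is an abelian group on which the finite group \<open>G\<close> acts
  and \<open>\<pi> : G \<rightarrow> A\<close> is a bijection with \<open>\<pi> (g h) = \<pi> g + g (\<pi> h)\<close>, then transporting the addition of
  \<open>A\<close> to \<open>G\<close> makes \<open>G\<close> the multiplicative group of a left brace, and a solution on \<open>G \<times> G\<close> has \<open>G\<close> as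
  its permutation group (\<open>IYB_group_of_bij_cocycle\<close>). A surjective cocycle onto a group of order \<open>n\<close>
  vanishes exactly on a subgroup of index \<open>n\<close>. Hence surjective cocycles onto groups of coprime orders
  combine to a surjective one, and it is enough to find, for each prime \<open>p\<close>, a surjective cocycle
  onto a group whose order is that of a Sylow \<open>p\<close>-subgroup \<open>P\<close>
  (\<open>IYB_group_of_primewise_cocycles\<close>).

  On a group \<open>P\<close> of class at most two let \<open>\<beta>\<close> be a bilinear form whose values are central and pair trivially
  with all elements, such that \<open>\<beta> x y (\<beta> y x)\<^sup>-\<^sup>1\<close> is the commutator of \<open>x\<close> and \<open>y\<close>. Then \<open>x + y = x y (\<beta> x y)\<^sup>-\<^sup>1\<close> is an abelian
  group structure for which the identity of \<open>P\<close> is a cocycle. If \<open>p\<close> is odd, half the commutator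
  is such a form, as in Baer's correspondence. It is invariant under automorphisms, so that the
  cocycle extends to every group in which \<open>P\<close> is normal with a complement
  (\<open>has_surj_cocycle_of_complement\<close>). For \<open>p = 2\<close> the form comes from a decomposition of \<open>P\<close> modulo its
  centre into cyclic factors (\<open>class2_form_exists\<close>), and no extension has to be found because \<open>P\<close> is
  a quotient of the 2-nilpotent group \<open>G\<close>.

  For odd \<open>p\<close> it remains to see that \<open>P\<close> becomes normal after dividing by the largest normal subgroup
  of order prime to \<open>p\<close>, which is the heart of the proof (\<open>sylow_normal_in\<close>). Let \<open>N\<close> be a normal
  \<open>p\<close>-subgroup. Since \<open>P\<close> has class at most two, each \<open>x\<close> in \<open>P\<close> acts on \<open>N\<close>, with Baer's addition, by
  an operator with \<open>(x - 1)\<^sup>2 = 0\<close>. A computation with two conjugate operators of this kind shows that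
  \<open>x\<close> centralises every soluble group of odd order prime to \<open>p\<close> that it normalises and that acts
  faithfully on \<open>N\<close> (\<open>quadratic_centralises\<close>). For groups of even order this fails, as \<open>SL(2,3)\<close> acting
  on its natural module shows; 2-nilpotency takes care of the 2-subgroups
  (\<open>odd_p_element_centralises_2_group\<close>).
\<close>

section \<open>From bijective cocycles to involutive Yang--Baxter groups\<close>

lemma (in group) inv_mult_cancel [simp]:
  assumes "x \<in> carrier G" "y \<in> carrier G"
  shows "inv x \<otimes> (x \<otimes> y) = y" "x \<otimes> (inv x \<otimes> y) = y"
  using assms by (simp_all flip: m_assoc)

lemmas (in group) word_simps = m_assoc inv_mult_group

lemma group_actionI:
  assumes "group G"
    and closed: "\<And>g x. \<lbrakk>g \<in> carrier G; x \<in> E\<rbrakk> \<Longrightarrow> act g x \<in> E"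
    and one: "\<And>x. x \<in> E \<Longrightarrow> act \<one>\<^bsub>G\<^esub> x = x"
    and mult: "\<And>g h x. \<lbrakk>g \<in> carrier G; h \<in> carrier G; x \<in> E\<rbrakk> \<Longrightarrow> act (g \<otimes>\<^bsub>G\<^esub> h) x = act g (act h x)"
  shows "group_action G E (\<lambda>g. restrict (act g) E)"
proof -
  interpret group G by fact
  have inv: "act (inv\<^bsub>G\<^esub> g) (act g x) = x" "act g (act (inv\<^bsub>G\<^esub> g) x) = x"
    if "g \<in> carrier G" "x \<in> E" for g x
    using that mult[of "inv\<^bsub>G\<^esub> g" g x] mult[of g "inv\<^bsub>G\<^esub> g" x] one by simp_all
  have bij: "restrict (act g) E \<in> carrier (BijGroup E)" if g: "g \<in> carrier G" for g
  proof -
    have "bij_betw (act g) E E"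
      by (rule bij_betw_byWitness[where f' = "act (inv\<^bsub>G\<^esub> g)"]) (use g inv closed in auto)
    then show ?thesis by (simp add: BijGroup_def Bij_def cong: bij_betw_cong)
  qed
  have "(\<lambda>g. restrict (act g) E) \<in> hom G (BijGroup E)"
  proof (rule homI)
    show "restrict (act (g \<otimes>\<^bsub>G\<^esub> h)) E = restrict (act g) E \<otimes>\<^bsub>BijGroup E\<^esub> restrict (act h) E"
      if "g \<in> carrier G" "h \<in> carrier G" for g h
      using that bij closed by (auto simp: BijGroup_def compose_def mult)
  qed (rule bij)
  then show ?thesis
    using group_BijGroup is_group by (simp add: group_action_def group_hom_def group_hom_axioms_def)
qed

text \<open>
  \<open>lam\<close> is the lambda map of a left brace with multiplicative group \<open>G\<close>. As \<open>a b = a + lam a b\<close> in such a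
  brace, the last axiom is the commutativity of its addition, stated without the addition.
\<close>

locale left_brace_action = group +
  fixes lam :: "'a \<Rightarrow> 'a \<Rightarrow> 'a"
  assumes lam_closed: "\<lbrakk>a \<in> carrier G; b \<in> carrier G\<rbrakk> \<Longrightarrow> lam a b \<in> carrier G"
    and lam_one: "b \<in> carrier G \<Longrightarrow> lam \<one> b = b"
    and lam_mult: "\<lbrakk>a \<in> carrier G; b \<in> carrier G; c \<in> carrier G\<rbrakk> \<Longrightarrow> lam (a \<otimes> b) c = lam a (lam b c)"
    and lam_exchange: "\<lbrakk>a \<in> carrier G; b \<in> carrier G\<rbrakk> \<Longrightarrow> lam a b \<otimes> lam (inv (lam a b)) a = a \<otimes> b"
begin

lemma lam_inv_exchange:
  assumes "a \<in> carrier G" "b \<in> carrier G"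
  shows "lam (inv (lam a b)) a = inv (lam a b) \<otimes> a \<otimes> b"
  using lam_exchange[OF assms] assms by (metis lam_closed inv_closed inv_mult_cancel(1) m_assoc)

text \<open>In the brace, \<open>lam (inv v) v\<close> is the additive inverse of \<open>inv v\<close>.\<close>

lemma lam_inv_self_inj:
  assumes "v \<in> carrier G" "w \<in> carrier G" and eq: "lam (inv v) v = lam (inv w) w"
  shows "v = w"
proof -
  have rec: "lam p (inv p) = inv x" if x: "x \<in> carrier G" and p: "p = lam (inv x) x" for x p
  proof -
    have pc: "p \<in> carrier G" using x p by (simp add: lam_closed)
    have "lam (inv p) (inv x) = inv p"
      using lam_inv_exchange[of "inv x" x] x p pc by (simp add: m_assoc)
    then have "lam p (inv p) = lam p (lam (inv p) (inv x))" by simp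
    also have "\<dots> = inv x" using x pc by (simp add: lam_one flip: lam_mult)
    finally show ?thesis .
  qed
  have "inv v = inv w" using rec[OF assms(1) refl] rec[OF assms(2) refl] eq by simp
  then show ?thesis using assms by (metis inv_inv)
qed

text \<open>
  A set on which \<open>G\<close> acts, with an equivariant labelling \<open>u\<close> by elements of \<open>G\<close>, carries the solution
  in which \<open>x\<close> acts through its label. If every element of \<open>G\<close> is a label and the action is
  faithful, the permutation group is the whole of \<open>G\<close>.
\<close>

lemma IYB_group_of_labelled_action:
  fixes X :: "nat set" and act :: "'a \<Rightarrow> nat \<Rightarrow> nat" and u :: "nat \<Rightarrow> 'a"
  assumes fin: "finite X" and ne: "X \<noteq> {}"
    and act_closed: "\<And>g x. \<lbrakk>g \<in> carrier G; x \<in> X\<rbrakk> \<Longrightarrow> act g x \<in> X"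
    and act_one: "\<And>x. x \<in> X \<Longrightarrow> act \<one> x = x"
    and act_mult: "\<And>g h x. \<lbrakk>g \<in> carrier G; h \<in> carrier G; x \<in> X\<rbrakk> \<Longrightarrow> act (g \<otimes> h) x = act g (act h x)"
    and faithful: "\<And>g. \<lbrakk>g \<in> carrier G; \<And>x. x \<in> X \<Longrightarrow> act g x = x\<rbrakk> \<Longrightarrow> g = \<one>"
    and labels: "u ` X = carrier G"
    and label_act: "\<And>g x. \<lbrakk>g \<in> carrier G; x \<in> X\<rbrakk> \<Longrightarrow> u (act g x) = lam g (u x)"
  shows "IYB_group G"
proof -
  define r where "r = (\<lambda>(x, y). (act (u x) y, act (inv (u (act (u x) y))) x))"
  have u_closed: "u x \<in> carrier G" if "x \<in> X" for x using labels that by blast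
  have act_inv: "act (inv g) (act g x) = x" "act g (act (inv g) x) = x"
    if "g \<in> carrier G" "x \<in> X" for g x
    using that act_mult[of "inv g" g x] act_mult[of g "inv g" x] act_one by simp_all
  have act_bij: "bij_betw (act g) X X" if "g \<in> carrier G" for g
    by (rule bij_betw_byWitness[where f' = "act (inv g)"]) (use that act_inv act_closed in auto)
  have r_eq: "r (x, y) = (act (u x) y, act (inv (lam (u x) (u y))) x)" if "x \<in> X" "y \<in> X" for x y
    using that by (simp add: r_def label_act u_closed)
  have label_inv: "u (act (inv (lam (u x) (u y))) x) = inv (lam (u x) (u y)) \<otimes> u x \<otimes> u y"
    if "x \<in> X" "y \<in> X" for x y
    using that by (simp add: label_act u_closed lam_closed lam_inv_exchange)
  have r_closed: "r \<in> X \<times> X \<rightarrow> X \<times> X"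
    by (auto simp: r_eq act_closed u_closed lam_closed)
  have braid: "(r12 r \<circ> r23 r \<circ> r12 r) t = (r23 r \<circ> r12 r \<circ> r23 r) t" if t_in: "t \<in> X \<times> X \<times> X" for t
  proof -
    obtain x y z where t: "t = (x, y, z)" and X: "x \<in> X" "y \<in> X" "z \<in> X" using t_in by auto
    define a b c where "a = u x" and "b = u y" and "c = u z"
    have G: "a \<in> carrier G" "b \<in> carrier G" "c \<in> carrier G" using X by (auto simp: a_def b_def c_def u_closed)
    define w where "w = lam a b"
    define a' where "a' = inv w \<otimes> a \<otimes> b"
    define e where "e = lam a' c"
    define p where "p = lam (a \<otimes> b) c"
    define q where "q = lam b c"
    have wc: "w \<in> carrier G" using G by (simp add: w_def lam_closed)
    have a'c: "a' \<in> carrier G" using G wc by (simp add: a'_def)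
    have ec: "e \<in> carrier G" "p \<in> carrier G" "q \<in> carrier G"
      using G a'c by (simp_all add: e_def p_def q_def lam_closed)
    note car = G wc a'c ec
    have p_w: "p = lam w e"
      using car by (simp add: p_def e_def a'_def word_simps flip: lam_mult)
    have p_q: "p = lam a q" using car by (simp add: p_def q_def lam_mult)
    have wa': "w \<otimes> a' = a \<otimes> b" using car by (simp add: a'_def word_simps)
    have exch: "lam (inv p) w = inv p \<otimes> w \<otimes> e" using lam_inv_exchange[of w e] p_w car by simp
    have exch2: "lam (inv p) a = inv p \<otimes> a \<otimes> q" using lam_inv_exchange[of a q] p_q car by simp
    have lab1: "u (act (inv w) x) = a'"
      using label_inv[OF X(1,2)] by (simp add: w_def a'_def a_def b_def)
    have lab2: "u (act a y) = w" using label_act[OF G(1) X(2)] by (simp add: w_def b_def)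
    have lab3: "u (act a' z) = e" using label_act[OF a'c X(3)] by (simp add: e_def c_def)
    have lab4: "u (act b z) = q" using label_act[OF G(2) X(3)] by (simp add: q_def c_def)
    have lab5: "u (act (inv q) y) = inv q \<otimes> b \<otimes> c"
      using label_inv[OF X(2,3)] by (simp add: q_def c_def b_def)
    have lab6: "u (act (inv p) x) = inv p \<otimes> a \<otimes> q"
      using label_act[of "inv p" x] X car exch2 by (simp add: a_def)
    have actc: "act a y \<in> X" "act (inv w) x \<in> X" "act a' z \<in> X" "act b z \<in> X" "act (inv q) y \<in> X"
      "act (inv p) x \<in> X" using X car act_closed by auto
    have s1: "r (x, y) = (act a y, act (inv w) x)" using r_eq X by (simp add: a_def b_def w_def)
    have s2: "r (act (inv w) x, z) = (act a' z, act (inv e) (act (inv w) x))"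
      using r_eq[OF actc(2) X(3)] lab1 by (simp add: e_def c_def)
    have s3: "r (act a y, act a' z) = (act w (act a' z), act (inv (lam w e)) (act a y))"
      using r_eq[OF actc(1,3)] lab2 lab3 by simp
    have L: "(r12 r \<circ> r23 r \<circ> r12 r) t
        = (act w (act a' z), act (inv p) (act a y), act (inv e) (act (inv w) x))"
      using s1 s2 s3 p_w by (simp add: t r12_def r23_def)
    have s4: "r (y, z) = (act b z, act (inv q) y)" using r_eq X by (simp add: q_def c_def b_def)
    have s5: "r (x, act b z) = (act a (act b z), act (inv p) x)"
      using r_eq[OF X(1) actc(4)] lab4 p_q by (simp add: a_def)
    have s6: "r (act (inv p) x, act (inv q) y)
      = (act (inv p \<otimes> a \<otimes> q) (act (inv q) y),
         act (inv (u (act (inv p \<otimes> a \<otimes> q) (act (inv q) y)))) (act (inv p) x))"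
      using actc lab6 by (simp add: r_def)
    have s7: "act (inv p \<otimes> a \<otimes> q) (act (inv q) y) = act (inv p) (act a y)"
      using X car by (simp add: act_mult[symmetric] word_simps)
    have s8: "u (act (inv p) (act a y)) = inv p \<otimes> w \<otimes> e"
      using label_act[of "inv p" "act a y"] actc car lab2 exch by simp
    have R: "(r23 r \<circ> r12 r \<circ> r23 r) t
        = (act a (act b z), act (inv p) (act a y), act (inv (inv p \<otimes> w \<otimes> e)) (act (inv p) x))"
      using s4 s5 s6 s7 s8 by (simp add: t r12_def r23_def)
    have "act w (act a' z) = act a (act b z)" using X car wa' by (simp flip: act_mult)
    moreover have "act (inv (inv p \<otimes> w \<otimes> e)) (act (inv p) x) = act (inv e) (act (inv w) x)"
      using X car by (simp add: word_simps flip: act_mult)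
    ultimately show ?thesis using L R by simp
  qed
  have solution: "YB_solution X r" using ne r_closed braid by (simp add: YB_solution_def)
  have involutive: "YB_involutive X r"
    using act_inv act_closed u_closed by (auto simp: YB_involutive_def r_def)
  have f_eq: "YB_f r x y = act (u x) y" for x y by (simp add: YB_f_def r_def)
  have g_inj: "inj_on (YB_g r y) X" if y: "y \<in> X" for y
  proof (rule inj_onI)
    fix x1 x2 assume x: "x1 \<in> X" "x2 \<in> X" and eq: "YB_g r y x1 = YB_g r y x2"
    define w where "w x = lam (u x) (u y)" for x
    define x' where "x' = YB_g r y x1"
    have wc: "w x \<in> carrier G" if "x \<in> X" for x using that y by (simp add: w_def u_closed lam_closed)
    define k where "k = lam (u x' \<otimes> inv (u y)) (u y)"
    have x': "act (inv (w x)) x = x'" "lam (inv (w x)) (w x) = k" if "x = x1 \<or> x = x2" for x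
    proof -
      have xX: "x \<in> X" using that x by auto
      show 1: "act (inv (w x)) x = x'"
        using that eq r_eq[OF xX y] by (auto simp: x'_def YB_g_def w_def)
      have "u x' = inv (w x) \<otimes> u x \<otimes> u y" using 1 label_inv[OF xX y] by (simp add: w_def)
      then have "u x' \<otimes> inv (u y) = inv (w x) \<otimes> u x"
        using xX y wc u_closed by (simp add: word_simps)
      then have "k = lam (inv (w x)) (lam (u x) (u y))"
        using xX y wc u_closed by (simp add: k_def lam_mult)
      then show "lam (inv (w x)) (w x) = k" by (simp add: w_def)
    qed
    have "w x1 = w x2" using lam_inv_self_inj[of "w x1" "w x2"] x' wc x by simp
    then show "x1 = x2" using x'(1)[of x1] x'(1)[of x2] act_inv(2) wc x by metis
  qed
  have "bij_betw (YB_g r y) X X" if y: "y \<in> X" for y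
  proof -
    have "YB_g r y ` X \<subseteq> X" using r_closed y by (force simp: YB_g_def)
    then show ?thesis using g_inj[OF y] fin by (simp add: bij_betw_def endo_inj_surj)
  qed
  then have nondegenerate: "YB_nondegenerate X r"
    using act_bij u_closed f_eq by (auto simp: YB_nondegenerate_def cong: bij_betw_cong)
  define h where "h g = restrict (act g) X" for g
  interpret gh: group_action G X h
    unfolding h_def using is_group act_closed act_one act_mult by (rule group_actionI)
  interpret gh: group_hom G "BijGroup X" h by (rule gh.group_hom)
  have gens: "(\<lambda>x. restrict (YB_f r x) X) ` X = h ` carrier G"
    unfolding labels[symmetric] h_def image_image f_eq ..
  have "inj_on h (carrier G)"
  proof (rule gh.inj_on_one_iff[THEN iffD2], intro allI impI)
    fix g assume g: "g \<in> carrier G" "h g = \<one>\<^bsub>BijGroup X\<^esub>"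
    show "g = \<one>"
    proof (rule faithful[OF g(1)])
      fix x assume "x \<in> X"
      then show "act g x = x" using fun_cong[OF g(2), of x] by (simp add: h_def BijGroup_def)
    qed
  qed
  moreover have "carrier (YB_permutation_group X r) = h ` carrier G"
    unfolding YB_permutation_group_def gens
    by (rule subgroup.carrier_subgroup_generated_subgroup[OF gh.img_is_subgroup])
  ultimately have "h \<in> iso G (YB_permutation_group X r)"
    using gh.homh by (auto simp: iso_def bij_betw_def hom_def YB_permutation_group_def)
  then have "G \<cong> YB_permutation_group X r" by (rule is_isoI)
  then show ?thesis using solution involutive nondegenerate unfolding IYB_group_def by blast
qed

text \<open>
  \<open>G\<close> translates the first factor of \<open>G \<times> G\<close>, which makes the action faithful; the pair \<open>(b, a)\<close> is
  labelled by \<open>lam b a\<close>, so that the pairs \<open>(\<one>, a)\<close> already carry all labels.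
\<close>

theorem IYB_group:
  assumes fin: "finite (carrier G)"
  shows "IYB_group G"
proof -
  obtain e :: "'a \<times> 'a \<Rightarrow> nat" where e: "inj_on e (carrier G \<times> carrier G)"
    using finite_imp_inj_to_nat_seg[of "carrier G \<times> carrier G"] fin by blast
  define d where "d = the_inv_into (carrier G \<times> carrier G) e"
  have d: "d (e (a, b)) = (a, b)" if "a \<in> carrier G" "b \<in> carrier G" for a b
    using e that by (simp add: d_def the_inv_into_f_f)
  define X where "X = e ` (carrier G \<times> carrier G)"
  define act where "act g x = e (g \<otimes> fst (d x), snd (d x))" for g x
  define u where "u x = lam (fst (d x)) (snd (d x))" for x
  show ?thesis
  proof (rule IYB_group_of_labelled_action[of X act u])
    show "finite X" "X \<noteq> {}" using fin by (auto simp: X_def)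
    show "act g x \<in> X" if "g \<in> carrier G" "x \<in> X" for g x
      using that by (auto simp: act_def X_def d)
    show "act \<one> x = x" if "x \<in> X" for x using that by (auto simp: act_def X_def d)
    show "act (g \<otimes> h) x = act g (act h x)" if "g \<in> carrier G" "h \<in> carrier G" "x \<in> X" for g h x
      using that by (auto simp: act_def X_def d m_assoc)
    show "g = \<one>" if g: "g \<in> carrier G" and fixd: "\<And>x. x \<in> X \<Longrightarrow> act g x = x" for g
    proof -
      have "act g (e (\<one>, \<one>)) = e (\<one>, \<one>)" by (rule fixd) (simp add: X_def)
      then have "d (act g (e (\<one>, \<one>))) = d (e (\<one>, \<one>))" by simp
      then show ?thesis using g by (simp add: act_def d)
    qed
    show "u (act g x) = lam g (u x)" if "g \<in> carrier G" "x \<in> X" for g x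
      using that by (auto simp: act_def u_def X_def d lam_mult)
    have "u (e (\<one>, a)) = a" if "a \<in> carrier G" for a using that by (simp add: u_def d lam_one)
    moreover have "u ` X \<subseteq> carrier G" by (auto simp: X_def u_def d lam_closed)
    ultimately show "u ` X = carrier G" by (auto simp: X_def image_iff) (metis SigmaI one_closed)
  qed
qed

end

section \<open>One-cocycles\<close>

locale group_module = G?: group G + A: comm_group A
  for G :: "('a, 'b) monoid_scheme" (structure) and A :: "('c, 'd) monoid_scheme" +
  fixes \<sigma> :: "'a \<Rightarrow> 'c \<Rightarrow> 'c"
  assumes action_hom: "g \<in> carrier G \<Longrightarrow> \<sigma> g \<in> hom A A"
    and action_one: "v \<in> carrier A \<Longrightarrow> \<sigma> \<one> v = v"
    and action_mult: "\<lbrakk>g \<in> carrier G; h \<in> carrier G; v \<in> carrier A\<rbrakk> \<Longrightarrow> \<sigma> (g \<otimes> h) v = \<sigma> g (\<sigma> h v)"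
begin

lemma action_closed [simp]: "\<lbrakk>g \<in> carrier G; v \<in> carrier A\<rbrakk> \<Longrightarrow> \<sigma> g v \<in> carrier A"
  using action_hom by (rule hom_in_carrier)

lemma action_add:
  "\<lbrakk>g \<in> carrier G; v \<in> carrier A; w \<in> carrier A\<rbrakk> \<Longrightarrow> \<sigma> g (v \<otimes>\<^bsub>A\<^esub> w) = \<sigma> g v \<otimes>\<^bsub>A\<^esub> \<sigma> g w"
  using action_hom by (rule hom_mult)

lemma action_zero [simp]: "g \<in> carrier G \<Longrightarrow> \<sigma> g \<one>\<^bsub>A\<^esub> = \<one>\<^bsub>A\<^esub>"
  using action_hom A.is_group hom_one by blast

lemma action_neg: "\<lbrakk>g \<in> carrier G; v \<in> carrier A\<rbrakk> \<Longrightarrow> \<sigma> g (inv\<^bsub>A\<^esub> v) = inv\<^bsub>A\<^esub> (\<sigma> g v)"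
  using action_hom[of g] group_hom.hom_inv[of A A "\<sigma> g" v]
  by (simp add: group_hom_def group_hom_axioms_def)

lemma action_inv [simp]:
  assumes "g \<in> carrier G" "v \<in> carrier A"
  shows "\<sigma> (inv g) (\<sigma> g v) = v" "\<sigma> g (\<sigma> (inv g) v) = v"
  using assms by (simp_all add: action_one flip: action_mult)

end

locale one_cocycle = group_module +
  fixes \<pi> :: "'a \<Rightarrow> 'c"
  assumes cocycle_closed [simp]: "g \<in> carrier G \<Longrightarrow> \<pi> g \<in> carrier A"
    and cocycle_mult: "\<lbrakk>g \<in> carrier G; h \<in> carrier G\<rbrakk> \<Longrightarrow> \<pi> (g \<otimes> h) = \<pi> g \<otimes>\<^bsub>A\<^esub> \<sigma> g (\<pi> h)"
begin

lemma cocycle_one [simp]: "\<pi> \<one> = \<one>\<^bsub>A\<^esub>"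
  using cocycle_mult[of \<one> \<one>] by (simp add: action_one)

lemma cocycle_inv: "g \<in> carrier G \<Longrightarrow> \<pi> (inv g) = inv\<^bsub>A\<^esub> (\<sigma> (inv g) (\<pi> g))"
  using cocycle_mult[of "inv g" g] A.inv_equality[of "\<pi> (inv g)"] by simp

lemma IYB_group_of_bij_cocycle:
  assumes fin: "finite (carrier G)" and bij: "bij_betw \<pi> (carrier G) (carrier A)"
  shows "IYB_group G"
proof -
  define \<rho> where "\<rho> = the_inv_into (carrier G) \<pi>"
  have \<rho>\<pi>: "\<rho> (\<pi> g) = g" if "g \<in> carrier G" for g
    using bij that by (simp add: \<rho>_def the_inv_into_f_f bij_betw_def)
  have \<pi>\<rho>: "\<pi> (\<rho> v) = v" "\<rho> v \<in> carrier G" if "v \<in> carrier A" for v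
    using bij that f_the_inv_into_f_bij_betw[OF bij] the_inv_into_into[of \<pi> "carrier G" v]
    by (auto simp: \<rho>_def bij_betw_def)
  define lam where "lam g h = \<rho> (\<sigma> g (\<pi> h))" for g h
  interpret left_brace_action G lam
  proof
    show "lam a b \<in> carrier G" if "a \<in> carrier G" "b \<in> carrier G" for a b
      using that by (simp add: lam_def \<pi>\<rho>)
    show "lam \<one> b = b" if "b \<in> carrier G" for b
      using that by (simp add: lam_def action_one \<rho>\<pi>)
    show "lam (a \<otimes> b) c = lam a (lam b c)"
      if "a \<in> carrier G" "b \<in> carrier G" "c \<in> carrier G" for a b c
      using that by (simp add: lam_def action_mult \<pi>\<rho>)
    show "lam a b \<otimes> lam (inv (lam a b)) a = a \<otimes> b"
      if ab: "a \<in> carrier G" "b \<in> carrier G" for a b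
    proof -
      define w where "w = lam a b"
      have w: "w \<in> carrier G" "\<pi> w = \<sigma> a (\<pi> b)" using ab by (simp_all add: w_def lam_def \<pi>\<rho>)
      have "\<pi> (w \<otimes> lam (inv w) a) = \<pi> w \<otimes>\<^bsub>A\<^esub> \<pi> a"
        using ab w(1) by (simp add: cocycle_mult lam_def \<pi>\<rho>)
      also have "\<dots> = \<pi> (a \<otimes> b)" using ab w by (simp add: cocycle_mult A.m_comm)
      finally have "\<rho> (\<pi> (w \<otimes> lam (inv w) a)) = \<rho> (\<pi> (a \<otimes> b))" by simp
      then show ?thesis using ab w by (simp add: \<rho>\<pi> lam_def \<pi>\<rho> w_def)
    qed
  qed
  show ?thesis using fin by (rule IYB_group)
qed

end

context one_cocycle
begin

lemma subgroup_cocycle_zeros: "subgroup {g \<in> carrier G. \<pi> g = \<one>\<^bsub>A\<^esub>} G"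
proof (rule G.subgroupI)
  show "{g \<in> carrier G. \<pi> g = \<one>\<^bsub>A\<^esub>} \<noteq> {}" using G.one_closed cocycle_one by blast
qed (auto simp: cocycle_mult cocycle_inv)

lemma cocycle_eq_imp_zero:
  assumes "g \<in> carrier G" "x \<in> carrier G" "\<pi> x = \<pi> g"
  shows "\<pi> (inv g \<otimes> x) = \<one>\<^bsub>A\<^esub>"
proof -
  have "\<pi> (inv g \<otimes> x) = \<pi> (inv g) \<otimes>\<^bsub>A\<^esub> \<sigma> (inv g) (\<pi> x)"
    using assms(1,2) by (simp add: cocycle_mult)
  also have "\<dots> = \<one>\<^bsub>A\<^esub>"
    unfolding assms(3) cocycle_inv[OF assms(1)] using assms(1) by simp
  finally show ?thesis .
qed

text \<open>The fibres of a cocycle are the left cosets of its zero set.\<close>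

lemma card_cocycle_image:
  assumes fin: "finite (carrier G)"
  shows "card (\<pi> ` carrier G) * card {g \<in> carrier G. \<pi> g = \<one>\<^bsub>A\<^esub>} = card (carrier G)"
proof -
  define K where "K = {g \<in> carrier G. \<pi> g = \<one>\<^bsub>A\<^esub>}"
  have fibre: "card {x \<in> carrier G. \<pi> x = v} = card K" if v: "v \<in> \<pi> ` carrier G" for v
  proof -
    obtain g where g: "g \<in> carrier G" "v = \<pi> g" using v by blast
    have "bij_betw (\<lambda>k. g \<otimes> k) K {x \<in> carrier G. \<pi> x = v}"
    proof (rule bij_betw_byWitness[where f' = "\<lambda>x. inv g \<otimes> x"])
      show "(\<lambda>k. g \<otimes> k) ` K \<subseteq> {x \<in> carrier G. \<pi> x = v}"
        using g by (auto simp: cocycle_mult K_def)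
      show "(\<lambda>x. inv g \<otimes> x) ` {x \<in> carrier G. \<pi> x = v} \<subseteq> K"
        using g cocycle_eq_imp_zero[OF g(1)] unfolding K_def by blast
      show "\<forall>k\<in>K. inv g \<otimes> (g \<otimes> k) = k"
        using g(1) unfolding K_def by (blast intro: inv_mult_cancel)
      show "\<forall>x\<in>{x \<in> carrier G. \<pi> x = v}. g \<otimes> (inv g \<otimes> x) = x"
        using g(1) by (blast intro: inv_mult_cancel)
    qed
    then show ?thesis by (simp add: bij_betw_same_card)
  qed
  have "card (carrier G) = (\<Sum>v\<in>\<pi> ` carrier G. card {x \<in> carrier G. \<pi> x = v})"
    using sum.image_gen[OF fin, of "\<lambda>_. 1::nat" \<pi>] by simp
  also have "\<dots> = (\<Sum>v\<in>\<pi> ` carrier G. card K)" by (rule sum.cong[OF refl fibre])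
  finally show ?thesis by (simp add: K_def)
qed

end

lemma (in group) card_subgroup_dvd:
  assumes "subgroup H G" "subgroup K G" "H \<subseteq> K"
  shows "card H dvd card K"
proof -
  have "card (rcosets\<^bsub>G\<lparr>carrier := K\<rparr>\<^esub> H) * card H = card K"
    using group.lagrange[OF subgroup_imp_group[OF assms(2)] subgroup_incl[OF assms]]
    by (simp add: order_def)
  then show ?thesis by (metis dvd_triv_right)
qed

text \<open>
  The module lives on natural numbers so that cocycles which arise in quotients of different
  types can be compared.
\<close>

definition has_surj_cocycle :: "('a, 'b) monoid_scheme \<Rightarrow> nat \<Rightarrow> bool" where
  "has_surj_cocycle G n \<longleftrightarrow>
     (\<exists>(A :: nat monoid) \<sigma> \<pi>. one_cocycle G A \<sigma> \<pi> \<and> \<pi> ` carrier G = carrier A \<and> card (carrier A) = n)"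

lemma (in one_cocycle) has_surj_cocycleI:
  assumes fin: "finite (carrier G)" and surj: "\<pi> ` carrier G = carrier A"
  shows "has_surj_cocycle G (card (carrier A))"
proof -
  obtain e :: "'c \<Rightarrow> nat" where e: "inj_on e (carrier A)"
    using finite_imp_inj_to_nat_seg[of "carrier A"] fin surj[symmetric] by auto
  define d where "d = the_inv_into (carrier A) e"
  have d: "d (e v) = v" if "v \<in> carrier A" for v
    using e that by (simp add: d_def the_inv_into_f_f)
  define B where "B = \<lparr>carrier = e ` carrier A, monoid.mult = (\<lambda>x y. e (d x \<otimes>\<^bsub>A\<^esub> d y)), one = e \<one>\<^bsub>A\<^esub>\<rparr>"
  have B: "carrier B = e ` carrier A" "\<one>\<^bsub>B\<^esub> = e \<one>\<^bsub>A\<^esub>" "\<And>x y. x \<otimes>\<^bsub>B\<^esub> y = e (d x \<otimes>\<^bsub>A\<^esub> d y)"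
    by (simp_all add: B_def)
  interpret B: comm_group B
  proof (rule comm_groupI)
    fix x assume "x \<in> carrier B"
    then obtain v where v: "x = e v" "v \<in> carrier A" by (auto simp: B)
    show "\<exists>y\<in>carrier B. y \<otimes>\<^bsub>B\<^esub> x = \<one>\<^bsub>B\<^esub>"
      by (rule bexI[of _ "e (inv\<^bsub>A\<^esub> v)"]) (use v in \<open>simp_all add: B d\<close>)
  qed (auto simp: B d A.m_ac)
  interpret B: one_cocycle G B "\<lambda>g x. e (\<sigma> g (d x))" "\<lambda>g. e (\<pi> g)"
    by unfold_locales
      (auto simp: B d hom_def action_one action_mult action_add cocycle_mult)
  have "one_cocycle G B (\<lambda>g x. e (\<sigma> g (d x))) (\<lambda>g. e (\<pi> g))" by (rule B.one_cocycle_axioms)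
  moreover have "(\<lambda>g. e (\<pi> g)) ` carrier G = carrier B" unfolding B surj[symmetric] image_image ..
  moreover have "card (carrier B) = card (carrier A)" using e by (simp add: B card_image)
  ultimately show ?thesis unfolding has_surj_cocycle_def by blast
qed

lemma has_surj_cocycle_one:
  assumes "group G" "finite (carrier G)"
  shows "has_surj_cocycle G 1"
proof -
  interpret G: group G by fact
  interpret T: comm_group "singleton_group (0 :: nat)" by simp
  have "one_cocycle G (singleton_group (0 :: nat)) (\<lambda>g v. v) (\<lambda>g. 0)"
    unfolding one_cocycle_def group_module_def group_module_axioms_def one_cocycle_axioms_def
    using G.is_group T.comm_group_axioms by (auto simp: hom_def singleton_group_def)
  moreover have "(\<lambda>g. 0) ` carrier G = carrier (singleton_group 0)" using G.carrier_not_empty by auto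
  ultimately show ?thesis unfolding has_surj_cocycle_def
    by (intro exI[of _ "singleton_group 0"] exI[of _ "\<lambda>g v. v"] exI[of _ "\<lambda>g. 0"]) simp
qed

lemma has_surj_cocycle_mult:
  assumes fin: "finite (carrier G)" and cop: "coprime m n"
    and "has_surj_cocycle G m" "has_surj_cocycle G n"
  shows "has_surj_cocycle G (m * n)"
proof -
  obtain A :: "nat monoid" and \<sigma> \<pi> where 1: "one_cocycle G A \<sigma> \<pi>"
    "\<pi> ` carrier G = carrier A" "card (carrier A) = m"
    using assms(3) unfolding has_surj_cocycle_def by blast
  obtain B :: "nat monoid" and \<tau> \<rho> where 2: "one_cocycle G B \<tau> \<rho>"
    "\<rho> ` carrier G = carrier B" "card (carrier B) = n"
    using assms(4) unfolding has_surj_cocycle_def by blast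
  interpret a: one_cocycle G A \<sigma> \<pi> by fact
  interpret b: one_cocycle G B \<tau> \<rho> by fact
  interpret AB: comm_group "A \<times>\<times> B"
  proof (rule group.group_comm_groupI[OF DirProd_group[OF a.A.is_group b.A.is_group]])
    fix x y assume "x \<in> carrier (A \<times>\<times> B)" "y \<in> carrier (A \<times>\<times> B)"
    then show "x \<otimes>\<^bsub>A \<times>\<times> B\<^esub> y = y \<otimes>\<^bsub>A \<times>\<times> B\<^esub> x"
      using a.A.m_comm[of "fst x" "fst y"] b.A.m_comm[of "snd x" "snd y"] by (auto simp: mult_DirProd')
  qed
  interpret ab: one_cocycle G "A \<times>\<times> B" "\<lambda>g (v, w). (\<sigma> g v, \<tau> g w)" "\<lambda>g. (\<pi> g, \<rho> g)"
  proof
    show "(\<lambda>(v, w). (\<sigma> g v, \<tau> g w)) \<in> hom (A \<times>\<times> B) (A \<times>\<times> B)" if "g \<in> carrier G" for g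
      using that by (intro homI) (auto simp: a.action_add b.action_add)
    show "(case v of (v, w) \<Rightarrow> (\<sigma> \<one>\<^bsub>G\<^esub> v, \<tau> \<one>\<^bsub>G\<^esub> w)) = v" if "v \<in> carrier (A \<times>\<times> B)" for v
      using that by (auto simp: a.action_one b.action_one)
    show "(case v of (v, w) \<Rightarrow> (\<sigma> (g \<otimes>\<^bsub>G\<^esub> h) v, \<tau> (g \<otimes>\<^bsub>G\<^esub> h) w))
        = (case case v of (v, w) \<Rightarrow> (\<sigma> h v, \<tau> h w) of (v, w) \<Rightarrow> (\<sigma> g v, \<tau> g w))"
      if "g \<in> carrier G" "h \<in> carrier G" "v \<in> carrier (A \<times>\<times> B)" for g h v
      using that by (auto simp: a.action_mult b.action_mult)
    show "(\<pi> g, \<rho> g) \<in> carrier (A \<times>\<times> B)" if "g \<in> carrier G" for g using that by simp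
    show "(\<pi> (g \<otimes>\<^bsub>G\<^esub> h), \<rho> (g \<otimes>\<^bsub>G\<^esub> h))
        = (\<pi> g, \<rho> g) \<otimes>\<^bsub>A \<times>\<times> B\<^esub> (case (\<pi> h, \<rho> h) of (v, w) \<Rightarrow> (\<sigma> g v, \<tau> g w))"
      if "g \<in> carrier G" "h \<in> carrier G" for g h
      by (simp only: prod.case mult_DirProd a.cocycle_mult[OF that] b.cocycle_mult[OF that])
  qed
  let ?img = "(\<lambda>g. (\<pi> g, \<rho> g)) ` carrier G"
  let ?K = "{g \<in> carrier G. (\<pi> g, \<rho> g) = \<one>\<^bsub>A \<times>\<times> B\<^esub>}"
  \<comment> \<open>The joint zero set lies in either zero set, so both indices divide the size of the joint image.\<close>
  have dvd: "k dvd card ?img"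
    if c: "k * card L = card (carrier G)" and L: "subgroup L G" "?K \<subseteq> L" for k L
  proof -
    obtain q where q: "card L = card ?K * q"
      using a.G.card_subgroup_dvd[OF ab.subgroup_cocycle_zeros L] by (rule dvdE)
    have "card ?img * card ?K = k * q * card ?K"
      using ab.card_cocycle_image[OF fin] c q by (simp add: ac_simps)
    moreover have "card ?K > 0" 
      by (rule subgroup.finite_imp_card_positive[OF ab.subgroup_cocycle_zeros fin])
    ultimately show ?thesis by simp
  qed
  have "m dvd card ?img"
    by (rule dvd[OF _ a.subgroup_cocycle_zeros]) (use a.card_cocycle_image[OF fin] 1 in auto)
  moreover have "n dvd card ?img"
    by (rule dvd[OF _ b.subgroup_cocycle_zeros]) (use b.card_cocycle_image[OF fin] 2 in auto)
  ultimately have "m * n dvd card ?img" using cop by (simp add: divides_mult)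
  moreover have "card ?img > 0" using fin a.G.one_closed by (auto simp: card_gt_0_iff)
  ultimately have "m * n \<le> card ?img" by (simp add: dvd_imp_le)
  moreover have sub: "?img \<subseteq> carrier (A \<times>\<times> B)" by auto
  moreover have fAB: "finite (carrier (A \<times>\<times> B))"
    using fin 1 2 by (metis carrier_DirProd finite_SigmaI finite_imageI)
  moreover have card: "card (carrier (A \<times>\<times> B)) = m * n" using 1 2 by (simp add: card_cartesian_product)
  ultimately have "?img = carrier (A \<times>\<times> B)" by (metis card_seteq)
  then show ?thesis using ab.has_surj_cocycleI[OF fin] card by simp
qed

lemma (in group_hom) has_surj_cocycle_inflate:
  assumes fin: "finite (carrier G)" and surj: "h ` carrier G = carrier H"
    and "has_surj_cocycle H n"
  shows "has_surj_cocycle G n"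
proof -
  obtain A :: "nat monoid" and \<sigma> \<pi> where 1: "one_cocycle H A \<sigma> \<pi>"
    "\<pi> ` carrier H = carrier A" "card (carrier A) = n"
    using assms(3) unfolding has_surj_cocycle_def by blast
  interpret a: one_cocycle H A \<sigma> \<pi> by fact
  interpret b: one_cocycle G A "\<lambda>g. \<sigma> (h g)" "\<lambda>g. \<pi> (h g)"
    by unfold_locales (auto simp: a.action_one a.action_mult a.cocycle_mult intro: a.action_hom)
  show ?thesis using b.has_surj_cocycleI[OF fin] 1 surj by (metis image_image)
qed

text \<open>
  Zero sets of surjective cocycles onto groups of coprime orders are in general position, so one
  prime at a time is enough.
\<close>

theorem (in group) IYB_group_of_primewise_cocycles:
  assumes fin: "finite (carrier G)"
    and coc: "\<And>p. prime p \<Longrightarrow> has_surj_cocycle G (p ^ multiplicity p (card (carrier G)))"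
  shows "IYB_group G"
proof -
  let ?n = "card (carrier G)"
  have "has_surj_cocycle G (\<Prod>p\<in>Q. p ^ multiplicity p ?n)"
    if "finite Q" "Q \<subseteq> prime_factors ?n" for Q
    using that
  proof (induction Q rule: finite_induct)
    case empty
    then show ?case using has_surj_cocycle_one[OF is_group fin] by simp
  next
    case (insert p Q)
    have "coprime (p ^ multiplicity p ?n) (\<Prod>q\<in>Q. q ^ multiplicity q ?n)"
    proof (rule prod_coprime_right)
      fix q assume "q \<in> Q"
      then have "p \<noteq> q" "prime p" "prime q"
        using insert.hyps(2) insert.prems in_prime_factors_iff by blast+
      then show "coprime (p ^ multiplicity p ?n) (q ^ multiplicity q ?n)"
        by (simp add: primes_coprime)
    qed
    then show ?case using insert coc[of p] has_surj_cocycle_mult[OF fin] by (simp add: in_prime_factors_iff)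
  qed
  note step = this
  have pos: "?n > 0" using fin one_closed by (metis card_gt_0_iff empty_iff)
  have "has_surj_cocycle G ?n"
    using step[of "prime_factors ?n"] prime_factorization_nat[of ?n] pos by simp
  then obtain A :: "nat monoid" and \<sigma> \<pi> where 1: "one_cocycle G A \<sigma> \<pi>"
    "\<pi> ` carrier G = carrier A" "card (carrier A) = ?n"
    unfolding has_surj_cocycle_def by blast
  interpret one_cocycle G A \<sigma> \<pi> by fact
  have "inj_on \<pi> (carrier G)" using 1 fin by (simp add: eq_card_imp_inj_on)
  then show ?thesis using IYB_group_of_bij_cocycle[OF fin] 1 by (simp add: bij_betw_def)
qed

section \<open>Pairs of quadratic operators\<close>

lemma (in group) coprime_pow_eq_one:
  assumes a: "a \<in> carrier G" and pow: "a [^] (m :: nat) = \<one>" "a [^] (n :: nat) = \<one>" and cop: "coprime m n"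
  shows "a = \<one>"
proof -
  have "ord a dvd m" "ord a dvd n" using a pow pow_eq_id by auto
  then have "ord a = 1" using cop coprime_common_divisor_nat by blast
  then show ?thesis using a ord_eq_1 by simp
qed

lemma (in group) square_root_odd_pow:
  assumes a: "a \<in> carrier G" and pow: "a [^] (n :: nat) = \<one>" and odd: "odd n"
  shows "a = (a \<otimes> a) [^] ((n + 1) div 2)"
proof -
  have n: "n + 1 = 2 * ((n + 1) div 2)" using odd by simp
  have "a = a [^] (n + 1)" using a pow by simp
  also have "\<dots> = (a [^] (2 :: nat)) [^] ((n + 1) div 2)"
    by (subst n) (use a in \<open>simp only: nat_pow_pow\<close>)
  also have "a [^] (2 :: nat) = a \<otimes> a" using a by (simp add: numeral_2_eq_2)
  finally show ?thesis .
qed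

lemma (in group) square_inj_odd:
  assumes "a \<in> carrier G" "b \<in> carrier G" "a [^] (n :: nat) = \<one>" "b [^] n = \<one>" "odd n"
    and "a \<otimes> a = b \<otimes> b"
  shows "a = b"
  using assms square_root_odd_pow by metis

lemma (in comm_group) diff_eq_iff:
  assumes "a \<in> carrier G" "b \<in> carrier G" "c \<in> carrier G" "d \<in> carrier G"
  shows "a \<otimes> inv b = c \<otimes> inv d \<longleftrightarrow> a \<otimes> d = c \<otimes> b"
proof
  assume "a \<otimes> inv b = c \<otimes> inv d"
  then have "(a \<otimes> inv b) \<otimes> (b \<otimes> d) = (c \<otimes> inv d) \<otimes> (d \<otimes> b)" using assms by (simp add: m_comm[of b d])
  then show "a \<otimes> d = c \<otimes> b" using assms by (simp add: m_assoc)
next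
  assume "a \<otimes> d = c \<otimes> b"
  then have "(a \<otimes> d) \<otimes> (inv d \<otimes> inv b) = (c \<otimes> b) \<otimes> (inv b \<otimes> inv d)"
    using assms by (simp add: m_comm[of "inv b" "inv d"])
  then show "a \<otimes> inv b = c \<otimes> inv d" using assms by (simp add: m_assoc)
qed

text \<open>
  This disposes of unipotent operators of coprime order: if \<open>g\<close> moves \<open>v\<close> by \<open>w\<close> and fixes \<open>w\<close>, then
  the powers of \<open>g\<close> move \<open>v\<close> along a progression with step \<open>w\<close>, which closes at the order of \<open>g\<close>.
\<close>

lemma (in group) progression_closes:
  assumes f: "\<And>n :: nat. f n \<in> carrier G" and step: "\<And>n. f (Suc n) = f n \<otimes> w" and w: "w \<in> carrier G"
    and closes: "f m = f 0" and pow: "w [^] (n :: nat) = \<one>" and cop: "coprime m n"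
  shows "w = \<one>"
proof -
  have "f k = f 0 \<otimes> w [^] k" for k
    by (induction k) (use f w step in \<open>simp_all add: m_assoc\<close>)
  from this[of m] have "w [^] m = \<one>" using closes f w by simp
  then show ?thesis using coprime_pow_eq_one[OF w _ pow cop] by simp
qed

context group_module
begin

text \<open>The condition \<open>(x - 1)\<^sup>2 = 0\<close> on the operator \<open>x\<close>.\<close>

definition quadratic :: "'a \<Rightarrow> bool" where
  "quadratic x \<longleftrightarrow> (\<forall>v \<in> carrier A. \<sigma> x (\<sigma> x v) \<otimes>\<^bsub>A\<^esub> v = \<sigma> x v \<otimes>\<^bsub>A\<^esub> \<sigma> x v)"

lemma quadratic_inv:
  assumes "quadratic x" "x \<in> carrier G" "v \<in> carrier A"
  shows "\<sigma> x v \<otimes>\<^bsub>A\<^esub> \<sigma> (inv x) v = v \<otimes>\<^bsub>A\<^esub> v"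
proof -
  have "\<sigma> (inv x) v \<in> carrier A" using assms by simp
  then have "\<sigma> x (\<sigma> x (\<sigma> (inv x) v)) \<otimes>\<^bsub>A\<^esub> \<sigma> (inv x) v
      = \<sigma> x (\<sigma> (inv x) v) \<otimes>\<^bsub>A\<^esub> \<sigma> x (\<sigma> (inv x) v)"
    using assms(1) unfolding quadratic_def by blast
  then show ?thesis using assms(2,3) by simp
qed

lemma action_pow_fixed:
  assumes "g \<in> carrier G" "v \<in> carrier A" "\<sigma> g v = v"
  shows "\<sigma> (g [^] (n :: nat)) v = v"
  by (induction n) (use assms in \<open>simp_all add: action_one action_mult\<close>)

text \<open>Two quadratic elements \<open>x\<close> and \<open>y\<close>: in operator notation \<open>inv x = 2 - x\<close> and \<open>inv y = 2 - y\<close>, so that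
  \<open>inv x * y\<close> and \<open>y * inv x\<close> have the same sum with their inverses, namely \<open>2x + 2y - xy - yx\<close>.\<close>

lemma quadratic_pair:
  assumes xy: "x \<in> carrier G" "y \<in> carrier G" "quadratic x" "quadratic y"
    and c: "c = inv x \<otimes> y" and c': "c' = y \<otimes> inv x" and v: "v \<in> carrier A"
  shows quadratic_pair_trace:
      "\<sigma> c v \<otimes>\<^bsub>A\<^esub> \<sigma> (inv c) v = \<sigma> c' v \<otimes>\<^bsub>A\<^esub> \<sigma> (inv c') v"
    and quadratic_pair_diff:
      "(\<sigma> y v \<otimes>\<^bsub>A\<^esub> \<sigma> y v) \<otimes>\<^bsub>A\<^esub> \<sigma> (inv c) v = \<sigma> c' v \<otimes>\<^bsub>A\<^esub> (\<sigma> x v \<otimes>\<^bsub>A\<^esub> \<sigma> x v)"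
proof -
  let ?xy = "\<sigma> x (\<sigma> y v)" and ?yx = "\<sigma> y (\<sigma> x v)"
  let ?xx = "\<sigma> x v \<otimes>\<^bsub>A\<^esub> \<sigma> x v" and ?yy = "\<sigma> y v \<otimes>\<^bsub>A\<^esub> \<sigma> y v"
  have s: "\<sigma> c v = \<sigma> (inv x) (\<sigma> y v)" "\<sigma> (inv c) v = \<sigma> (inv y) (\<sigma> x v)"
    "\<sigma> c' v = \<sigma> y (\<sigma> (inv x) v)" "\<sigma> (inv c') v = \<sigma> x (\<sigma> (inv y) v)"
    using xy v by (simp_all add: c c' inv_mult_group action_mult)
  have car: "?xy \<in> carrier A" "?yx \<in> carrier A" "\<sigma> c v \<in> carrier A" "\<sigma> (inv c) v \<in> carrier A"
    "\<sigma> c' v \<in> carrier A" "\<sigma> (inv c') v \<in> carrier A" "\<sigma> x v \<in> carrier A" "\<sigma> y v \<in> carrier A"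
    using xy v by (simp_all add: s)
  have e1: "?xy \<otimes>\<^bsub>A\<^esub> \<sigma> c v = ?yy" using quadratic_inv[of x "\<sigma> y v"] xy v s by simp
  have e2: "?yx \<otimes>\<^bsub>A\<^esub> \<sigma> (inv c) v = ?xx" using quadratic_inv[of y "\<sigma> x v"] xy v s by simp
  have e3: "?yx \<otimes>\<^bsub>A\<^esub> \<sigma> c' v = ?yy"
    using arg_cong[OF quadratic_inv[of x v], of "\<sigma> y"] xy v s by (simp add: action_add)
  have e4: "?xy \<otimes>\<^bsub>A\<^esub> \<sigma> (inv c') v = ?xx"
    using arg_cong[OF quadratic_inv[of y v], of "\<sigma> x"] xy v s by (simp add: action_add)
  have "(?xy \<otimes>\<^bsub>A\<^esub> ?yx) \<otimes>\<^bsub>A\<^esub> (\<sigma> c v \<otimes>\<^bsub>A\<^esub> \<sigma> (inv c) v) = ?yy \<otimes>\<^bsub>A\<^esub> ?xx"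
    unfolding e1[symmetric] e2[symmetric] using car by (simp add: A.m_ac)
  also have "\<dots> = (?xy \<otimes>\<^bsub>A\<^esub> ?yx) \<otimes>\<^bsub>A\<^esub> (\<sigma> c' v \<otimes>\<^bsub>A\<^esub> \<sigma> (inv c') v)"
    unfolding e3[symmetric] e4[symmetric] using car by (simp add: A.m_ac)
  finally show "\<sigma> c v \<otimes>\<^bsub>A\<^esub> \<sigma> (inv c) v = \<sigma> c' v \<otimes>\<^bsub>A\<^esub> \<sigma> (inv c') v"
    using car by simp
  have "?yx \<otimes>\<^bsub>A\<^esub> (?yy \<otimes>\<^bsub>A\<^esub> \<sigma> (inv c) v) = ?yy \<otimes>\<^bsub>A\<^esub> ?xx"
    unfolding e2[symmetric] using car by (simp add: A.m_ac)
  also have "\<dots> = ?yx \<otimes>\<^bsub>A\<^esub> (\<sigma> c' v \<otimes>\<^bsub>A\<^esub> ?xx)"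
    unfolding e3[symmetric] using car by (simp add: A.m_ac)
  finally show "?yy \<otimes>\<^bsub>A\<^esub> \<sigma> (inv c) v = \<sigma> c' v \<otimes>\<^bsub>A\<^esub> ?xx"
    using car by simp
qed

text \<open>
  The operator \<open>c + inv c = c' + inv c'\<close> commutes with \<open>c'\<close>, and conjugation by \<open>c'\<close> takes \<open>c\<close> to \<open>z c\<close>.
  Hence \<open>z c + inv (z c) = c + inv c\<close>, that is \<open>(z c\<^sup>2 - 1) (z - 1) = 0\<close>. The same for the conjugate
  under \<open>c'\<close> leaves \<open>z\<^sup>2 = 1\<close> on the image of \<open>z - 1\<close>, so \<open>z\<close>, having odd order, is unipotent.
\<close>

lemma quadratic_pair_commutator_trivial:
  assumes xy: "x \<in> carrier G" "y \<in> carrier G" "quadratic x" "quadratic y"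
    and c: "c = inv x \<otimes> y" and c': "c' = y \<otimes> inv x"
    and z: "z = c' \<otimes> c \<otimes> inv c' \<otimes> inv c" and zc: "z \<otimes> c = c \<otimes> z" and zc': "z \<otimes> c' = c' \<otimes> z"
    and expA: "\<And>v. v \<in> carrier A \<Longrightarrow> v [^]\<^bsub>A\<^esub> (n :: nat) = \<one>\<^bsub>A\<^esub>"
    and expz: "z [^] (m :: nat) = \<one>" and odd: "odd m" and cop: "coprime m n"
    and v: "v \<in> carrier A"
  shows "\<sigma> z v = v"
proof -
  have car: "c \<in> carrier G" "c' \<in> carrier G" "z \<in> carrier G" using xy by (auto simp: c c' z)
  have c'c: "c' \<otimes> c = z \<otimes> c \<otimes> c'" using car by (simp add: z m_assoc)
  have trace: "\<sigma> z (\<sigma> c u) \<otimes>\<^bsub>A\<^esub> \<sigma> (inv z) (\<sigma> (inv c) u) = \<sigma> c u \<otimes>\<^bsub>A\<^esub> \<sigma> (inv c) u"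
    if u: "u \<in> carrier A" for u
  proof -
    define w where "w = \<sigma> (inv c') u"
    have w: "w \<in> carrier A" "\<sigma> c' w = u" using u car by (simp_all add: w_def)
    have cj: "c' \<otimes> c \<otimes> inv c' = z \<otimes> c"
      using car by (simp add: c'c m_assoc)
    have "inv (c' \<otimes> c \<otimes> inv c') = inv (c \<otimes> z)" unfolding cj zc ..
    then have cj': "c' \<otimes> inv c \<otimes> inv c' = inv z \<otimes> inv c"
      using car by (simp add: inv_mult_group m_assoc)
    have "\<sigma> c' (\<sigma> c w \<otimes>\<^bsub>A\<^esub> \<sigma> (inv c) w) = \<sigma> (c' \<otimes> c \<otimes> inv c') u \<otimes>\<^bsub>A\<^esub> \<sigma> (c' \<otimes> inv c \<otimes> inv c') u"
      using car u w by (simp add: action_add action_mult w_def)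
    also have "\<dots> = \<sigma> z (\<sigma> c u) \<otimes>\<^bsub>A\<^esub> \<sigma> (inv z) (\<sigma> (inv c) u)"
      unfolding cj cj' using car u by (simp add: action_mult)
    finally have "\<sigma> z (\<sigma> c u) \<otimes>\<^bsub>A\<^esub> \<sigma> (inv z) (\<sigma> (inv c) u) = \<sigma> c' (\<sigma> c' w \<otimes>\<^bsub>A\<^esub> \<sigma> (inv c') w)"
      using quadratic_pair_trace[OF xy c c' w(1)] by simp
    also have "\<dots> = \<sigma> c' u \<otimes>\<^bsub>A\<^esub> \<sigma> (inv c') u"
      using car u w by (simp add: action_add) (simp add: w_def)
    finally show ?thesis using quadratic_pair_trace[OF xy c c' u] by simp
  qed
  \<comment> \<open>On the image of \<open>z - 1\<close> the operator \<open>z c\<^sup>2\<close> is trivial; conjugating by \<open>c'\<close> turns \<open>z c\<^sup>2\<close> into \<open>z\<^sup>3 c\<^sup>2\<close>.\<close>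
  have zcc: "\<sigma> z (\<sigma> c (\<sigma> c w)) = w" if u: "u \<in> carrier A" and w: "w = \<sigma> z u \<otimes>\<^bsub>A\<^esub> inv\<^bsub>A\<^esub> u" for u w
  proof -
    have com: "\<sigma> c (\<sigma> z a) = \<sigma> z (\<sigma> c a)" if "a \<in> carrier A" for a
      using that car zc by (simp flip: action_mult)
    have "\<sigma> (inv z) (\<sigma> (inv c) (\<sigma> c u)) = \<sigma> (inv z) u" using u car by simp
    then have "\<sigma> z (\<sigma> c (\<sigma> c u)) \<otimes>\<^bsub>A\<^esub> \<sigma> (inv z) u = \<sigma> c (\<sigma> c u) \<otimes>\<^bsub>A\<^esub> u"
      using trace[of "\<sigma> c u"] u car by simp
    then have "\<sigma> z (\<sigma> z (\<sigma> c (\<sigma> c u)) \<otimes>\<^bsub>A\<^esub> \<sigma> (inv z) u) = \<sigma> z (\<sigma> c (\<sigma> c u) \<otimes>\<^bsub>A\<^esub> u)" by simp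
    then have "\<sigma> z (\<sigma> z (\<sigma> c (\<sigma> c u))) \<otimes>\<^bsub>A\<^esub> u = \<sigma> z u \<otimes>\<^bsub>A\<^esub> \<sigma> z (\<sigma> c (\<sigma> c u))"
      using u car by (simp add: action_add A.m_comm)
    then have "\<sigma> z (\<sigma> z (\<sigma> c (\<sigma> c u))) \<otimes>\<^bsub>A\<^esub> inv\<^bsub>A\<^esub> (\<sigma> z (\<sigma> c (\<sigma> c u))) = \<sigma> z u \<otimes>\<^bsub>A\<^esub> inv\<^bsub>A\<^esub> u"
      using u car by (simp add: A.diff_eq_iff)
    then show ?thesis using u car com by (simp add: w action_add action_neg)
  qed
  define w where "w = \<sigma> z v \<otimes>\<^bsub>A\<^esub> inv\<^bsub>A\<^esub> v"
  have wc: "w \<in> carrier A" using v car by (simp add: w_def)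
  have "\<sigma> c' w = \<sigma> z (\<sigma> c' v) \<otimes>\<^bsub>A\<^esub> inv\<^bsub>A\<^esub> (\<sigma> c' v)"
    using v car zc' by (simp add: w_def action_add action_neg flip: action_mult)
  then have 1: "\<sigma> z (\<sigma> c (\<sigma> c (\<sigma> c' w))) = \<sigma> c' w" using zcc[of "\<sigma> c' v"] v car by simp
  have 2: "\<sigma> c' (\<sigma> z (\<sigma> c (\<sigma> c w))) = \<sigma> c' w" using zcc[OF v w_def] by simp
  have "c' \<otimes> (z \<otimes> (c \<otimes> c)) = z \<otimes> (z \<otimes> (z \<otimes> (c \<otimes> (c \<otimes> c'))))"
  proof -
    have "c' \<otimes> (z \<otimes> (c \<otimes> c)) = z \<otimes> ((c' \<otimes> c) \<otimes> c)" using car zc' by (simp flip: m_assoc)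
    also have "\<dots> = z \<otimes> ((z \<otimes> c \<otimes> c') \<otimes> c)" by (simp only: c'c)
    also have "\<dots> = z \<otimes> (z \<otimes> (c \<otimes> (c' \<otimes> c)))" using car by (simp add: m_assoc)
    also have "\<dots> = z \<otimes> (z \<otimes> (c \<otimes> (z \<otimes> c \<otimes> c')))" by (simp only: c'c)
    also have "\<dots> = z \<otimes> (z \<otimes> ((c \<otimes> z) \<otimes> (c \<otimes> c')))" using car by (simp add: m_assoc)
    also have "\<dots> = z \<otimes> (z \<otimes> (z \<otimes> (c \<otimes> (c \<otimes> c'))))" unfolding zc[symmetric] using car by (simp add: m_assoc)
    finally show ?thesis .
  qed
  then have "\<sigma> (c' \<otimes> (z \<otimes> (c \<otimes> c))) w = \<sigma> (z \<otimes> (z \<otimes> (z \<otimes> (c \<otimes> (c \<otimes> c'))))) w" by simp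
  then have "\<sigma> c' w = \<sigma> z (\<sigma> z (\<sigma> c' w))"
    using 1 2 wc car by (simp add: action_mult)
  then have "\<sigma> c' w = \<sigma> c' (\<sigma> (z \<otimes> z) w)"
    using wc car zc' by (simp add: m_assoc flip: action_mult) (metis m_assoc)
  then have "\<sigma> (inv c') (\<sigma> c' w) = \<sigma> (inv c') (\<sigma> c' (\<sigma> (z \<otimes> z) w))" by simp
  then have zzw: "\<sigma> (z \<otimes> z) w = w" using wc car by simp
  have zw: "\<sigma> z w = w"
    using action_pow_fixed[OF _ wc zzw, of "(m + 1) div 2"] square_root_odd_pow[OF car(3) expz odd] car
    by simp
  have "w = \<one>\<^bsub>A\<^esub>"
  proof (rule A.progression_closes[where f = "\<lambda>k :: nat. \<sigma> (z [^] k) v" and w = w and m = m and n = n])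
    show "\<sigma> (z [^] Suc k) v = \<sigma> (z [^] k) v \<otimes>\<^bsub>A\<^esub> w" for k
    proof -
      have "\<sigma> z v = v \<otimes>\<^bsub>A\<^esub> w" using v car by (simp add: w_def A.m_lcomm[of v "\<sigma> z v"])
      then show ?thesis
        using v car wc zw by (simp add: action_mult action_add action_pow_fixed)
    qed
  qed (use v car wc expA expz cop in simp_all)
  then have "\<sigma> z v \<otimes>\<^bsub>A\<^esub> inv\<^bsub>A\<^esub> v \<otimes>\<^bsub>A\<^esub> v = v" using v by (simp add: w_def)
  then show ?thesis using v car by (simp add: A.m_assoc)
qed

text \<open>
  Here \<open>2 (y - x) = c' - inv c\<close> commutes with \<open>c\<close> and with \<open>c'\<close>. Since \<open>y = x c = c' x\<close>, this gives
  \<open>c f = f = c' f\<close> for \<open>f = c' - c\<close>. So \<open>inv c * c'\<close> is unipotent, and its order is prime to the exponent of \<open>A\<close>.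
\<close>

lemma quadratic_pair_commuting:
  assumes xy: "x \<in> carrier G" "y \<in> carrier G" "quadratic x" "quadratic y"
    and c: "c = inv x \<otimes> y" and c': "c' = y \<otimes> inv x" and comm: "c' \<otimes> c = c \<otimes> c'"
    and expA: "\<And>v. v \<in> carrier A \<Longrightarrow> v [^]\<^bsub>A\<^esub> (n :: nat) = \<one>\<^bsub>A\<^esub>" and oddn: "odd n"
    and expc: "c [^] (m :: nat) = \<one>" "c' [^] m = \<one>" and cop: "coprime m n"
    and v: "v \<in> carrier A"
  shows "\<sigma> c' v = \<sigma> c v"
proof -
  have car: "c \<in> carrier G" "c' \<in> carrier G" using xy by (auto simp: c c')
  have y: "y = x \<otimes> c" "y = c' \<otimes> x" using xy by (simp_all add: c c' m_assoc)
  have com: "\<sigma> c' (\<sigma> c u) = \<sigma> c (\<sigma> c' u)" if "u \<in> carrier A" for u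
    using that car comm by (simp flip: action_mult)
  have com_inv: "\<sigma> c' (\<sigma> (inv c) u) = \<sigma> (inv c) (\<sigma> c' u)" if "u \<in> carrier A" for u
    using com[of "\<sigma> (inv c) u"] that car by (metis action_closed action_inv inv_closed)
  have xc: "\<sigma> c' (\<sigma> x u) = \<sigma> x (\<sigma> c u)" "\<sigma> y u = \<sigma> x (\<sigma> c u)" if "u \<in> carrier A" for u
    using that car xy y by (simp_all flip: action_mult)
  note diff = quadratic_pair_diff[OF xy c c']
  define f where "f u = \<sigma> c' u \<otimes>\<^bsub>A\<^esub> inv\<^bsub>A\<^esub> (\<sigma> c u)" for u
  \<comment> \<open>\<open>2(y - x) = c' - inv c\<close> commutes with every operator \<open>g\<close> that commutes with \<open>c\<close> and \<open>c'\<close>.\<close>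
  have key: "\<sigma> g (\<sigma> y u) \<otimes>\<^bsub>A\<^esub> \<sigma> x (\<sigma> g u) = \<sigma> y (\<sigma> g u) \<otimes>\<^bsub>A\<^esub> \<sigma> g (\<sigma> x u)"
    if g: "g \<in> carrier G" and gc: "\<And>u. u \<in> carrier A \<Longrightarrow> \<sigma> g (\<sigma> c' u) = \<sigma> c' (\<sigma> g u)"
      "\<And>u. u \<in> carrier A \<Longrightarrow> \<sigma> g (\<sigma> (inv c) u) = \<sigma> (inv c) (\<sigma> g u)"
      and u: "u \<in> carrier A" for g u
  proof (rule A.square_inj_odd[OF _ _ _ _ oddn])
    let ?gy = "\<sigma> g (\<sigma> y u)" and ?xg = "\<sigma> x (\<sigma> g u)" and ?yg = "\<sigma> y (\<sigma> g u)" and ?gx = "\<sigma> g (\<sigma> x u)"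
      and ?k = "\<sigma> (inv c) (\<sigma> g u)" and ?l = "\<sigma> c' (\<sigma> g u)"
    have C: "?gy \<in> carrier A" "?xg \<in> carrier A" "?yg \<in> carrier A" "?gx \<in> carrier A"
      "?k \<in> carrier A" "?l \<in> carrier A" using g u xy car by simp_all
    have 1: "(?gy \<otimes>\<^bsub>A\<^esub> ?gy) \<otimes>\<^bsub>A\<^esub> ?k = ?l \<otimes>\<^bsub>A\<^esub> (?gx \<otimes>\<^bsub>A\<^esub> ?gx)"
      using arg_cong[OF diff[OF u], of "\<sigma> g"] g u xy car gc by (simp add: action_add)
    have 2: "(?yg \<otimes>\<^bsub>A\<^esub> ?yg) \<otimes>\<^bsub>A\<^esub> ?k = ?l \<otimes>\<^bsub>A\<^esub> (?xg \<otimes>\<^bsub>A\<^esub> ?xg)"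
      using diff[of "\<sigma> g u"] g u by simp
    have "(?k \<otimes>\<^bsub>A\<^esub> ?l) \<otimes>\<^bsub>A\<^esub> ((?gy \<otimes>\<^bsub>A\<^esub> ?xg) \<otimes>\<^bsub>A\<^esub> (?gy \<otimes>\<^bsub>A\<^esub> ?xg))
        = ((?gy \<otimes>\<^bsub>A\<^esub> ?gy) \<otimes>\<^bsub>A\<^esub> ?k) \<otimes>\<^bsub>A\<^esub> (?l \<otimes>\<^bsub>A\<^esub> (?xg \<otimes>\<^bsub>A\<^esub> ?xg))"
      using C by (simp add: A.m_ac)
    also have "\<dots> = (?l \<otimes>\<^bsub>A\<^esub> (?gx \<otimes>\<^bsub>A\<^esub> ?gx)) \<otimes>\<^bsub>A\<^esub> ((?yg \<otimes>\<^bsub>A\<^esub> ?yg) \<otimes>\<^bsub>A\<^esub> ?k)" using 1 2 by simp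
    also have "\<dots> = (?k \<otimes>\<^bsub>A\<^esub> ?l) \<otimes>\<^bsub>A\<^esub> ((?yg \<otimes>\<^bsub>A\<^esub> ?gx) \<otimes>\<^bsub>A\<^esub> (?yg \<otimes>\<^bsub>A\<^esub> ?gx))"
      using C by (simp add: A.m_ac)
    finally show "(?gy \<otimes>\<^bsub>A\<^esub> ?xg) \<otimes>\<^bsub>A\<^esub> (?gy \<otimes>\<^bsub>A\<^esub> ?xg) = (?yg \<otimes>\<^bsub>A\<^esub> ?gx) \<otimes>\<^bsub>A\<^esub> (?yg \<otimes>\<^bsub>A\<^esub> ?gx)"
      using C by (metis A.Units_eq A.Units_l_cancel A.m_closed)
  qed (use g u xy in \<open>simp_all add: expA\<close>)
  have f_closed: "f u \<in> carrier A" if "u \<in> carrier A" for u using that car by (simp add: f_def)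
  have cf: "\<sigma> c (f u) = f u" if u: "u \<in> carrier A" for u
  proof -
    have k: "\<sigma> c' (\<sigma> y u) \<otimes>\<^bsub>A\<^esub> \<sigma> x (\<sigma> c' u) = \<sigma> y (\<sigma> c' u) \<otimes>\<^bsub>A\<^esub> \<sigma> c' (\<sigma> x u)"
      by (rule key) (use u car com_inv in simp_all)
    have "\<sigma> x (\<sigma> c (\<sigma> c' u)) \<otimes>\<^bsub>A\<^esub> \<sigma> x (\<sigma> c u) = \<sigma> x (\<sigma> c' u) \<otimes>\<^bsub>A\<^esub> \<sigma> x (\<sigma> c (\<sigma> c u))"
      using k u car xy xc by (simp add: A.m_comm)
    then have "\<sigma> x (\<sigma> c (\<sigma> c' u) \<otimes>\<^bsub>A\<^esub> \<sigma> c u) = \<sigma> x (\<sigma> c' u \<otimes>\<^bsub>A\<^esub> \<sigma> c (\<sigma> c u))"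
      using u car xy by (simp add: action_add)
    then have "\<sigma> c (\<sigma> c' u) \<otimes>\<^bsub>A\<^esub> \<sigma> c u = \<sigma> c' u \<otimes>\<^bsub>A\<^esub> \<sigma> c (\<sigma> c u)"
      using u car xy action_inv(1) by (metis A.m_closed action_closed)
    then have "\<sigma> c (\<sigma> c' u) \<otimes>\<^bsub>A\<^esub> inv\<^bsub>A\<^esub> (\<sigma> c (\<sigma> c u)) = \<sigma> c' u \<otimes>\<^bsub>A\<^esub> inv\<^bsub>A\<^esub> (\<sigma> c u)"
      using u car by (simp add: A.diff_eq_iff)
    then show ?thesis using u car by (simp add: f_def action_add action_neg)
  qed
  have fc': "f (\<sigma> c' u) = f u" if u: "u \<in> carrier A" for u
  proof -
    define w where "w = \<sigma> (inv x) u"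
    have w: "w \<in> carrier A" "\<sigma> x w = u" using u xy by (simp_all add: w_def)
    have k: "\<sigma> c (\<sigma> y w) \<otimes>\<^bsub>A\<^esub> \<sigma> x (\<sigma> c w) = \<sigma> y (\<sigma> c w) \<otimes>\<^bsub>A\<^esub> \<sigma> c (\<sigma> x w)"
      by (rule key) (use w car com in simp_all)
    have y: "\<sigma> y w = \<sigma> c' u" "\<sigma> x (\<sigma> c w) = \<sigma> c' u" "\<sigma> y (\<sigma> c w) = \<sigma> c' (\<sigma> c' u)"
      using xc w car xy by (metis action_closed)+
    have "\<sigma> c (\<sigma> c' u) \<otimes>\<^bsub>A\<^esub> \<sigma> c' u = \<sigma> c' (\<sigma> c' u) \<otimes>\<^bsub>A\<^esub> \<sigma> c u"
      using k unfolding y w(2) .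
    then have "\<sigma> c' (\<sigma> c' u) \<otimes>\<^bsub>A\<^esub> \<sigma> c u = \<sigma> c' u \<otimes>\<^bsub>A\<^esub> \<sigma> c (\<sigma> c' u)"
      using u car by (simp add: A.m_comm)
    then show ?thesis using u car by (simp add: f_def A.diff_eq_iff)
  qed
  have "f v = \<one>\<^bsub>A\<^esub>"
  proof (rule A.progression_closes[where f = "\<lambda>k :: nat. \<sigma> (inv c [^] k) (\<sigma> (c' [^] k) v)" and m = m and n = n])
    have icf: "\<sigma> (inv c) (f v) = f v" using cf[OF v] f_closed[OF v] car by (metis action_inv(1))
    show "\<sigma> (inv c [^] Suc k) (\<sigma> (c' [^] Suc k) v) = \<sigma> (inv c [^] k) (\<sigma> (c' [^] k) v) \<otimes>\<^bsub>A\<^esub> f v" for k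
    proof -
      define u where "u = \<sigma> (c' [^] k) v"
      have u: "u \<in> carrier A" using v car by (simp add: u_def)
      have fu: "f u = f v" unfolding u_def
      proof (induction k)
        case (Suc k)
        have "\<sigma> (c' [^] Suc k) v = \<sigma> c' (\<sigma> (c' [^] k) v)"
          using v car by (simp only: nat_pow_Suc2 action_mult nat_pow_closed)
        then show ?case using Suc fc' v car by simp
      qed (use v action_one in simp)
      have c'u: "\<sigma> c' u = \<sigma> c u \<otimes>\<^bsub>A\<^esub> f v"
      proof -
        have "\<sigma> c' u = \<sigma> c u \<otimes>\<^bsub>A\<^esub> f u"
          using u car by (simp add: f_def A.m_lcomm[of "\<sigma> c u" "\<sigma> c' u"])
        then show ?thesis unfolding fu .
      qed
      have "\<sigma> (c' [^] Suc k) v = \<sigma> c' u"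
        using v car by (simp only: nat_pow_Suc2 u_def action_mult nat_pow_closed)
      then have "\<sigma> (inv c [^] Suc k) (\<sigma> (c' [^] Suc k) v) = \<sigma> (inv c [^] k) (\<sigma> (inv c) (\<sigma> c' u))"
        using u car by (simp add: action_mult)
      also have "\<sigma> (inv c) (\<sigma> c' u) = u \<otimes>\<^bsub>A\<^esub> f v"
        using u v car icf f_closed by (simp add: c'u action_add)
      also have "\<sigma> (inv c [^] k) (u \<otimes>\<^bsub>A\<^esub> f v) = \<sigma> (inv c [^] k) u \<otimes>\<^bsub>A\<^esub> f v"
        using u v car icf f_closed by (simp add: action_add action_pow_fixed)
      finally show ?thesis by (simp add: u_def)
    qed
    have "inv c [^] m = \<one>" using expc car by (simp add: nat_pow_inv)
    then show "\<sigma> (inv c [^] m) (\<sigma> (c' [^] m) v) = \<sigma> (inv c [^] (0::nat)) (\<sigma> (c' [^] (0::nat)) v)"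
      using expc by simp
  qed (use v car f_closed expA cop in simp_all)
  then have "\<sigma> c' v \<otimes>\<^bsub>A\<^esub> inv\<^bsub>A\<^esub> (\<sigma> c v) \<otimes>\<^bsub>A\<^esub> \<sigma> c v = \<sigma> c v" using v car by (simp add: f_def)
  then show ?thesis using v car by (simp add: A.m_assoc)
qed

end

section \<open>Conjugation and commutators\<close>

context group
begin

lemma commute_inv:
  assumes "x \<in> carrier G" "y \<in> carrier G" "x \<otimes> y = y \<otimes> x"
  shows "inv x \<otimes> y = y \<otimes> inv x"
proof -
  have "inv x \<otimes> (y \<otimes> x) \<otimes> inv x = inv x \<otimes> (x \<otimes> y) \<otimes> inv x" using assms(3) by simp
  then show ?thesis using assms(1,2) by (simp add: m_assoc)
qed

lemma commute_mult:
  assumes "x \<in> carrier G" "y \<in> carrier G" "z \<in> carrier G" "x \<otimes> z = z \<otimes> x" "y \<otimes> z = z \<otimes> y"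
  shows "x \<otimes> y \<otimes> z = z \<otimes> (x \<otimes> y)"
proof -
  have "x \<otimes> y \<otimes> z = x \<otimes> (z \<otimes> y)" using assms by (simp add: m_assoc)
  also have "\<dots> = (z \<otimes> x) \<otimes> y" using assms by (simp flip: m_assoc)
  finally show ?thesis using assms by (simp add: m_assoc)
qed

definition cj :: "'a \<Rightarrow> 'a \<Rightarrow> 'a" where
  "cj g x = g \<otimes> x \<otimes> inv g"

definition cmt :: "'a \<Rightarrow> 'a \<Rightarrow> 'a" where
  "cmt x y = x \<otimes> y \<otimes> inv x \<otimes> inv y"

lemma cj_closed [simp]: "\<lbrakk>g \<in> carrier G; x \<in> carrier G\<rbrakk> \<Longrightarrow> cj g x \<in> carrier G"
  by (simp add: cj_def)

lemma cmt_closed [simp]: "\<lbrakk>g \<in> carrier G; x \<in> carrier G\<rbrakk> \<Longrightarrow> cmt g x \<in> carrier G"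
  by (simp add: cmt_def)

lemma cj_mult: "\<lbrakk>g \<in> carrier G; x \<in> carrier G; y \<in> carrier G\<rbrakk> \<Longrightarrow> cj g (x \<otimes> y) = cj g x \<otimes> cj g y"
  by (simp add: cj_def word_simps)

lemma cj_cj: "\<lbrakk>g \<in> carrier G; h \<in> carrier G; x \<in> carrier G\<rbrakk> \<Longrightarrow> cj g (cj h x) = cj (g \<otimes> h) x"
  by (simp add: cj_def word_simps)

lemma cj_inv_cancel [simp]:
  "\<lbrakk>g \<in> carrier G; x \<in> carrier G\<rbrakk> \<Longrightarrow> cj (inv g) (cj g x) = x"
  "\<lbrakk>g \<in> carrier G; x \<in> carrier G\<rbrakk> \<Longrightarrow> cj g (cj (inv g) x) = x"
  by (simp_all add: cj_def word_simps)

lemma cj_one [simp]: "x \<in> carrier G \<Longrightarrow> cj \<one> x = x" "g \<in> carrier G \<Longrightarrow> cj g \<one> = \<one>"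
  by (simp_all add: cj_def)

lemma cj_group_hom: "g \<in> carrier G \<Longrightarrow> group_hom G G (cj g)"
  by unfold_locales (auto simp: hom_def cj_mult)

lemma cj_inv: "\<lbrakk>g \<in> carrier G; x \<in> carrier G\<rbrakk> \<Longrightarrow> cj g (inv x) = inv (cj g x)"
  using group_hom.hom_inv[OF cj_group_hom] by blast

lemma cj_pow: "\<lbrakk>g \<in> carrier G; x \<in> carrier G\<rbrakk> \<Longrightarrow> cj g (x [^] (n :: nat)) = cj g x [^] n"
  using group_hom.hom_nat_pow[OF cj_group_hom] by blast

lemma cj_cmt:
  "\<lbrakk>g \<in> carrier G; x \<in> carrier G; y \<in> carrier G\<rbrakk> \<Longrightarrow> cj g (cmt x y) = cmt (cj g x) (cj g y)"
  by (simp add: cmt_def cj_mult cj_inv)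

lemma inj_on_cj: "g \<in> carrier G \<Longrightarrow> inj_on (cj g) (carrier G)"
  by (rule inj_on_inverseI[where g = "cj (inv g)"]) simp

lemma cj_in_subgroup: "\<lbrakk>subgroup H G; g \<in> H; x \<in> H\<rbrakk> \<Longrightarrow> cj g x \<in> H"
  unfolding cj_def by (meson subgroup.m_closed subgroup.m_inv_closed)

lemma cmt_in_subgroup: "\<lbrakk>subgroup H G; g \<in> H; x \<in> H\<rbrakk> \<Longrightarrow> cmt g x \<in> H"
  unfolding cmt_def by (meson subgroup.m_closed subgroup.m_inv_closed)

lemma cmt_eq_cj: "\<lbrakk>g \<in> carrier G; x \<in> carrier G\<rbrakk> \<Longrightarrow> cmt g x = cj g x \<otimes> inv x"
  by (simp add: cj_def cmt_def)

lemma cmt_pow: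
  assumes a: "a \<in> carrier G" and b: "b \<in> carrier G" and za: "cmt a b \<otimes> a = a \<otimes> cmt a b"
  shows "cmt (a [^] (n :: nat)) b = cmt a b [^] n"
proof -
  let ?z = "cmt a b"
  have z: "?z \<in> carrier G" using a b by simp
  have ab: "a \<otimes> b = ?z \<otimes> (b \<otimes> a)" using a b by (simp add: cmt_def word_simps)
  have zan: "?z \<otimes> a [^] k = a [^] k \<otimes> ?z" for k :: nat
    using group_commutes_pow[OF za[symmetric] a z, of k] by simp
  have "a [^] n \<otimes> b = ?z [^] n \<otimes> (b \<otimes> a [^] n)"
  proof (induction n)
    case (Suc n)
    have "a [^] Suc n \<otimes> b = a [^] n \<otimes> (a \<otimes> b)" using a b by (simp add: m_assoc)
    also have "\<dots> = (a [^] n \<otimes> ?z) \<otimes> (b \<otimes> a)" unfolding ab using a b z by (simp add: m_assoc)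
    also have "\<dots> = ?z \<otimes> (a [^] n \<otimes> b) \<otimes> a" using a b z zan[of n] by (simp add: m_assoc flip: zan)
    also have "\<dots> = (?z \<otimes> ?z [^] n) \<otimes> (b \<otimes> a [^] Suc n)" unfolding Suc using a b z by (simp add: m_assoc)
    also have "?z \<otimes> ?z [^] n = ?z [^] Suc n" using z by (simp only: nat_pow_Suc2)
    finally show ?case .
  qed (use a b in simp)
  then have "a [^] n \<otimes> b \<otimes> inv (a [^] n) \<otimes> inv b = ?z [^] n \<otimes> (b \<otimes> a [^] n) \<otimes> inv (a [^] n) \<otimes> inv b" by simp
  also have "\<dots> = ?z [^] n" using a b z by (simp add: m_assoc)
  finally show ?thesis by (simp add: cmt_def)
qed

lemma cmt_eq_one_iff:
  assumes "a \<in> carrier G" "b \<in> carrier G"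
  shows "cmt a b = \<one> \<longleftrightarrow> a \<otimes> b = b \<otimes> a"
proof
  assume "cmt a b = \<one>"
  then have "cmt a b \<otimes> (b \<otimes> a) = b \<otimes> a" using assms by simp
  then show "a \<otimes> b = b \<otimes> a" using assms by (simp add: cmt_def word_simps)
next
  assume "a \<otimes> b = b \<otimes> a"
  then have "cmt a b = b \<otimes> a \<otimes> inv a \<otimes> inv b" by (simp add: cmt_def)
  then show "cmt a b = \<one>" using assms by (simp add: m_assoc)
qed

lemma cmt_in_derived: "\<lbrakk>x \<in> H; y \<in> H\<rbrakk> \<Longrightarrow> cmt x y \<in> derived G H"
  unfolding derived_def cmt_def by (rule generate.incl) blast

lemma cj_derived:
  assumes g: "g \<in> carrier G" and H: "H \<subseteq> carrier G" "cj g ` H \<subseteq> H"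
  shows "cj g ` derived G H \<subseteq> derived G H"
  using group_hom.derived_img[OF cj_group_hom[OF g] H(1)] mono_derived[OF H(2)] by simp

lemma cj_derived_pow:
  assumes g: "g \<in> carrier G" and H: "H \<subseteq> carrier G" "cj g ` H \<subseteq> H"
  shows "cj g ` (derived G ^^ n) H \<subseteq> (derived G ^^ n) H"
  by (induction n) (use assms cj_derived exp_of_derived_in_carrier in auto)

lemma derived_pow_solvable:
  assumes "solvable G" and H: "subgroup H G"
  obtains n where "(derived G ^^ n) H = {\<one>}"
proof -
  obtain n where n: "(derived G ^^ n) (carrier G) = {\<one>}"
    using assms(1) solvable_iff_trivial_derived_seq by blast
  have "(derived G ^^ n) H \<subseteq> {\<one>}"
    using mono_exp_of_derived[OF subgroup.subset[OF H], of n] n by simp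
  moreover have "\<one> \<in> (derived G ^^ n) H"
    using exp_of_derived_is_subgroup[OF H] subgroup.one_closed by blast
  ultimately show ?thesis using that by blast
qed

end

section \<open>Quadratic elements centralise odd soluble groups of coprime order\<close>

text \<open>
  For \<open>g \<in> Q\<close> put \<open>y = inv g * x * g\<close>, \<open>c = inv x * y\<close> and \<open>c' = y * inv x\<close>; the last two lie in \<open>Q\<close>. Both
  \<open>x\<close> and \<open>y\<close> centralise \<open>D\<close>, hence so do \<open>c\<close> and \<open>c'\<close>, and their commutator, which lies in \<open>D\<close>, is
  trivial. Then \<open>c = c'\<close>, which means that \<open>x\<close> commutes with \<open>c\<close>. Since the order of \<open>x\<close> and of its
  conjugate \<open>y = x * c\<close> divides \<open>k\<close>, so does the order of \<open>c\<close>, and \<open>c\<close> is trivial.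
\<close>

lemma (in group_module) quadratic_centralises_step:
  assumes x: "x \<in> carrier G" and Q: "subgroup Q G"
    and norm: "\<And>q. q \<in> Q \<Longrightarrow> cj x q \<in> Q" "\<And>q. q \<in> Q \<Longrightarrow> cj (inv x) q \<in> Q"
    and quad: "\<And>q. q \<in> Q \<Longrightarrow> quadratic (cj q x)"
    and D: "D \<subseteq> Q" "\<And>d. d \<in> D \<Longrightarrow> x \<otimes> d = d \<otimes> x" "\<And>a b. \<lbrakk>a \<in> Q; b \<in> Q\<rbrakk> \<Longrightarrow> cmt a b \<in> D"
      "\<And>q d. \<lbrakk>q \<in> Q; d \<in> D\<rbrakk> \<Longrightarrow> cj q d \<in> D"
    and expA: "\<And>v. v \<in> carrier A \<Longrightarrow> v [^]\<^bsub>A\<^esub> (n :: nat) = \<one>\<^bsub>A\<^esub>" and oddn: "odd n"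
    and expQ: "\<And>q. q \<in> Q \<Longrightarrow> q [^] (m :: nat) = \<one>" and oddm: "odd m" and cop: "coprime m n"
    and faithful: "\<And>q. \<lbrakk>q \<in> Q; \<And>v. v \<in> carrier A \<Longrightarrow> \<sigma> q v = v\<rbrakk> \<Longrightarrow> q = \<one>"
    and expx: "x [^] (k :: nat) = \<one>" and copx: "coprime k m"
    and g: "g \<in> Q"
  shows "x \<otimes> g = g \<otimes> x"
proof -
  have QG: "q \<in> carrier G" if "q \<in> Q" for q using Q that by (rule subgroup.mem_carrier)
  note gc = QG[OF g]
  define y where "y = cj (inv g) x"
  define c where "c = inv x \<otimes> y"
  define c' where "c' = y \<otimes> inv x"
  have yc: "y \<in> carrier G" using x gc by (simp add: y_def)
  have ig: "inv g \<in> Q" using Q g by (rule subgroup.m_inv_closed)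
  have "c = cj (inv x) (inv g) \<otimes> g" "c' = inv g \<otimes> cj x g"
    using x gc by (simp_all add: c_def c'_def y_def cj_def word_simps)
  then have cQ: "c \<in> Q" "c' \<in> Q" using norm g ig Q by (simp_all add: subgroup.m_closed)
  note cc = QG[OF cQ(1)] QG[OF cQ(2)]
  have qx: "quadratic x" using quad[OF subgroup.one_closed[OF Q]] x by simp
  have qy: "quadratic y" using quad[OF ig] by (simp add: y_def)
  have xc: "x \<otimes> c = y" "c' \<otimes> x = y" using x yc by (simp_all add: c_def c'_def m_assoc)
  have commD: "y \<otimes> d = d \<otimes> y" if d: "d \<in> D" for d
  proof -
    have dc: "d \<in> carrier G" using d D(1) QG by blast
    have "cj g d \<in> D" using D(4)[OF g d] .
    then have "x \<otimes> cj g d = cj g d \<otimes> x" by (rule D(2))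
    then have "cj (inv g) (x \<otimes> cj g d) = cj (inv g) (cj g d \<otimes> x)" by simp
    then show ?thesis using x gc dc by (simp add: cj_mult y_def)
  qed
  define z where "z = c' \<otimes> c \<otimes> inv c' \<otimes> inv c"
  have zD: "z \<in> D" using D(3)[OF cQ(2,1)] by (simp add: z_def cmt_def)
  have zc: "z \<in> carrier G" using cc by (simp add: z_def)
  have zcomm: "z \<otimes> c = c \<otimes> z" "z \<otimes> c' = c' \<otimes> z"
    using commute_mult[OF _ _ zc commute_inv[OF x zc D(2)[OF zD]] commD[OF zD]]
      commute_mult[OF _ _ zc commD[OF zD] commute_inv[OF x zc D(2)[OF zD]]] x yc
    by (simp_all add: c_def c'_def)
  have "\<sigma> z v = v" if "v \<in> carrier A" for v
    by (rule quadratic_pair_commutator_trivial[OF x yc qx qy c_def c'_def z_def zcomm expA _ oddm cop that])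
      (use zD D(1) expQ in auto)
  then have "z = \<one>" using faithful zD D(1) by blast
  then have "c' \<otimes> c \<otimes> inv c' \<otimes> inv c \<otimes> c \<otimes> c' = c \<otimes> c'" using cc by (simp add: z_def)
  then have comm: "c' \<otimes> c = c \<otimes> c'" using cc by (simp add: m_assoc)
  have eq: "\<sigma> c' v = \<sigma> c v" if "v \<in> carrier A" for v
    by (rule quadratic_pair_commuting[OF x yc qx qy c_def c'_def comm expA oddn _ _ cop that])
      (use expQ cQ in auto)
  have "inv c \<otimes> c' = \<one>"
  proof (rule faithful)
    show "inv c \<otimes> c' \<in> Q" using cQ Q by (simp add: subgroup.m_closed subgroup.m_inv_closed)
    show "\<sigma> (inv c \<otimes> c') v = v" if "v \<in> carrier A" for v
      using that cc eq by (simp add: action_mult)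
  qed
  then have "c \<otimes> (inv c \<otimes> c') = c" using cc by simp
  then have "c' = c" using cc by simp
  then have comm_xc: "x \<otimes> c = c \<otimes> x" using xc by simp
  \<comment> \<open>Now \<open>y = x c\<close> is conjugate to \<open>x\<close> and commutes with it, so \<open>c\<close> inherits the order of \<open>x\<close>.\<close>
  have "cj (inv g) (x [^] k) = (x \<otimes> c) [^] k" using x gc xc by (simp add: cj_pow y_def)
  then have "c [^] k = \<one>" using expx x gc cc pow_mult_distrib[OF comm_xc x cc(1)] by simp
  then have "c = \<one>" using coprime_pow_eq_one[OF cc(1) _ expQ[OF cQ(1)] copx] by simp
  then have "y = x" using xc x by simp
  moreover have "cj g y = x" using x gc by (simp add: y_def)
  ultimately have "x = cj g x" by simp
  then have "x \<otimes> g = cj g x \<otimes> g" by (rule arg_cong)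
  also have "\<dots> = g \<otimes> x" using x gc by (simp add: cj_def m_assoc)
  finally show ?thesis .
qed

text \<open>Climb the derived series of \<open>Q\<close> from the trivial term.\<close>

theorem (in group_module) quadratic_centralises:
  assumes x: "x \<in> carrier G" and Q: "subgroup Q G" and sol: "solvable G"
    and norm: "\<And>q. q \<in> Q \<Longrightarrow> cj x q \<in> Q" "\<And>q. q \<in> Q \<Longrightarrow> cj (inv x) q \<in> Q"
    and quad: "\<And>q. q \<in> Q \<Longrightarrow> quadratic (cj q x)"
    and expA: "\<And>v. v \<in> carrier A \<Longrightarrow> v [^]\<^bsub>A\<^esub> (n :: nat) = \<one>\<^bsub>A\<^esub>" and oddn: "odd n"
    and expQ: "\<And>q. q \<in> Q \<Longrightarrow> q [^] (m :: nat) = \<one>" and oddm: "odd m" and cop: "coprime m n"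
    and faithful: "\<And>q. \<lbrakk>q \<in> Q; \<And>v. v \<in> carrier A \<Longrightarrow> \<sigma> q v = v\<rbrakk> \<Longrightarrow> q = \<one>"
    and expx: "x [^] (k :: nat) = \<one>" and copx: "coprime k m"
    and g: "g \<in> Q"
  shows "x \<otimes> g = g \<otimes> x"
proof -
  define D where "D i = (derived G ^^ i) Q" for i
  obtain l where l: "D l = {\<one>}" using derived_pow_solvable[OF sol Q] by (auto simp: D_def)
  have sub: "subgroup (D i) G" for i unfolding D_def by (rule exp_of_derived_is_subgroup[OF Q])
  have Suc: "D (Suc i) = derived G (D i)" for i by (simp add: D_def)
  have dec: "D (Suc i) \<subseteq> D i" for i unfolding Suc by (rule derived_incl[OF subset_refl sub])
  have DQ: "D i \<subseteq> Q" for i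
  proof (induction i)
    case (Suc i)
    then show ?case using dec[of i] by blast
  qed (simp add: D_def)
  have "\<forall>g \<in> D i. x \<otimes> g = g \<otimes> x" if "i \<le> l" for i
    using that
  proof (induction i rule: inc_induct)
    case base
    show ?case using l x by simp
  next
    case (step i)
    show ?case
    proof
      fix g assume g: "g \<in> D i"
      show "x \<otimes> g = g \<otimes> x"
      proof (rule quadratic_centralises_step[OF x sub[of i] _ _ _ dec _ _ _ expA oddn _ oddm cop _ expx copx g])
        show "cj x q \<in> D i" if "q \<in> D i" for q
          using cj_derived_pow[OF x subgroup.subset[OF Q], of i] norm(1) that by (auto simp: D_def)
        show "cj (inv x) q \<in> D i" if "q \<in> D i" for q
          using cj_derived_pow[OF inv_closed[OF x] subgroup.subset[OF Q], of i] norm(2) that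
          by (auto simp: D_def)
        show "x \<otimes> d = d \<otimes> x" if "d \<in> D (Suc i)" for d using step.IH that by blast
        show "cmt a b \<in> D (Suc i)" if "a \<in> D i" "b \<in> D i" for a b
          unfolding Suc using that by (rule cmt_in_derived)
        show "cj q d \<in> D (Suc i)" if qd: "q \<in> D i" "d \<in> D (Suc i)" for q d
        proof -
          have "cmt q d \<in> D (Suc i)"
            using qd dec[of i] unfolding Suc by (intro cmt_in_derived) auto
          then have "cmt q d \<otimes> d \<in> D (Suc i)" using qd(2) by (rule subgroup.m_closed[OF sub])
          moreover have "q \<in> carrier G" "d \<in> carrier G"
            using qd subgroup.mem_carrier[OF sub] by auto
          ultimately show ?thesis by (simp add: cmt_def cj_def m_assoc)
        qed
      qed (use DQ quad expQ faithful in \<open>blast+\<close>)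
    qed
  qed
  from this[of 0] show ?thesis using g by (simp add: D_def)
qed

section \<open>Central bilinear forms\<close>

text \<open>
  The last axiom makes the commutator the alternating part of \<open>\<beta>\<close>. It is responsible for the
  commutativity of \<open>plus\<close> below; the others give associativity.
\<close>

locale central_form = group +
  fixes S :: "'a set" and \<beta> :: "'a \<Rightarrow> 'a \<Rightarrow> 'a"
  assumes S: "subgroup S G"
    and form_closed [simp]: "\<lbrakk>x \<in> S; y \<in> S\<rbrakk> \<Longrightarrow> \<beta> x y \<in> S"
    and form_central: "\<lbrakk>x \<in> S; y \<in> S; z \<in> S\<rbrakk> \<Longrightarrow> \<beta> x y \<otimes> z = z \<otimes> \<beta> x y"
    and form_left: "\<lbrakk>x \<in> S; y \<in> S; z \<in> S\<rbrakk> \<Longrightarrow> \<beta> (x \<otimes> y) z = \<beta> x z \<otimes> \<beta> y z"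
    and form_right: "\<lbrakk>x \<in> S; y \<in> S; z \<in> S\<rbrakk> \<Longrightarrow> \<beta> x (y \<otimes> z) = \<beta> x y \<otimes> \<beta> x z"
    and form_form: "\<lbrakk>x \<in> S; y \<in> S; z \<in> S\<rbrakk> \<Longrightarrow> \<beta> (\<beta> x y) z = \<one>" "\<lbrakk>x \<in> S; y \<in> S; z \<in> S\<rbrakk> \<Longrightarrow> \<beta> z (\<beta> x y) = \<one>"
    and form_cmt: "\<lbrakk>x \<in> S; y \<in> S\<rbrakk> \<Longrightarrow> \<beta> x y \<otimes> inv (\<beta> y x) = cmt x y"
begin

lemma S_carrier [simp]: "x \<in> S \<Longrightarrow> x \<in> carrier G"
  using S by (rule subgroup.mem_carrier)

lemma S_closed [simp]: "\<lbrakk>x \<in> S; y \<in> S\<rbrakk> \<Longrightarrow> x \<otimes> y \<in> S" "x \<in> S \<Longrightarrow> inv x \<in> S" "\<one> \<in> S"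
  using S by (auto intro: subgroup.m_closed subgroup.m_inv_closed subgroup.one_closed)

lemma form_one [simp]: "x \<in> S \<Longrightarrow> \<beta> \<one> x = \<one>" "x \<in> S \<Longrightarrow> \<beta> x \<one> = \<one>"
  using form_left[of \<one> \<one> x] form_right[of x \<one> \<one>] by simp_all

lemma form_inv: "\<lbrakk>x \<in> S; y \<in> S\<rbrakk> \<Longrightarrow> \<beta> (inv x) y = inv (\<beta> x y)" "\<lbrakk>x \<in> S; y \<in> S\<rbrakk> \<Longrightarrow> \<beta> x (inv y) = inv (\<beta> x y)"
proof -
  assume xy: "x \<in> S" "y \<in> S"
  have "\<beta> (inv x) y \<otimes> \<beta> x y = \<one>" using form_left[of "inv x" x y] xy by simp
  then show "\<beta> (inv x) y = inv (\<beta> x y)" using xy inv_equality[of _ "\<beta> x y"] by simp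
  have "\<beta> x (inv y) \<otimes> \<beta> x y = \<one>" using form_right[of x "inv y" y] xy by simp
  then show "\<beta> x (inv y) = inv (\<beta> x y)" using xy inv_equality[of _ "\<beta> x y"] by simp
qed

lemma inv_form_central: "\<lbrakk>x \<in> S; y \<in> S; z \<in> S\<rbrakk> \<Longrightarrow> inv (\<beta> x y) \<otimes> z = z \<otimes> inv (\<beta> x y)"
  using form_central[of "inv x" y z] by (simp add: form_inv)

definition plus :: "'a \<Rightarrow> 'a \<Rightarrow> 'a" where
  "plus x y = x \<otimes> y \<otimes> inv (\<beta> x y)"

definition additive :: "'a monoid" where
  "additive = \<lparr>carrier = S, monoid.mult = plus, one = \<one>\<rparr>"

lemma additive_simps [simp]:
  "carrier additive = S" "x \<otimes>\<^bsub>additive\<^esub> y = plus x y" "\<one>\<^bsub>additive\<^esub> = \<one>"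
  by (simp_all add: additive_def)

lemma plus_closed [simp]: "\<lbrakk>x \<in> S; y \<in> S\<rbrakk> \<Longrightarrow> plus x y \<in> S"
  by (simp add: plus_def)

lemma form_plus:
  assumes "x \<in> S" "y \<in> S" "z \<in> S"
  shows "\<beta> (plus x y) z = \<beta> x z \<otimes> \<beta> y z" "\<beta> z (plus x y) = \<beta> z x \<otimes> \<beta> z y"
  using assms by (simp_all add: plus_def form_left form_right form_inv form_form)

lemma plus_assoc:
  assumes "x \<in> S" "y \<in> S" "z \<in> S"
  shows "plus (plus x y) z = plus x (plus y z)"
proof -
  note C = inv_form_central and A = assms
  have "plus (plus x y) z = x \<otimes> (y \<otimes> (inv (\<beta> x y) \<otimes> z)) \<otimes> (inv (\<beta> y z) \<otimes> inv (\<beta> x z))"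
    using A by (simp add: plus_def[of "plus x y"] form_plus) (simp add: plus_def word_simps)
  also have "\<dots> = x \<otimes> (y \<otimes> (z \<otimes> (inv (\<beta> x y) \<otimes> (inv (\<beta> y z) \<otimes> inv (\<beta> x z)))))"
    using A by (simp add: C[of x y z] m_assoc)
  also have "inv (\<beta> x y) \<otimes> (inv (\<beta> y z) \<otimes> inv (\<beta> x z)) = inv (\<beta> y z) \<otimes> (inv (\<beta> x z) \<otimes> inv (\<beta> x y))"
    using A by (simp add: C[of x y "inv (\<beta> y z) \<otimes> inv (\<beta> x z)"] m_assoc)
  also have "x \<otimes> (y \<otimes> (z \<otimes> (inv (\<beta> y z) \<otimes> (inv (\<beta> x z) \<otimes> inv (\<beta> x y))))) = plus x (plus y z)"
    using A by (simp add: plus_def[of x] form_plus) (simp add: plus_def word_simps)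
  finally show ?thesis .
qed

lemma plus_comm:
  assumes "x \<in> S" "y \<in> S"
  shows "plus x y = plus y x"
proof -
  have "x \<otimes> y = cmt x y \<otimes> (y \<otimes> x)" using assms by (simp add: cmt_def word_simps)
  also have "\<dots> = \<beta> x y \<otimes> (inv (\<beta> y x) \<otimes> (y \<otimes> x))" using assms by (simp add: form_cmt[symmetric] m_assoc)
  also have "\<dots> = y \<otimes> x \<otimes> inv (\<beta> y x) \<otimes> \<beta> x y"
    using assms by (simp add: inv_form_central[of y x "y \<otimes> x"] form_central[of x y "y \<otimes> x \<otimes> inv (\<beta> y x)"])
  finally show ?thesis using assms by (simp add: plus_def m_assoc)
qed

lemma comm_group_additive: "comm_group additive"
proof (rule comm_groupI)
  fix x assume "x \<in> carrier additive"
  then have x: "x \<in> S" by simp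
  have "plus (inv x \<otimes> inv (\<beta> x x)) x = inv x \<otimes> (inv (\<beta> x x) \<otimes> x) \<otimes> \<beta> x x"
    using x by (simp add: plus_def form_left form_inv form_form m_assoc)
  also have "\<dots> = \<one>" using x by (simp add: inv_form_central[of x x x] m_assoc)
  finally show "\<exists>y\<in>carrier additive. y \<otimes>\<^bsub>additive\<^esub> x = \<one>\<^bsub>additive\<^esub>"
    using x by (intro bexI[of _ "inv x \<otimes> inv (\<beta> x x)"]) simp_all
  show "\<one>\<^bsub>additive\<^esub> \<otimes>\<^bsub>additive\<^esub> x = x" using x by (simp add: plus_def)
next
  fix x y assume "x \<in> carrier additive" "y \<in> carrier additive"
  then show "x \<otimes>\<^bsub>additive\<^esub> y = y \<otimes>\<^bsub>additive\<^esub> x" using plus_comm by simp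
qed (simp_all add: plus_assoc)

text \<open>The regular action of \<open>S\<close> is affine for \<open>plus\<close>, with linear part \<open>y \<mapsto> y * \<beta> x y\<close>;
  a complement acts through conjugation.\<close>

theorem has_surj_cocycle_of_complement:
  assumes fin: "finite (carrier G)" and H: "subgroup H G" and SH: "S \<inter> H = {\<one>}"
    and prod: "\<And>g. g \<in> carrier G \<Longrightarrow> \<exists>s\<in>S. \<exists>h\<in>H. g = s \<otimes> h"
    and normal: "\<And>g s. \<lbrakk>g \<in> carrier G; s \<in> S\<rbrakk> \<Longrightarrow> cj g s \<in> S"
    and form_cj: "\<And>g x y. \<lbrakk>g \<in> carrier G; x \<in> S; y \<in> S\<rbrakk> \<Longrightarrow> \<beta> (cj g x) (cj g y) = cj g (\<beta> x y)"
  shows "has_surj_cocycle G (card S)"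
proof -
  have HG [simp]: "h \<in> carrier G" if "h \<in> H" for h using H that by (rule subgroup.mem_carrier)
  have "\<exists>s h. s \<in> S \<and> h \<in> H \<and> g = s \<otimes> h" if "g \<in> carrier G" for g using prod[OF that] by blast
  then obtain sp hp where part: "\<And>g. g \<in> carrier G \<Longrightarrow> sp g \<in> S \<and> hp g \<in> H \<and> g = sp g \<otimes> hp g" by metis
  have unique: "sp (s \<otimes> h) = s \<and> hp (s \<otimes> h) = h" if s: "s \<in> S" and h: "h \<in> H" for s h
  proof -
    let ?s = "sp (s \<otimes> h)" and ?h = "hp (s \<otimes> h)"
    have p: "?s \<in> S" "?h \<in> H" "s \<otimes> h = ?s \<otimes> ?h" using part[of "s \<otimes> h"] s h by auto
    have "inv ?s \<otimes> (s \<otimes> h) \<otimes> inv h = inv ?s \<otimes> (?s \<otimes> ?h) \<otimes> inv h" using p(3) by simp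
    then have e: "inv ?s \<otimes> s = ?h \<otimes> inv h" using p(1,2) s h by (simp add: m_assoc)
    moreover have "inv ?s \<otimes> s \<in> S" using p s by simp
    moreover have "?h \<otimes> inv h \<in> H" using p h H by (simp add: subgroup.m_closed subgroup.m_inv_closed)
    ultimately have 1: "inv ?s \<otimes> s = \<one>" "?h \<otimes> inv h = \<one>" using SH by auto
    have "?s \<otimes> (inv ?s \<otimes> s) = ?s" "?h \<otimes> inv h \<otimes> h = h" using 1 p s h by simp_all
    then show ?thesis using p(1,2) s h by (simp add: m_assoc)
  qed
  define \<sigma> where "\<sigma> g v = cj (hp g) v \<otimes> \<beta> (sp g) (cj (hp g) v)" for g v
  interpret A: comm_group additive by (rule comm_group_additive)
  have mult_part: "sp (g \<otimes> g') = sp g \<otimes> cj (hp g) (sp g') \<and> hp (g \<otimes> g') = hp g \<otimes> hp g'"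
    if "g \<in> carrier G" "g' \<in> carrier G" for g g'
  proof -
    have p: "sp g \<in> S" "hp g \<in> H" "sp g' \<in> S" "hp g' \<in> H" using part that by auto
    have "g \<otimes> g' = (sp g \<otimes> hp g) \<otimes> (sp g' \<otimes> hp g')" using part that by metis
    also have "\<dots> = (sp g \<otimes> cj (hp g) (sp g')) \<otimes> (hp g \<otimes> hp g')" using p by (simp add: cj_def word_simps)
    finally show ?thesis using unique[of "sp g \<otimes> cj (hp g) (sp g')" "hp g \<otimes> hp g'"] p normal H
      by (simp add: subgroup.m_closed)
  qed
  have add_cj: "cj g (plus v w) = plus (cj g v) (cj g w)" if "g \<in> carrier G" "v \<in> S" "w \<in> S" for g v w
    using that by (simp add: plus_def cj_mult cj_inv form_cj)
  have add_tr: "plus v w \<otimes> \<beta> s (plus v w) = plus (v \<otimes> \<beta> s v) (w \<otimes> \<beta> s w)"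
    if A: "s \<in> S" "v \<in> S" "w \<in> S" for s v w
  proof -
    have "plus v w \<otimes> \<beta> s (plus v w) = v \<otimes> (w \<otimes> (inv (\<beta> v w) \<otimes> (\<beta> s v \<otimes> \<beta> s w)))"
      using A by (simp add: form_plus) (simp add: plus_def m_assoc)
    also have "\<dots> = v \<otimes> ((w \<otimes> \<beta> s v) \<otimes> (\<beta> s w \<otimes> inv (\<beta> v w)))"
      using A by (simp add: inv_form_central[of v w "\<beta> s v \<otimes> \<beta> s w"] m_assoc)
    also have "\<dots> = plus (v \<otimes> \<beta> s v) (w \<otimes> \<beta> s w)"
      using A by (simp add: plus_def form_left form_right form_form form_central[of s v w, symmetric] m_assoc)
    finally show ?thesis .
  qed
  interpret one_cocycle G additive \<sigma> sp
  proof
    fix g assume g: "g \<in> carrier G"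
    then have p: "sp g \<in> S" "hp g \<in> H" using part by auto
    then show "\<sigma> g \<in> hom additive additive"
      by (intro homI) (simp_all add: \<sigma>_def normal add_cj add_tr)
    show "sp g \<in> carrier additive" using p by simp
  next
    have "sp \<one> = \<one>" "hp \<one> = \<one>" using unique[of \<one> \<one>] H by (simp_all add: subgroup.one_closed)
    then show "\<sigma> \<one> v = v" if "v \<in> carrier additive" for v using that by (simp add: \<sigma>_def)
  next
    fix g g' v assume gg: "g \<in> carrier G" "g' \<in> carrier G" and "v \<in> carrier additive"
    then have v: "v \<in> S" by simp
    have p: "sp g \<in> S" "hp g \<in> H" "sp g' \<in> S" "hp g' \<in> H" using part gg by auto
    define w where "w = cj (hp g \<otimes> hp g') v"
    define s where "s = cj (hp g) (sp g')"
    have ws: "w \<in> S" "s \<in> S" using p v normal by (simp_all add: w_def s_def)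
    have "cj (hp g) (\<sigma> g' v) = w \<otimes> \<beta> s w"
      using p v normal by (simp add: \<sigma>_def cj_mult form_cj[symmetric] cj_cj w_def s_def)
    then have "\<sigma> g (\<sigma> g' v) = (w \<otimes> \<beta> s w) \<otimes> \<beta> (sp g) (w \<otimes> \<beta> s w)" by (simp add: \<sigma>_def[of g])
    also have "\<dots> = w \<otimes> (\<beta> s w \<otimes> \<beta> (sp g) w)" using ws p by (simp add: form_right form_form m_assoc)
    also have "\<dots> = w \<otimes> (\<beta> (sp g) w \<otimes> \<beta> s w)" using ws p by (simp add: form_central[of s w])
    also have "\<dots> = \<sigma> (g \<otimes> g') v"
      using ws p by (simp add: \<sigma>_def mult_part[OF gg] form_left s_def[symmetric] w_def[symmetric])
    finally show "\<sigma> (g \<otimes> g') v = \<sigma> g (\<sigma> g' v)" ..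
  next
    fix g g' assume gg: "g \<in> carrier G" "g' \<in> carrier G"
    have p: "sp g \<in> S" "hp g \<in> H" "sp g' \<in> S" "hp g' \<in> H" using part gg by auto
    define s where "s = cj (hp g) (sp g')"
    have s: "s \<in> S" using p normal by (simp add: s_def)
    have "plus (sp g) (s \<otimes> \<beta> (sp g) s) = sp g \<otimes> s"
      using s p by (simp add: plus_def form_right form_form m_assoc)
    then show "sp (g \<otimes> g') = sp g \<otimes>\<^bsub>additive\<^esub> \<sigma> g (sp g')"
      by (simp add: mult_part[OF gg] \<sigma>_def s_def)
  qed
  have "sp ` carrier G = S"
  proof
    show "sp ` carrier G \<subseteq> S" using part by blast
    show "S \<subseteq> sp ` carrier G"
    proof
      fix s assume s: "s \<in> S"
      then have "sp s = s" using unique[of s \<one>] H by (simp add: subgroup.one_closed)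
      then show "s \<in> sp ` carrier G" using s by (metis S_carrier imageI)
    qed
  qed
  then show ?thesis using has_surj_cocycleI[OF fin] by simp
qed

end

section \<open>Sylow subgroups of subgroups\<close>

text \<open>All orbits other than fixed points have a length divisible by \<open>p\<close>.\<close>

lemma (in group_action) fixed_point_of_p_group:
  assumes order: "order G = p ^ k" and p: "prime p" and E: "finite E" "\<not> p dvd card E"
  shows "\<exists>x\<in>E. \<forall>g\<in>carrier G. \<phi> g x = x"
proof (rule ccontr)
  assume no: "\<not> ?thesis"
  have "p dvd (\<Sum>y\<in>B. 1 :: nat)" if B: "B \<in> orbits G E \<phi>" for B
  proof -
    obtain x where x: "x \<in> E" "B = orbit G \<phi> x" using B unfolding orbits_def by blast
    have fB: "B \<subseteq> E" using B orbits_coverture by blast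
    have "card B dvd p ^ k" using orbit_stabilizer_theorem[OF x(1)] x(2) order by (metis dvd_triv_left)
    then obtain j where j: "card B = p ^ j" using divides_primepow_nat[OF p] by blast
    have "card B \<noteq> 1"
    proof
      assume "card B = 1"
      then obtain b where b: "B = {b}" using card_1_singletonE by blast
      have "\<phi> g x = x" if "g \<in> carrier G" for g
      proof -
        have "\<phi> g x \<in> B" using that x(2) by (auto simp: orbit_def)
        moreover have "x \<in> B" using orbit_refl[OF x(1)] x(2) by simp
        ultimately show ?thesis using b by simp
      qed
      then show False using no x(1) by blast
    qed
    then have "j \<noteq> 0" using j by (metis power_0)
    then show ?thesis using j by simp
  qed
  then have "p dvd (\<Sum>B\<in>orbits G E \<phi>. \<Sum>y\<in>B. 1 :: nat)" by (rule dvd_sum)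
  then show False using E disjoint_sum[OF E(1), of "\<lambda>_. 1 :: nat"] by simp
qed

locale finite_group = group +
  assumes fin: "finite (carrier G)"
begin

lemma finite_sub [simp]: "subgroup H G \<Longrightarrow> finite H"
  using fin subgroup.subset finite_subset by blast

lemma card_sub_pos: "subgroup H G \<Longrightarrow> card H > 0"
  using fin subgroup.finite_imp_card_positive by blast

lemma sub_pow_closed: "\<lbrakk>subgroup H G; x \<in> H\<rbrakk> \<Longrightarrow> x [^] (n :: nat) \<in> H"
  by (induction n) (auto simp: subgroup.one_closed subgroup.m_closed)

lemma sub_pow_card: 
  assumes "subgroup H G" "x \<in> H"
  shows "x [^] card H = \<one>"
proof -
  interpret H: group "G\<lparr>carrier := H\<rparr>" using assms(1) by (rule subgroup_imp_group)
  have "x [^]\<^bsub>G\<lparr>carrier := H\<rparr>\<^esub> order (G\<lparr>carrier := H\<rparr>) = \<one>"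
    using H.pow_order_eq_1[of x] assms by simp
  then show ?thesis by (simp add: order_def nat_pow_consistent[symmetric])
qed

definition sylow_in :: "nat \<Rightarrow> 'a set \<Rightarrow> 'a set \<Rightarrow> bool" where
  "sylow_in p M S \<longleftrightarrow> subgroup S G \<and> S \<subseteq> M \<and> card S = p ^ multiplicity p (card M)"

lemma exists_sylow_in:
  assumes "prime p" and M: "subgroup M G"
  obtains S where "sylow_in p M S"
proof -
  interpret M: group "G\<lparr>carrier := M\<rparr>" using M by (rule subgroup_imp_group)
  have "order (G\<lparr>carrier := M\<rparr>) = p ^ multiplicity p (card M) * (card M div p ^ multiplicity p (card M))"
    by (simp add: order_def multiplicity_dvd)
  from sylow_thm[OF assms(1) M.is_group this] obtain S where
    S: "subgroup S (G\<lparr>carrier := M\<rparr>)" "card S = p ^ multiplicity p (card M)"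
    using M by auto
  have "S \<subseteq> M" "subgroup S G"
    using S(1) subgroup.subset incl_subgroup[OF M] by fastforce+
  then show ?thesis using that S(2) by (auto simp: sylow_in_def)
qed

lemma index_not_dvd:
  assumes "sylow_in p M S" "prime p" "subgroup M G"
  shows "\<not> p dvd card (rcosets\<^bsub>G\<lparr>carrier := M\<rparr>\<^esub> S)"
proof
  let ?n = "card (rcosets\<^bsub>G\<lparr>carrier := M\<rparr>\<^esub> S)"
  assume "p dvd ?n"
  have S: "subgroup S G" "S \<subseteq> M" "card S = p ^ multiplicity p (card M)" using assms by (auto simp: sylow_in_def)
  have "?n * card S = card M"
    using group.lagrange[OF subgroup_imp_group[OF assms(3)] subgroup_incl[OF S(1) assms(3) S(2)]]
    by (simp add: order_def)
  moreover have "p * card S dvd ?n * card S" using \<open>p dvd ?n\<close> by (rule mult_dvd_mono) simp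
  ultimately have "p ^ Suc (multiplicity p (card M)) dvd card M" using S(3) by simp
  moreover have "\<not> is_unit p" "card M \<noteq> 0" using assms card_sub_pos[of M] by (auto simp: prime_nat_iff)
  ultimately have "Suc (multiplicity p (card M)) \<le> multiplicity p (card M)"
    using power_dvd_iff_le_multiplicity[of "card M" p] by blast
  then show False by simp
qed

text \<open>Every \<open>p\<close>-subgroup is conjugate into every Sylow \<open>p\<close>-subgroup: it fixes a coset.\<close>

lemma sylow_absorbs:
  assumes p: "prime p" and M: "subgroup M G" and S: "sylow_in p M S"
    and T: "subgroup T G" "T \<subseteq> M" "card T = p ^ k"
  obtains m where "m \<in> M" "cj m ` T \<subseteq> S"
proof -
  have SG: "subgroup S G" "S \<subseteq> M" using S by (auto simp: sylow_in_def)
  have MG: "x \<in> carrier G" if "x \<in> M" for x using M that by (rule subgroup.mem_carrier)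
  define E where "E = rcosets\<^bsub>G\<lparr>carrier := M\<rparr>\<^esub> S"
  have E_eq: "E = (\<lambda>m. S #> m) ` M" by (auto simp: E_def RCOSETS_def)
  have S_sub: "S \<subseteq> carrier G" using SG(1) by (rule subgroup.subset)
  interpret T: group "G\<lparr>carrier := T\<rparr>" using T(1) by (rule subgroup_imp_group)
  interpret act: group_action "G\<lparr>carrier := T\<rparr>" E "\<lambda>t. restrict (\<lambda>C. C #> inv t) E"
  proof (rule group_actionI[OF T.is_group])
    fix t C assume "t \<in> carrier (G\<lparr>carrier := T\<rparr>)" "C \<in> E"
    then obtain m where m: "t \<in> T" "m \<in> M" "C = S #> m" by (auto simp: E_eq)
    then have "C #> inv t = S #> (m \<otimes> inv t)" using T(2) MG S_sub by (auto simp: coset_mult_assoc)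
    moreover have "m \<otimes> inv t \<in> M" using m T(2) M by (auto intro: subgroup.m_closed subgroup.m_inv_closed)
    ultimately show "C #> inv t \<in> E" by (simp add: E_eq)
  next
    fix C assume "C \<in> E"
    then obtain m where m: "m \<in> M" "C = S #> m" by (auto simp: E_eq)
    then show "C #> inv \<one>\<^bsub>G\<lparr>carrier := T\<rparr>\<^esub> = C" using MG S_sub by (simp add: coset_mult_assoc)
  next
    fix g h C assume gh: "g \<in> carrier (G\<lparr>carrier := T\<rparr>)" "h \<in> carrier (G\<lparr>carrier := T\<rparr>)" and "C \<in> E"
    then obtain m where m: "m \<in> M" "C = S #> m" by (auto simp: E_eq)
    have "g \<in> carrier G" "h \<in> carrier G" using gh T(2) MG by auto
    then show "C #> inv (g \<otimes>\<^bsub>G\<lparr>carrier := T\<rparr>\<^esub> h) = (C #> inv h) #> inv g"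
      using m MG S_sub by (simp add: coset_mult_assoc inv_mult_group m_assoc)
  qed
  have "finite E" using M by (simp add: E_eq)
  moreover have "\<not> p dvd card E" unfolding E_def by (rule index_not_dvd[OF S p M])
  moreover have "order (G\<lparr>carrier := T\<rparr>) = p ^ k" using T(3) by (simp add: order_def)
  ultimately obtain C where C: "C \<in> E" "\<forall>t\<in>T. restrict (\<lambda>C. C #> inv t) E C = C"
    using act.fixed_point_of_p_group[of p k] p by auto
  then obtain m where m: "m \<in> M" "C = S #> m" by (auto simp: E_eq)
  have "cj m t \<in> S" if t: "t \<in> T" for t
  proof -
    have tG: "t \<in> carrier G" "m \<in> carrier G" using t T(2) m MG by auto
    have "S #> m #> inv t = S #> m" using C m t by simp
    then have "S #> (m \<otimes> inv t) = S #> m" using tG S_sub by (simp add: coset_mult_assoc)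
    then have "m \<otimes> inv t \<in> S #> m" using tG SG(1) rcos_self[of "m \<otimes> inv t" S] by simp
    then obtain s where s: "s \<in> S" "m \<otimes> inv t = s \<otimes> m" by (auto simp: r_coset_def)
    have "inv (cj m t) = s"
    proof -
      have "inv (cj m t) = (m \<otimes> inv t) \<otimes> inv m" using tG by (simp add: cj_def word_simps)
      also have "\<dots> = s" unfolding s(2) using s(1) S_sub tG by (auto simp: m_assoc)
      finally show ?thesis .
    qed
    then have "inv (inv (cj m t)) \<in> S" using s(1) SG(1) by (simp add: subgroup.m_inv_closed)
    then show ?thesis using tG by simp
  qed
  then show ?thesis using that m(1) by blast
qed

lemma subgroup_cj: "\<lbrakk>subgroup H G; g \<in> carrier G\<rbrakk> \<Longrightarrow> subgroup (cj g ` H) G"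
  using group_hom.subgroup_img_is_subgroup[OF cj_group_hom] by blast

lemma card_cj: "\<lbrakk>H \<subseteq> carrier G; g \<in> carrier G\<rbrakk> \<Longrightarrow> card (cj g ` H) = card H"
  using inj_on_cj by (meson card_image inj_on_subset)

lemma sylow_in_cj:
  assumes "sylow_in p M S" "subgroup M G" "g \<in> carrier G" "cj g ` M \<subseteq> M"
  shows "sylow_in p M (cj g ` S)"
proof -
  have "subgroup S G" "S \<subseteq> M" "card S = p ^ multiplicity p (card M)" using assms by (auto simp: sylow_in_def)
  moreover have "S \<subseteq> carrier G" using calculation subgroup.subset by blast
  ultimately show ?thesis using assms subgroup_cj[of S g] card_cj[of S g] by (auto simp: sylow_in_def)
qed

lemma sylow_conjugate:
  assumes "prime p" "subgroup M G" "sylow_in p M S" "sylow_in p M T"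
  obtains m where "m \<in> M" "cj m ` T = S"
proof -
  have T: "subgroup T G" "T \<subseteq> M" "card T = p ^ multiplicity p (card M)" using assms(4) by (auto simp: sylow_in_def)
  obtain m where m: "m \<in> M" "cj m ` T \<subseteq> S"
    by (rule sylow_absorbs[OF assms(1-3) T])
  have "m \<in> carrier G" "T \<subseteq> carrier G"
    using subgroup.mem_carrier[OF assms(2) m(1)] subgroup.subset[OF T(1)] by simp_all
  then have "card (cj m ` T) = card S" using card_cj[of T m] T(3) assms(3) by (simp add: sylow_in_def)
  moreover have "finite S" using assms(3) by (simp add: sylow_in_def)
  ultimately show ?thesis using that m card_subset_eq by metis
qed

definition p_element :: "nat \<Rightarrow> 'a \<Rightarrow> bool" where
  "p_element p x \<longleftrightarrow> (\<exists>k :: nat. x [^] (p ^ k) = \<one>)"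

lemma p_element_cj: "\<lbrakk>p_element p x; g \<in> carrier G; x \<in> carrier G\<rbrakk> \<Longrightarrow> p_element p (cj g x)"
  unfolding p_element_def using cj_pow cj_one(2) by metis

lemma sylow_elements: "sylow_in p M S \<Longrightarrow> x \<in> S \<Longrightarrow> p_element p x"
  unfolding sylow_in_def p_element_def using sub_pow_card by metis

lemma p_element_in_sylow:
  assumes p: "prime p" and M: "subgroup M G" and S: "sylow_in p M S"
    and x: "x \<in> M" "p_element p x"
  obtains m where "m \<in> M" "cj m x \<in> S"
proof -
  have xG: "x \<in> carrier G" using M x(1) by (rule subgroup.mem_carrier)
  obtain k where "x [^] (p ^ k) = \<one>" using x(2) by (auto simp: p_element_def)
  then have "ord x dvd p ^ k" using pow_eq_id xG by simp
  then obtain j where j: "ord x = p ^ j" using divides_primepow_nat[OF p] by blast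
  have T: "subgroup (generate G {x}) G" using xG by (simp add: generate_is_subgroup)
  have "generate G {x} \<subseteq> M" using x(1) M by (simp add: generate_subgroup_incl)
  moreover have "card (generate G {x}) = p ^ j" using generate_pow_card[OF xG] j by simp
  ultimately obtain m where "m \<in> M" "cj m ` generate G {x} \<subseteq> S"
    using sylow_absorbs[OF p M S T] by metis
  moreover have "x \<in> generate G {x}" by (simp add: generate.incl)
  ultimately show ?thesis using that by blast
qed

text \<open>
  Through this criterion the orders of products, images and preimages are controlled by
  computations with elements.
\<close>

lemma not_dvd_card_iff:
  assumes p: "prime p" and M: "subgroup M G"
  shows "\<not> p dvd card M \<longleftrightarrow> (\<forall>x\<in>M. p_element p x \<longrightarrow> x = \<one>)"
proof
  assume n: "\<not> p dvd card M"
  show "\<forall>x\<in>M. p_element p x \<longrightarrow> x = \<one>"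
  proof (intro ballI impI)
    fix x assume x: "x \<in> M" "p_element p x"
    then obtain k where k: "x [^] (p ^ k) = \<one>" by (auto simp: p_element_def)
    have "coprime (p ^ k) (card M)" using n p by (simp add: prime_imp_coprime)
    then show "x = \<one>"
      using coprime_pow_eq_one[OF subgroup.mem_carrier[OF M x(1)] k sub_pow_card[OF M x(1)]] by blast
  qed
next
  assume triv: "\<forall>x\<in>M. p_element p x \<longrightarrow> x = \<one>"
  obtain S where S: "sylow_in p M S" by (rule exists_sylow_in[OF p M])
  have "S \<subseteq> {\<one>}" using S triv sylow_elements[OF S] by (auto simp: sylow_in_def)
  then have "card S \<le> 1" using card_mono[of "{\<one>}" S] by simp
  then have "\<not> p ^ multiplicity p (card M) > 1" using S by (simp add: sylow_in_def)
  then have "multiplicity p (card M) = 0" using prime_gt_1_nat[OF p] one_less_power by (metis gr0I)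
  then show "\<not> p dvd card M"
    using p card_sub_pos[OF M] by (metis not_prime_unit not_dvd_imp_multiplicity_0 multiplicity_eq_zero_iff neq0_conv)
qed

section \<open>Normal subgroups of a subgroup\<close>

definition normal_in :: "'a set \<Rightarrow> 'a set \<Rightarrow> bool" where
  "normal_in H M \<longleftrightarrow> subgroup H G \<and> H \<subseteq> M \<and> (\<forall>g\<in>M. \<forall>h\<in>H. cj g h \<in> H)"

lemma normal_in_mult:
  assumes M: "subgroup M G" and H: "normal_in H M" and K: "normal_in K M"
  shows "normal_in (H <#> K) M"
proof -
  have MG: "x \<in> carrier G" if "x \<in> M" for x using M that by (rule subgroup.mem_carrier)
  have sub: "subgroup H G" "subgroup K G" "H \<subseteq> M" "K \<subseteq> M" using H K by (auto simp: normal_in_def)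
  have G: "x \<in> carrier G" if "x \<in> H \<or> x \<in> K" for x using that sub MG by blast
  have "subgroup (H <#> K) G"
  proof (rule subgroupI)
    show "H <#> K \<subseteq> carrier G" using G by (auto simp: set_mult_def)
    show "H <#> K \<noteq> {}" using sub(1,2) subgroup.one_closed by (force simp: set_mult_def)
  next
    fix a assume "a \<in> H <#> K"
    then obtain h k where hk: "h \<in> H" "k \<in> K" "a = h \<otimes> k" by (auto simp: set_mult_def)
    have "inv a = cj (inv k) (inv h) \<otimes> inv k" using hk G by (simp add: cj_def word_simps)
    moreover have "cj (inv k) (inv h) \<in> H"
      using H hk sub by (auto simp: normal_in_def subgroup.m_inv_closed subset_iff)
    moreover have "inv k \<in> K" using hk sub by (simp add: subgroup.m_inv_closed)
    ultimately show "inv a \<in> H <#> K" by (auto simp: set_mult_def)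
  next
    fix a b assume "a \<in> H <#> K" "b \<in> H <#> K"
    then obtain h k h' k' where hk: "h \<in> H" "k \<in> K" "a = h \<otimes> k" "h' \<in> H" "k' \<in> K" "b = h' \<otimes> k'"
      by (auto simp: set_mult_def)
    have "a \<otimes> b = (h \<otimes> cj k h') \<otimes> (k \<otimes> k')" using hk G by (simp add: cj_def word_simps)
    moreover have "h \<otimes> cj k h' \<in> H" using H hk sub by (auto simp: normal_in_def subgroup.m_closed subset_iff)
    moreover have "k \<otimes> k' \<in> K" using hk sub by (simp add: subgroup.m_closed)
    ultimately show "a \<otimes> b \<in> H <#> K" by (auto simp: set_mult_def)
  qed
  moreover have "H <#> K \<subseteq> M" using sub M by (auto simp: set_mult_def intro: subgroup.m_closed)
  moreover have "cj g x \<in> H <#> K" if g: "g \<in> M" and x: "x \<in> H <#> K" for g x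
  proof -
    obtain h k where hk: "h \<in> H" "k \<in> K" "x = h \<otimes> k" using x by (auto simp: set_mult_def)
    have "cj g x = cj g h \<otimes> cj g k" using hk G MG[OF g] by (simp add: cj_mult)
    moreover have "cj g h \<in> H" "cj g k \<in> K" using H K hk g by (auto simp: normal_in_def)
    ultimately show ?thesis by (auto simp: set_mult_def)
  qed
  ultimately show ?thesis by (simp add: normal_in_def)
qed

text \<open>Modulo \<open>H\<close> the powers of an element \<open>h k\<close> are those of \<open>k\<close>, so its order divides the product of the orders.\<close>

lemma normal_in_mult_p':
  assumes p: "prime p" and M: "subgroup M G" and H: "normal_in H M" "\<not> p dvd card H" and K: "normal_in K M" "\<not> p dvd card K"
  shows "\<not> p dvd card (H <#> K)"
proof -
  have sub: "subgroup H G" "subgroup K G" "H \<subseteq> M" "K \<subseteq> M" using H K by (auto simp: normal_in_def)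
  have HK: "subgroup (H <#> K) G" using normal_in_mult[OF M H(1) K(1)] by (simp add: normal_in_def)
  have "x = \<one>" if x: "x \<in> H <#> K" "p_element p x" for x
  proof -
    obtain h k where hk: "h \<in> H" "k \<in> K" "x = h \<otimes> k" using x(1) by (auto simp: set_mult_def)
    have G: "h \<in> carrier G" "k \<in> carrier G"
      using subgroup.mem_carrier[OF sub(1) hk(1)] subgroup.mem_carrier[OF sub(2) hk(2)] by simp_all
    have "\<exists>h'\<in>H. x [^] n = h' \<otimes> k [^] n" for n :: nat
    proof (induction n)
      case 0
      show ?case using subgroup.one_closed[OF sub(1)] by (intro bexI[of _ \<one>]) simp_all
    next
      case (Suc n)
      then obtain h' where h': "h' \<in> H" "x [^] n = h' \<otimes> k [^] n" by blast
      have h'G: "h' \<in> carrier G" using subgroup.mem_carrier[OF sub(1) h'(1)] .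
      have "x [^] Suc n = h' \<otimes> (k [^] n \<otimes> h \<otimes> k)"
        using h' h'G hk G by (simp add: m_assoc)
      also have "\<dots> = (h' \<otimes> cj (k [^] n) h) \<otimes> k [^] Suc n" using h'G G by (simp add: cj_def word_simps)
      finally have "x [^] Suc n = (h' \<otimes> cj (k [^] n) h) \<otimes> k [^] Suc n" .
      moreover have "k [^] n \<in> M" using sub_pow_closed[OF sub(2) hk(2)] sub by blast
      then have "h' \<otimes> cj (k [^] n) h \<in> H" using H(1) h' hk sub(1) by (simp add: normal_in_def subgroup.m_closed)
      ultimately show ?case by blast
    qed
    then obtain h' where h': "h' \<in> H" "x [^] card K = h' \<otimes> k [^] card K" by blast
    then have "x [^] card K \<in> H"
      using sub_pow_card[OF sub(2) hk(2)] subgroup.mem_carrier[OF sub(1) h'(1)] by simp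
    then have "(x [^] card K) [^] card H = \<one>" using sub_pow_card[OF sub(1)] by blast
    moreover have xG: "x \<in> carrier G" using hk G by simp
    ultimately have 1: "x [^] (card K * card H) = \<one>" by (simp add: nat_pow_pow)
    obtain j where j: "x [^] (p ^ j) = \<one>" using x(2) by (auto simp: p_element_def)
    have "coprime (p ^ j) (card K * card H)"
      using H(2) K(2) p by (simp add: prime_imp_coprime)
    then show ?thesis using coprime_pow_eq_one[OF xG j 1] by blast
  qed
  then show ?thesis using not_dvd_card_iff[OF p HK] by blast
qed

lemma p'_core_exists:
  assumes p: "prime p" and M: "subgroup M G"
  obtains K where "normal_in K M" "\<not> p dvd card K" "\<And>L. normal_in L M \<Longrightarrow> \<not> p dvd card L \<Longrightarrow> L \<subseteq> K"
proof -
  let ?P = "\<lambda>K. normal_in K M \<and> \<not> p dvd card K"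
  have "normal_in {\<one>} M"
    using subgroup.one_closed[OF M] subgroup.mem_carrier[OF M] triv_subgroup by (simp add: normal_in_def)
  then have P1: "?P {\<one>}" using p by (simp add: prime_nat_iff)
  have bound: "\<forall>K. ?P K \<longrightarrow> card K < Suc (card M)"
    using M by (simp add: normal_in_def card_mono less_Suc_eq_le)
  obtain K where K: "?P K" "\<forall>L. ?P L \<longrightarrow> card L \<le> card K"
    using Lattices_Big.ex_has_greatest_nat[of ?P, OF P1 bound] by blast
  have "L \<subseteq> K" if L: "normal_in L M" "\<not> p dvd card L" for L
  proof -
    have KL: "normal_in (K <#> L) M" "\<not> p dvd card (K <#> L)"
      using normal_in_mult[OF M _ L(1)] normal_in_mult_p'[OF p M _ _ L] K(1) by simp_all
    have sub: "subgroup K G" "subgroup L G" "subgroup (K <#> L) G" using K(1) L KL by (auto simp: normal_in_def)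
    have "k \<in> K <#> L" if "k \<in> K" for k
    proof -
      have "k \<otimes> \<one> \<in> K <#> L" using that subgroup.one_closed[OF sub(2)] by (auto simp: set_mult_def)
      then show ?thesis using subgroup.mem_carrier[OF sub(1) that] by simp
    qed
    then have "K \<subseteq> K <#> L" by blast
    then have "K = K <#> L" using K(2) KL by (intro card_seteq finite_sub[OF sub(3)]) auto
    moreover have "l \<in> K <#> L" if "l \<in> L" for l
    proof -
      have "\<one> \<otimes> l \<in> K <#> L" using that subgroup.one_closed[OF sub(1)] by (auto simp: set_mult_def)
      then show ?thesis using subgroup.mem_carrier[OF sub(2) that] by simp
    qed
    ultimately show ?thesis by blast
  qed
  then show ?thesis using that K(1) by blast
qed

end

context finite_group
begin

section \<open>Subgroups of prime index\<close>

lemma coprime_powers_in_subgroup: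
  assumes H: "subgroup H G" and x: "x \<in> carrier G" "x [^] (a :: nat) \<in> H" "x [^] (b :: nat) \<in> H" and cop: "coprime a b"
  shows "x \<in> H"
proof (cases "b = 1")
  case True
  then show ?thesis using x by simp
next
  case False
  obtain u v where uv: "a * u = b * v + 1" using coprime_bezout_strong[OF cop False] by blast
  have "x [^] (a * u) = x [^] (b * v) \<otimes> x" using x(1) by (simp add: uv)
  then have "inv (x [^] (b * v)) \<otimes> x [^] (a * u) = x" using x(1) by simp
  moreover have "x [^] (a * u) \<in> H" "x [^] (b * v) \<in> H"
    using sub_pow_closed[OF H x(2), of u] sub_pow_closed[OF H x(3), of v] x(1) by (simp_all add: nat_pow_pow)
  ultimately show ?thesis using subgroup.m_closed[OF H subgroup.m_inv_closed[OF H]] by metis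
qed

text \<open>The subgroup generated by \<open>x\<close> and a subgroup \<open>L\<close> that \<open>x\<close> normalises, in a finite group.\<close>

definition cyc_ext :: "'a set \<Rightarrow> 'a \<Rightarrow> 'a set" where
  "cyc_ext L x = {l \<otimes> x [^] i | l i. l \<in> L \<and> i \<in> (UNIV :: nat set)}"

lemma cyc_extI: "l \<in> L \<Longrightarrow> l \<otimes> x [^] (i :: nat) \<in> cyc_ext L x"
  by (auto simp: cyc_ext_def)

lemma cyc_extE:
  assumes "y \<in> cyc_ext L x"
  obtains l and i :: nat where "l \<in> L" "y = l \<otimes> x [^] i"
  using assms by (auto simp: cyc_ext_def)

lemma cyc_ext:
  assumes M: "subgroup M G" and L: "normal_in L M" and x: "x \<in> M"
  shows subgroup_cyc_ext: "subgroup (cyc_ext L x) G"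
    and cyc_ext_upper: "cyc_ext L x \<subseteq> M"
    and cyc_ext_lower: "L \<subseteq> cyc_ext L x"
    and cyc_ext_gen: "x \<in> cyc_ext L x"
proof -
  have LG: "subgroup L G" "L \<subseteq> M" using L by (auto simp: normal_in_def)
  have G: "y \<in> carrier G" if "y \<in> M" for y using subgroup.mem_carrier[OF M that] .
  have l: "l \<in> carrier G" if "l \<in> L" for l using subgroup.mem_carrier[OF LG(1) that] .
  note xG = G[OF x]
  have xp: "x [^] i \<in> M" for i :: nat using sub_pow_closed[OF M x] .
  show "L \<subseteq> cyc_ext L x"
  proof
    fix l assume "l \<in> L"
    then show "l \<in> cyc_ext L x" using cyc_extI[of l L x 0] l by simp
  qed
  show "x \<in> cyc_ext L x" using cyc_extI[of \<one> L x 1] subgroup.one_closed[OF LG(1)] xG by simp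
  show M': "cyc_ext L x \<subseteq> M"
  proof
    fix y assume "y \<in> cyc_ext L x"
    then obtain l and i :: nat where "l \<in> L" "y = l \<otimes> x [^] i" by (rule cyc_extE)
    then show "y \<in> M" using subgroup.m_closed[OF M _ xp] LG(2) by blast
  qed
  show "subgroup (cyc_ext L x) G"
  proof (rule subgroupI)
    show "cyc_ext L x \<subseteq> carrier G" using M' G by blast
    show "cyc_ext L x \<noteq> {}" using cyc_extI subgroup.one_closed[OF LG(1)] by blast
  next
    fix y assume "y \<in> cyc_ext L x"
    then obtain k and i :: nat where y: "k \<in> L" "y = k \<otimes> x [^] i" by (rule cyc_extE)
    define j where "j = i * (card M - 1)"
    have "j + i = i * card M" using card_sub_pos[OF M] by (cases "card M") (simp_all add: j_def)
    then have "x [^] j \<otimes> x [^] i = x [^] (i * card M)" using xG by (simp add: nat_pow_mult)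
    also have "\<dots> = (x [^] card M) [^] i" using xG by (simp add: nat_pow_pow mult.commute)
    also have "\<dots> = \<one>" by (simp add: sub_pow_card[OF M x])
    finally have j: "inv (x [^] i) = x [^] j" using xG by (simp add: inv_equality)
    have "inv y = cj (inv (x [^] i)) (inv k) \<otimes> inv (x [^] i)"
      using y l xG by (simp add: cj_def word_simps)
    moreover have "cj (inv (x [^] i)) (inv k) \<in> L"
      using L y subgroup.m_inv_closed[OF LG(1)] subgroup.m_inv_closed[OF M xp] by (simp add: normal_in_def)
    ultimately show "inv y \<in> cyc_ext L x" unfolding j by (simp add: cyc_extI)
  next
    fix y z assume "y \<in> cyc_ext L x" "z \<in> cyc_ext L x"
    then obtain k k' and i j :: nat where y: "k \<in> L" "y = k \<otimes> x [^] i" "k' \<in> L" "z = k' \<otimes> x [^] j"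
      by (elim cyc_extE)
    have "y \<otimes> z = (k \<otimes> cj (x [^] i) k') \<otimes> (x [^] i \<otimes> x [^] j)"
      using y l xG by (simp add: cj_def word_simps)
    also have "x [^] i \<otimes> x [^] j = x [^] (i + j)" using xG by (simp add: nat_pow_mult)
    finally have "y \<otimes> z = (k \<otimes> cj (x [^] i) k') \<otimes> x [^] (i + j)" .
    moreover have "k \<otimes> cj (x [^] i) k' \<in> L" using L y xp subgroup.m_closed[OF LG(1)] by (simp add: normal_in_def)
    ultimately show "y \<otimes> z \<in> cyc_ext L x" by (simp add: cyc_extI)
  qed
qed

lemma normal_in_of_derived:
  assumes M: "subgroup M G" and L: "subgroup L G" "derived G M \<subseteq> L" "L \<subseteq> M"
  shows "normal_in L M"
proof -
  have "cj g l \<in> L" if g: "g \<in> M" and l: "l \<in> L" for g l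
  proof -
    have G: "g \<in> carrier G" "l \<in> carrier G"
      using subgroup.mem_carrier[OF M g] subgroup.mem_carrier[OF L(1) l] .
    have "cmt g l \<in> L" using cmt_in_derived[of g M l] g l L by blast
    then have "cmt g l \<otimes> l \<in> L" using subgroup.m_closed[OF L(1)] l by blast
    then show ?thesis using G by (simp add: cmt_def cj_def m_assoc)
  qed
  then show ?thesis using L by (simp add: normal_in_def)
qed

text \<open>
  A maximal one among the proper subgroups \<open>L\<close> that contain the derived subgroup of \<open>M\<close>. By maximality
  every \<open>x\<close> outside \<open>L\<close> generates \<open>M\<close> over \<open>L\<close>, and so does every power of \<open>x\<close> outside \<open>L\<close>, which makes
  the index prime.
\<close>

lemma prime_index_subgroup:
  assumes sol: "solvable G" and M: "subgroup M G" and nt: "M \<noteq> {\<one>}"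
  obtains L r where "normal_in L M" "prime r" "card M = r * card L" "\<And>x. x \<in> M \<Longrightarrow> x [^] r \<in> L"
    "\<And>x. x \<in> M \<Longrightarrow> x \<notin> L \<Longrightarrow> cyc_ext L x = M"
proof -
  have MG: "y \<in> carrier G" if "y \<in> M" for y using subgroup.mem_carrier[OF M that] .
  have MC: "M \<subseteq> carrier G" using M by (rule subgroup.subset)
  have "derived G M \<noteq> M"
  proof
    assume e: "derived G M = M"
    obtain n where "(derived G ^^ n) M = {\<one>}" by (rule derived_pow_solvable[OF sol M])
    moreover have "(derived G ^^ n) M = M" by (induction n) (simp_all add: e)
    ultimately show False using nt by simp
  qed
  moreover have "derived G M \<subseteq> M" by (rule derived_incl[OF subset_refl M])
  moreover have "subgroup (derived G M) G" by (rule derived_is_subgroup[OF MC])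
  ultimately have P1: "subgroup (derived G M) G \<and> derived G M \<subseteq> derived G M \<and> derived G M \<subset> M" by blast
  have bound: "\<forall>L. subgroup L G \<and> derived G M \<subseteq> L \<and> L \<subset> M \<longrightarrow> card L < card M"
    using finite_sub[OF M] by (simp add: psubset_card_mono)
  obtain L where L: "subgroup L G" "derived G M \<subseteq> L" "L \<subset> M"
    and max: "\<And>K. \<lbrakk>subgroup K G; derived G M \<subseteq> K; K \<subset> M\<rbrakk> \<Longrightarrow> card K \<le> card L"
    using Lattices_Big.ex_has_greatest_nat[of "\<lambda>L. subgroup L G \<and> derived G M \<subseteq> L \<and> L \<subset> M", OF P1 bound]
    by blast
  have nL: "normal_in L M" using normal_in_of_derived[OF M L(1,2)] L(3) by blast
  have gen: "cyc_ext L x = M" if x: "x \<in> M" "x \<notin> L" for x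
  proof (rule ccontr)
    assume "cyc_ext L x \<noteq> M"
    then have 1: "cyc_ext L x \<subset> M" using cyc_ext_upper[OF M nL x(1)] by blast
    have 2: "L \<subset> cyc_ext L x" using cyc_ext_lower[OF M nL x(1)] cyc_ext_gen[OF M nL x(1)] x(2) by blast
    have sub: "subgroup (cyc_ext L x) G" by (rule subgroup_cyc_ext[OF M nL x(1)])
    have "card (cyc_ext L x) \<le> card L" using max[OF sub _ 1] L(2) 2 by blast
    then show False using psubset_card_mono[OF finite_sub[OF sub] 2] by simp
  qed
  have index: "\<exists>r. prime r \<and> card M = r * card L \<and> x [^] r \<in> L" if x: "x \<in> M" "x \<notin> L" for x
  proof -
    note xG = MG[OF x(1)]
    define r where "r = (LEAST k. k > 0 \<and> x [^] (k :: nat) \<in> L)"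
    have "card M > 0 \<and> x [^] card M \<in> L"
      using card_sub_pos[OF M] sub_pow_card[OF M x(1)] subgroup.one_closed[OF L(1)] by simp
    then have r: "r > 0" "x [^] r \<in> L" unfolding r_def by (metis (mono_tags, lifting) LeastI)+
    have least: "i = 0" if "i < r" "x [^] i \<in> L" for i
      using that not_less_Least[of i "\<lambda>k. k > 0 \<and> x [^] (k :: nat) \<in> L"] unfolding r_def by auto
    have dvd: "r dvd i" if i: "x [^] i \<in> L" for i
    proof -
      have "x [^] i = (x [^] r) [^] (i div r) \<otimes> x [^] (i mod r)"
        using xG by (simp add: nat_pow_pow nat_pow_mult)
      then have "inv ((x [^] r) [^] (i div r)) \<otimes> x [^] i = x [^] (i mod r)" using xG by simp
      moreover have "inv ((x [^] r) [^] (i div r)) \<otimes> x [^] i \<in> L"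
        using sub_pow_closed[OF L(1) r(2)] i subgroup.m_closed[OF L(1)] subgroup.m_inv_closed[OF L(1)] by simp
      ultimately have "i mod r = 0" using least[of "i mod r"] r(1) by simp
      then show ?thesis by blast
    qed
    have "r \<noteq> 1" using r(2) x xG by auto
    moreover have "a = 1 \<or> a = r" if a: "a dvd r" for a
    proof (rule disjCI)
      assume "a \<noteq> r"
      then have ar: "a < r" "a > 0" using dvd_imp_le[OF a r(1)] dvd_pos_nat[OF r(1) a] by simp_all
      then have "x [^] a \<notin> L" using least by blast
      then have "x \<in> cyc_ext L (x [^] a)" using gen[OF sub_pow_closed[OF M x(1)]] x(1) by simp
      then obtain l and i :: nat where l: "l \<in> L" "x = l \<otimes> (x [^] a) [^] i" by (rule cyc_extE)
      have lG: "l \<in> carrier G" using subgroup.mem_carrier[OF L(1) l(1)] .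
      have "x [^] Suc (a * i * (r - 1)) = x \<otimes> x [^] (a * i * (r - 1))" using xG by (simp only: nat_pow_Suc2)
      also have "\<dots> = l \<otimes> (x [^] (a * i) \<otimes> x [^] (a * i * (r - 1)))"
        using arg_cong[OF l(2), of "\<lambda>u. u \<otimes> x [^] (a * i * (r - 1))"] xG lG
        by (simp add: m_assoc nat_pow_pow)
      also have "x [^] (a * i) \<otimes> x [^] (a * i * (r - 1)) = x [^] (a * i * r)"
        using xG r(1) by (cases r) (simp_all add: nat_pow_mult)
      also have "\<dots> = (x [^] r) [^] (a * i)" using xG by (simp add: nat_pow_pow mult.commute)
      finally have "x [^] Suc (a * i * (r - 1)) \<in> L"
        using subgroup.m_closed[OF L(1) l(1) sub_pow_closed[OF L(1) r(2)]] by simp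
      then have "r dvd Suc (a * i * (r - 1))" by (rule dvd)
      then have "a dvd Suc (a * i * (r - 1))" using a by (rule dvd_trans[rotated])
      moreover have "a dvd a * i * (r - 1)" by simp
      ultimately show "a = 1" by (metis Suc_eq_plus1 dvd_add_right_iff nat_dvd_1_iff_1)
    qed
    ultimately have prime: "prime r" using r(1) by (simp add: prime_nat_iff)
    have surj: "\<exists>l\<in>L. \<exists>i<r. y = l \<otimes> x [^] i" if y: "y \<in> M" for y
    proof -
      have "y \<in> cyc_ext L x" using gen[OF x] y by simp
      then obtain l and i :: nat where l: "l \<in> L" "y = l \<otimes> x [^] i" by (rule cyc_extE)
      have lG: "l \<in> carrier G" using subgroup.mem_carrier[OF L(1) l(1)] .
      have "x [^] i = (x [^] r) [^] (i div r) \<otimes> x [^] (i mod r)"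
        using xG by (simp add: nat_pow_pow nat_pow_mult)
      then have "y = (l \<otimes> (x [^] r) [^] (i div r)) \<otimes> x [^] (i mod r)" using l(2) lG xG by (simp add: m_assoc)
      moreover have "l \<otimes> (x [^] r) [^] (i div r) \<in> L"
        using subgroup.m_closed[OF L(1) l(1) sub_pow_closed[OF L(1) r(2)]] .
      moreover have "i mod r < r" using r(1) by simp
      ultimately show ?thesis by blast
    qed
    have "inj_on (\<lambda>(l, i). l \<otimes> x [^] i) (L \<times> {..<r})"
    proof -
      have le: "l = l' \<and> i = j" if h: "l \<in> L" "l' \<in> L" "j < r" "i \<le> j" "l \<otimes> x [^] i = l' \<otimes> x [^] j" for l l' i j
      proof -
        have G: "l \<in> carrier G" "l' \<in> carrier G" using h(1,2) subgroup.mem_carrier[OF L(1)] by simp_all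
        have "x [^] j = x [^] (j - i) \<otimes> x [^] i" using xG h(4) by (simp add: nat_pow_mult)
        then have "l \<otimes> x [^] i = (l' \<otimes> x [^] (j - i)) \<otimes> x [^] i" using h(5) G xG by (simp add: m_assoc)
        then have e: "l = l' \<otimes> x [^] (j - i)" using G xG by simp
        then have "x [^] (j - i) = inv l' \<otimes> l" using G xG by simp
        then have "x [^] (j - i) \<in> L" using h(1,2) subgroup.m_closed[OF L(1)] subgroup.m_inv_closed[OF L(1)] by simp
        then have "j - i = 0" using least[of "j - i"] h(3) by simp
        then show ?thesis using e h(4) G by simp
      qed
      show ?thesis
      proof (rule inj_onI)
        fix a b assume ab: "a \<in> L \<times> {..<r}" "b \<in> L \<times> {..<r}" and eq: "(case a of (l, i) \<Rightarrow> l \<otimes> x [^] i) = (case b of (l, i) \<Rightarrow> l \<otimes> x [^] i)"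
        show "a = b"
        proof (cases "snd a \<le> snd b")
          case True
          then show ?thesis using le[of "fst a" "fst b" "snd b" "snd a"] ab eq by (auto simp: case_prod_beta prod_eq_iff)
        next
          case False
          then show ?thesis using le[of "fst b" "fst a" "snd a" "snd b"] ab eq by (auto simp: case_prod_beta prod_eq_iff)
        qed
      qed
    qed
    moreover have "(\<lambda>(l, i). l \<otimes> x [^] i) ` (L \<times> {..<r}) = M"
    proof
      show "(\<lambda>(l, i). l \<otimes> x [^] i) ` (L \<times> {..<r}) \<subseteq> M"
        using cyc_ext_upper[OF M nL x(1)] cyc_extI by auto
      show "M \<subseteq> (\<lambda>(l, i). l \<otimes> x [^] i) ` (L \<times> {..<r})" using surj by force
    qed
    ultimately have "card M = card (L \<times> {..<r})" by (metis card_image)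
    then have card: "card M = r * card L" by (simp add: card_cartesian_product)
    show ?thesis using prime card r(2) by blast
  qed
  obtain x where x: "x \<in> M" "x \<notin> L" using L(3) by blast
  obtain r where r: "prime r" "card M = r * card L" using index[OF x] by blast
  have "y [^] r \<in> L" if y: "y \<in> M" for y
  proof (cases "y \<in> L")
    case True
    then show ?thesis by (rule sub_pow_closed[OF L(1)])
  next
    case False
    obtain r' where "card M = r' * card L" "y [^] r' \<in> L" using index[OF y False] by blast
    then show ?thesis using r(2) card_sub_pos[OF L(1)] by simp
  qed
  then show ?thesis using that[OF nL r _ gen] by blast
qed

section \<open>Self-centralising normal Sylow subgroups\<close>

text \<open>
  Otherwise let \<open>L\<close> be the last term of the derived series of the centraliser of \<open>N\<close> that is not
  contained in \<open>N\<close>. Commutators of \<open>L\<close> lie in \<open>N\<close>, so they are \<open>p\<close>-elements and central in \<open>L\<close>. If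
  \<open>m\<close> is the part of the order prime to \<open>p\<close>, then \<open>m\<close>-th powers are \<open>p\<close>-elements, hence also central, and
  the \<open>m\<close>-th powers of commutators are trivial. So \<open>L\<close> is abelian, and its elements of order prime to \<open>p\<close>
  form a normal subgroup. By assumption that subgroup is trivial, which puts \<open>L\<close> into \<open>N\<close>.
\<close>

lemma self_centralising:
  assumes sol: "solvable G" and p: "prime p" and M: "subgroup M G"
    and core: "\<And>K. normal_in K M \<Longrightarrow> \<not> p dvd card K \<Longrightarrow> K = {\<one>}"
    and N: "normal_in N M" and Np: "\<And>x. \<lbrakk>x \<in> M; p_element p x\<rbrakk> \<Longrightarrow> x \<in> N"
    and Ne: "\<And>x. x \<in> N \<Longrightarrow> p_element p x"
    and c: "c \<in> M" "\<And>n. n \<in> N \<Longrightarrow> c \<otimes> n = n \<otimes> c"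
  shows "c \<in> N"
proof (rule ccontr)
  assume cN: "c \<notin> N"
  have MG: "y \<in> carrier G" if "y \<in> M" for y using subgroup.mem_carrier[OF M that] .
  have NG: "subgroup N G" "N \<subseteq> M" using N by (auto simp: normal_in_def)
  define C where "C = {c \<in> M. \<forall>n\<in>N. c \<otimes> n = n \<otimes> c}"
  have C: "subgroup C G"
  proof (rule subgroupI)
    show "C \<subseteq> carrier G" using MG by (auto simp: C_def)
    show "C \<noteq> {}" using c by (auto simp: C_def)
    show "inv a \<in> C" if "a \<in> C" for a
      using that MG NG(2) subgroup.m_inv_closed[OF M] commute_inv[of a] by (auto simp: C_def)
    show "a \<otimes> b \<in> C" if "a \<in> C" "b \<in> C" for a b
      using that MG NG(2) subgroup.m_closed[OF M] commute_mult[of a b] by (auto simp: C_def)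
  qed
  have C_cj: "cj g ` C \<subseteq> C" if g: "g \<in> M" for g
  proof
    fix y assume "y \<in> cj g ` C"
    then obtain a where a: "a \<in> M" "\<forall>n\<in>N. a \<otimes> n = n \<otimes> a" "y = cj g a" by (auto simp: C_def)
    have "y \<otimes> n = n \<otimes> y" if n: "n \<in> N" for n
    proof -
      have ig: "inv g \<in> M" using subgroup.m_inv_closed[OF M g] .
      have "cj (inv g) n \<in> N" using N ig n by (simp add: normal_in_def)
      then have "cj g (a \<otimes> cj (inv g) n) = cj g (cj (inv g) n \<otimes> a)" using a(2) by simp
      then show ?thesis using a g n MG NG(2) by (auto simp: cj_mult)
    qed
    moreover have "y \<in> M" using a g M by (simp add: cj_in_subgroup)
    ultimately show "y \<in> C" by (simp add: C_def)
  qed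
  define D where "D i = (derived G ^^ i) C" for i
  obtain l where l: "D l = {\<one>}" using derived_pow_solvable[OF sol C] by (auto simp: D_def)
  have D: "subgroup (D i) G" for i unfolding D_def by (rule exp_of_derived_is_subgroup[OF C])
  have Suc: "D (Suc i) = derived G (D i)" for i by (simp add: D_def)
  have DC: "D i \<subseteq> C" for i
  proof (induction i)
    case (Suc i)
    have "D (Suc i) \<subseteq> D i" using derived_incl[OF subset_refl D[of i]] by (simp add: D_def)
    then show ?case using Suc by blast
  qed (simp add: D_def)
  have "D l \<subseteq> N" using l subgroup.one_closed[OF NG(1)] by simp
  moreover have "\<not> D 0 \<subseteq> N" using cN c by (auto simp: D_def C_def)
  ultimately obtain i where i: "\<not> D i \<subseteq> N" "D (Suc i) \<subseteq> N"
    using ex_least_nat_less[of "\<lambda>i. D i \<subseteq> N" l] by blast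
  define L where "L = D i"
  have L: "subgroup L G" "L \<subseteq> C" "L \<subseteq> M" using D DC[of i] by (auto simp: L_def C_def)
  have LG: "y \<in> carrier G" if "y \<in> L" for y using subgroup.mem_carrier[OF L(1) that] .
  have L_cj: "cj g a \<in> L" if "g \<in> M" "a \<in> L" for g a
    using cj_derived_pow[OF MG[OF that(1)] subgroup.subset[OF C] C_cj[OF that(1)], of i] that(2)
    by (auto simp: L_def D_def)
  \<comment> \<open>\<open>m\<close> is the part of the order prime to \<open>p\<close>.\<close>
  define m where "m = card M div p ^ multiplicity p (card M)"
  have cm: "card M = p ^ multiplicity p (card M) * m" by (simp add: m_def multiplicity_dvd)
  have "\<not> p dvd m"
    unfolding m_def by (rule multiplicity_decompose) (use card_sub_pos[OF M] p in \<open>auto simp: prime_nat_iff\<close>)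
  then have cop: "coprime m (p ^ k)" for k using prime_imp_coprime[of p m] p by (simp add: coprime_commute)
  have pm: "a [^] m \<in> N" if a: "a \<in> L" for a
  proof (rule Np)
    show "a [^] m \<in> M" using sub_pow_closed[OF M] a L(3) by blast
    have "(a [^] m) [^] (p ^ multiplicity p (card M)) = a [^] card M"
      unfolding nat_pow_pow[OF LG[OF a]] by (simp only: mult.commute[of m] cm[symmetric])
    also have "\<dots> = \<one>" using sub_pow_card[OF M] a L(3) by blast
    finally show "p_element p (a [^] m)" by (auto simp: p_element_def)
  qed
  have abelian: "a \<otimes> b = b \<otimes> a" if ab: "a \<in> L" "b \<in> L" for a b
  proof -
    have z: "cmt a b \<in> N" using cmt_in_derived[OF ab] i(2) by (auto simp: Suc L_def)
    have "cmt a b \<otimes> a = a \<otimes> cmt a b" using ab(1) z L(2) by (auto simp: C_def)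
    then have "cmt a b [^] m = cmt (a [^] m) b" using cmt_pow LG ab by simp
    also have "\<dots> = \<one>"
    proof -
      have "b \<otimes> a [^] m = a [^] m \<otimes> b" using pm[OF ab(1)] ab(2) L(2) by (auto simp: C_def)
      then show ?thesis using cmt_eq_one_iff LG ab by simp
    qed
    finally have "cmt a b [^] m = \<one>" .
    moreover obtain k where "cmt a b [^] (p ^ k) = \<one>" using Ne[OF z] by (auto simp: p_element_def)
    ultimately have "cmt a b = \<one>" using coprime_pow_eq_one[OF _ _ _ cop] LG ab by simp
    then show ?thesis using cmt_eq_one_iff LG ab by simp
  qed
  define E where "E = {e \<in> L. e [^] m = \<one>}"
  have "normal_in E M"
    unfolding normal_in_def
  proof (intro conjI ballI)
    show "subgroup E G"
    proof (rule subgroupI)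
      show "E \<subseteq> carrier G" using LG by (auto simp: E_def)
      show "E \<noteq> {}" using subgroup.one_closed[OF L(1)] by (auto simp: E_def)
      show "inv a \<in> E" if "a \<in> E" for a
        using that LG subgroup.m_inv_closed[OF L(1)] by (auto simp: E_def nat_pow_inv)
      show "a \<otimes> b \<in> E" if "a \<in> E" "b \<in> E" for a b
        using that LG subgroup.m_closed[OF L(1)] abelian pow_mult_distrib[of a b] by (auto simp: E_def)
    qed
    show "E \<subseteq> M" using L(3) by (auto simp: E_def)
    show "cj g e \<in> E" if "g \<in> M" "e \<in> E" for g e
      using that L_cj LG MG cj_pow[of g e m] by (auto simp: E_def)
  qed
  moreover have "\<not> p dvd card E"
  proof -
    have "x = \<one>" if x: "x \<in> E" "p_element p x" for x
    proof -
      obtain k where "x [^] (p ^ k) = \<one>" using x(2) by (auto simp: p_element_def)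
      then show ?thesis using x(1) coprime_pow_eq_one[OF _ _ _ cop] LG by (auto simp: E_def)
    qed
    then show ?thesis using not_dvd_card_iff[OF p] \<open>normal_in E M\<close> by (simp add: normal_in_def)
  qed
  ultimately have E1: "E = {\<one>}" by (rule core)
  have "L \<subseteq> N"
  proof
    fix a assume a: "a \<in> L"
    let ?q = "p ^ multiplicity p (card M)"
    have "(a [^] ?q) [^] m = a [^] card M"
      unfolding nat_pow_pow[OF LG[OF a]] by (simp only: cm[symmetric])
    also have "\<dots> = \<one>" using sub_pow_card[OF M] a L(3) by blast
    finally have "a [^] ?q \<in> E" using sub_pow_closed[OF L(1) a] by (simp add: E_def)
    then have "p_element p a" using E1 by (auto simp: p_element_def)
    then show "a \<in> N" using Np a L(3) by blast
  qed
  then show False using i(1) by (simp add: L_def)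
qed

end

lemma (in group_module) quadratic_cj:
  assumes "quadratic x" "x \<in> carrier G" "g \<in> carrier G"
  shows "quadratic (cj g x)"
  unfolding quadratic_def
proof
  fix v assume v: "v \<in> carrier A"
  define w where "w = \<sigma> (inv g) v"
  have w: "w \<in> carrier A" "\<sigma> g w = v" using v assms(3) by (simp_all add: w_def)
  have c: "\<sigma> (cj g x) (\<sigma> g u) = \<sigma> g (\<sigma> x u)" if "u \<in> carrier A" for u
    using that assms(2,3) by (simp add: cj_def action_mult)
  have "\<sigma> g (\<sigma> x (\<sigma> x w) \<otimes>\<^bsub>A\<^esub> w) = \<sigma> g (\<sigma> x w \<otimes>\<^bsub>A\<^esub> \<sigma> x w)"
    using assms(1) w(1) unfolding quadratic_def by simp
  then show "\<sigma> (cj g x) (\<sigma> (cj g x) v) \<otimes>\<^bsub>A\<^esub> v = \<sigma> (cj g x) v \<otimes>\<^bsub>A\<^esub> \<sigma> (cj g x) v"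
    unfolding w(2)[symmetric] using w(1) assms(2,3) by (simp add: c action_add)
qed

section \<open>Groups of nilpotency class two\<close>

context group
begin

definition class2 :: "'a set \<Rightarrow> bool" where
  "class2 S \<longleftrightarrow> (\<forall>a\<in>S. \<forall>b\<in>S. \<forall>c\<in>S. cmt a b \<otimes> c = c \<otimes> cmt a b)"

lemma class2D: "\<lbrakk>class2 S; a \<in> S; b \<in> S; c \<in> S\<rbrakk> \<Longrightarrow> cmt a b \<otimes> c = c \<otimes> cmt a b"
  by (simp add: class2_def)

lemma inv_cmt: "\<lbrakk>a \<in> carrier G; b \<in> carrier G\<rbrakk> \<Longrightarrow> inv (cmt a b) = cmt b a"
  by (simp add: cmt_def word_simps)

lemma class2_cmt_left:
  assumes S: "subgroup S G" "class2 S" and abc: "a \<in> S" "b \<in> S" "c \<in> S"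
  shows "cmt (a \<otimes> b) c = cmt a c \<otimes> cmt b c"
proof -
  have G: "a \<in> carrier G" "b \<in> carrier G" "c \<in> carrier G" using abc subgroup.mem_carrier[OF S(1)] by auto
  have "cmt (a \<otimes> b) c = (a \<otimes> cmt b c) \<otimes> (c \<otimes> (inv a \<otimes> inv c))" using G by (simp add: cmt_def word_simps)
  also have "\<dots> = cmt b c \<otimes> cmt a c"
    unfolding class2D[OF S(2) abc(2,3,1), symmetric] using G by (simp add: cmt_def[of a c] m_assoc)
  also have "\<dots> = cmt a c \<otimes> cmt b c"
    by (rule class2D[OF S(2) abc(2,3) cmt_in_subgroup[OF S(1) abc(1,3)]])
  finally show ?thesis .
qed

lemma class2_cmt_right:
  assumes S: "subgroup S G" "class2 S" and abc: "a \<in> S" "b \<in> S" "c \<in> S"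
  shows "cmt a (b \<otimes> c) = cmt a b \<otimes> cmt a c"
proof -
  have G: "a \<in> carrier G" "b \<in> carrier G" "c \<in> carrier G" using abc subgroup.mem_carrier[OF S(1)] by auto
  have "cmt a (b \<otimes> c) = inv (cmt (b \<otimes> c) a)" using G by (simp add: inv_cmt)
  also have "\<dots> = cmt a c \<otimes> cmt a b"
    unfolding class2_cmt_left[OF S abc(2,3,1)] using G by (simp add: inv_mult_group inv_cmt)
  also have "\<dots> = cmt a b \<otimes> cmt a c"
    by (rule class2D[OF S(2) abc(1,3) cmt_in_subgroup[OF S(1) abc(1,2)]])
  finally show ?thesis .
qed

end

context finite_group
begin

text \<open>The exponent halves, because \<open>(card S + 1) div 2\<close> is the inverse of 2 modulo the odd number \<open>card S\<close>.\<close>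

lemma odd_class2_form:
  assumes S: "subgroup S G" "class2 S" and odd: "odd (card S)"
  shows "central_form G S (\<lambda>x y. cmt x y [^] ((card S + 1) div 2))"
proof -
  let ?m = "(card S + 1) div 2"
  have SG: "x \<in> carrier G" if "x \<in> S" for x using subgroup.mem_carrier[OF S(1) that] .
  have c: "cmt x y \<in> S" if "x \<in> S" "y \<in> S" for x y using cmt_in_subgroup[OF S(1) that] .
  have central: "cmt x y [^] ?m \<otimes> z = z \<otimes> cmt x y [^] ?m" if "x \<in> S" "y \<in> S" "z \<in> S" for x y z
    using group_commutes_pow[OF class2D[OF S(2) that]] SG that by simp
  show ?thesis
  proof (intro central_form.intro central_form_axioms.intro)
    show "group G" by (rule is_group)
    show "subgroup S G" by fact
    show "cmt x y [^] ?m \<in> S" if "x \<in> S" "y \<in> S" for x y using sub_pow_closed[OF S(1) c[OF that]] .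
    show "cmt x y [^] ?m \<otimes> z = z \<otimes> cmt x y [^] ?m" if "x \<in> S" "y \<in> S" "z \<in> S" for x y z
      using central[OF that] .
    show "cmt (x \<otimes> y) z [^] ?m = cmt x z [^] ?m \<otimes> cmt y z [^] ?m" if "x \<in> S" "y \<in> S" "z \<in> S" for x y z
      unfolding class2_cmt_left[OF S that]
      by (rule pow_mult_distrib[OF class2D[OF S(2)]]) (use that c SG in auto)
    show "cmt x (y \<otimes> z) [^] ?m = cmt x y [^] ?m \<otimes> cmt x z [^] ?m" if "x \<in> S" "y \<in> S" "z \<in> S" for x y z
      unfolding class2_cmt_right[OF S that]
      by (rule pow_mult_distrib[OF class2D[OF S(2)]]) (use that c SG in auto)
    show "cmt (cmt x y [^] ?m) z [^] ?m = \<one>" "cmt z (cmt x y [^] ?m) [^] ?m = \<one>"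
      if "x \<in> S" "y \<in> S" "z \<in> S" for x y z
    proof -
      have "cmt (cmt x y [^] ?m) z = \<one>" "cmt z (cmt x y [^] ?m) = \<one>"
        using central[OF that] that SG by (simp_all add: cmt_eq_one_iff)
      then show "cmt (cmt x y [^] ?m) z [^] ?m = \<one>" "cmt z (cmt x y [^] ?m) [^] ?m = \<one>" by simp_all
    qed
    show "cmt x y [^] ?m \<otimes> inv (cmt y x [^] ?m) = cmt x y" if "x \<in> S" "y \<in> S" for x y
    proof -
      have G: "x \<in> carrier G" "y \<in> carrier G" using that SG by auto
      then have "inv (cmt y x [^] ?m) = cmt x y [^] ?m" by (simp add: nat_pow_inv[symmetric] inv_cmt)
      then have "cmt x y [^] ?m \<otimes> inv (cmt y x [^] ?m) = (cmt x y \<otimes> cmt x y) [^] ?m"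
        using G by (simp add: pow_mult_distrib)
      also have "\<dots> = cmt x y"
        using square_root_odd_pow[OF _ sub_pow_card[OF S(1) c[OF that]] odd] G by simp
      finally show ?thesis .
    qed
  qed
qed

end

lemma (in central_form) cj_module:
  assumes M: "subgroup M G" and SM: "\<And>g s. \<lbrakk>g \<in> M; s \<in> S\<rbrakk> \<Longrightarrow> cj g s \<in> S"
    and form_cj: "\<And>g x y. \<lbrakk>g \<in> M; x \<in> S; y \<in> S\<rbrakk> \<Longrightarrow> \<beta> (cj g x) (cj g y) = cj g (\<beta> x y)"
  shows "group_module (G\<lparr>carrier := M\<rparr>) additive cj"
proof -
  have MG: "g \<in> carrier G" if "g \<in> M" for g using subgroup.mem_carrier[OF M that] .
  interpret M: group "G\<lparr>carrier := M\<rparr>" using M by (rule subgroup_imp_group)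
  interpret A: comm_group additive by (rule comm_group_additive)
  show ?thesis
  proof
    show "cj g \<in> hom additive additive" if "g \<in> carrier (G\<lparr>carrier := M\<rparr>)" for g
    proof (rule homI)
      fix x y assume "x \<in> carrier additive" "y \<in> carrier additive"
      then have xy: "x \<in> S" "y \<in> S" by simp_all
      have g: "g \<in> M" "g \<in> carrier G" using that MG by auto
      show "cj g x \<in> carrier additive" using SM g xy by simp
      show "cj g (x \<otimes>\<^bsub>additive\<^esub> y) = cj g x \<otimes>\<^bsub>additive\<^esub> cj g y"
        using g xy by (simp add: plus_def cj_mult cj_inv form_cj)
    qed
    show "cj \<one>\<^bsub>G\<lparr>carrier := M\<rparr>\<^esub> v = v" if "v \<in> carrier additive" for v using that by simp
    show "cj (g \<otimes>\<^bsub>G\<lparr>carrier := M\<rparr>\<^esub> h) v = cj g (cj h v)"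
      if "g \<in> carrier (G\<lparr>carrier := M\<rparr>)" "h \<in> carrier (G\<lparr>carrier := M\<rparr>)" "v \<in> carrier additive" for g h v
      using that MG by (simp add: cj_cj)
  qed
qed

context finite_group
begin

text \<open>
  \<open>x\<close> is quadratic on \<open>N\<close> with Baer's addition: \<open>z = cmt x v\<close> is central in \<open>P\<close>, so that \<open>x\<close> maps \<open>v\<close> to
  \<open>z + v\<close> and fixes \<open>z\<close>.
\<close>

lemma class2_element_centralises:
  assumes sol: "solvable G" and M: "subgroup M G" and N: "normal_in N M" and P: "subgroup P G" "P \<subseteq> M" "N \<subseteq> P" "class2 P"
    and oddN: "odd (card N)" and x: "x \<in> P"
    and Q: "subgroup Q G" "Q \<subseteq> M" and norm: "cj x ` Q \<subseteq> Q" "cj (inv x) ` Q \<subseteq> Q"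
    and oddQ: "odd (card Q)" and cop: "coprime (card Q) (card N)"
    and faithful: "\<And>q. \<lbrakk>q \<in> Q; \<And>n. n \<in> N \<Longrightarrow> q \<otimes> n = n \<otimes> q\<rbrakk> \<Longrightarrow> q = \<one>"
    and expx: "x [^] (k :: nat) = \<one>" and copx: "coprime k (card Q)" and g: "g \<in> Q"
  shows "x \<otimes> g = g \<otimes> x"
proof -
  have NG: "subgroup N G" "N \<subseteq> M" using N by (auto simp: normal_in_def)
  have MG: "y \<in> carrier G" if "y \<in> M" for y using subgroup.mem_carrier[OF M that] .
  have Nc: "y \<in> carrier G" if "y \<in> N" for y using that NG(2) MG by blast
  have "class2 N" using P(3,4) unfolding class2_def by blast
  let ?G = "G\<lparr>carrier := M\<rparr>"
  define \<beta> where "\<beta> x y = cmt x y [^] ((card N + 1) div 2)" for x y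
  interpret \<beta>: central_form G N \<beta>
    unfolding \<beta>_def by (rule odd_class2_form[OF NG(1) \<open>class2 N\<close> oddN])
  interpret m: group_module ?G \<beta>.additive cj
  proof (rule \<beta>.cj_module[OF M])
    show "cj g s \<in> N" if "g \<in> M" "s \<in> N" for g s using that N by (simp add: normal_in_def)
    show "\<beta> (cj g x) (cj g y) = cj g (\<beta> x y)" if "g \<in> M" "x \<in> N" "y \<in> N" for g x y
      using that MG Nc by (simp add: \<beta>_def cj_cmt cj_pow)
  qed
  have inv_eq: "inv\<^bsub>?G\<^esub> y = inv y" if "y \<in> M" for y using m_inv_consistent[OF M that] .
  have cj_eq: "m.cj y z = cj y z" if "y \<in> M" for y z
    using that by (simp add: m.cj_def cj_def inv_eq)
  have xM: "x \<in> M" using x P(2) by blast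
  have "group_hom ?G G id"
    using canonical_inj_is_hom[OF M] .
  then have solM: "solvable ?G"
    using group_hom.inj_hom_imp_solvable[of ?G G id] sol by simp
  have "m.quadratic x"
    unfolding m.quadratic_def
  proof
    fix v assume "v \<in> carrier \<beta>.additive"
    then have v: "v \<in> N" by simp
    have G: "x \<in> carrier G" "v \<in> carrier G" using MG xM Nc v by auto
    define z where "z = cmt x v"
    have zP: "z \<otimes> y = y \<otimes> z" if "y \<in> P" for y
      using class2D[OF P(4) x _ that] v P(3) by (auto simp: z_def)
    have "cj x v \<in> N" using N xM v by (simp add: normal_in_def)
    then have zN: "z \<in> N" using cmt_eq_cj[OF G] v by (simp add: z_def)
    have xv: "cj x v = z \<otimes> v" using cmt_eq_cj[OF G] G by (simp add: z_def m_assoc)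
    have "cj x z = x \<otimes> z \<otimes> inv x" by (simp add: cj_def)
    also have "\<dots> = z" using zP[OF x] G Nc[OF zN] by (simp add: m_assoc flip: zP[OF x])
    finally have xxv: "cj x (cj x v) = z \<otimes> (z \<otimes> v)" using G Nc[OF zN] xv by (simp add: cj_mult)
    have triv: "\<beta> z y = \<one>" "\<beta> y z = \<one>" if "y \<in> N" for y
    proof -
      have "cmt z y = \<one>" "cmt y z = \<one>"
        using zP[of y] that P(3) Nc zN by (auto simp: cmt_eq_one_iff)
      then show "\<beta> z y = \<one>" "\<beta> y z = \<one>" by (simp_all add: \<beta>_def)
    qed
    have vz: "v \<otimes> z = z \<otimes> v" using zP[of v] v P(3) by auto
    have "\<beta>.plus (z \<otimes> (z \<otimes> v)) v = z \<otimes> (z \<otimes> (v \<otimes> v)) \<otimes> inv (\<beta> v v)"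
      using zN v Nc by (simp add: \<beta>.plus_def \<beta>.form_left triv m_assoc)
    also have "\<dots> = \<beta>.plus (z \<otimes> v) (z \<otimes> v)"
    proof -
      have "z \<otimes> (v \<otimes> (z \<otimes> v)) = z \<otimes> (z \<otimes> (v \<otimes> v))"
        using vz zN v Nc by (simp flip: m_assoc)
      then show ?thesis using zN v Nc by (simp add: \<beta>.plus_def \<beta>.form_left \<beta>.form_right triv m_assoc)
    qed
    finally show "cj x (cj x v) \<otimes>\<^bsub>\<beta>.additive\<^esub> v = cj x v \<otimes>\<^bsub>\<beta>.additive\<^esub> cj x v"
      using xv xxv by simp
  qed
  then have quad: "m.quadratic (m.cj q x)" if "q \<in> Q" for q
    by (rule m.quadratic_cj) (use that Q(2) xM in auto)
  have expA: "v [^]\<^bsub>\<beta>.additive\<^esub> card N = \<one>\<^bsub>\<beta>.additive\<^esub>" if "v \<in> carrier \<beta>.additive" for v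
    using m.A.pow_order_eq_1[OF that] by (simp add: order_def)
  have pow_eq: "y [^]\<^bsub>?G\<^esub> n = y [^] n" for y and n :: nat by (simp add: nat_pow_consistent[symmetric])
  have "x \<otimes>\<^bsub>?G\<^esub> g = g \<otimes>\<^bsub>?G\<^esub> x"
  proof (rule m.quadratic_centralises[where Q = Q and n = "card N" and m = "card Q" and k = k])
    show "subgroup Q ?G" by (rule subgroup_incl[OF Q(1) M Q(2)])
    show "solvable ?G" by fact
    show "m.cj x q \<in> Q" if "q \<in> Q" for q using norm(1) that cj_eq[OF xM] by auto
    show "m.cj (inv\<^bsub>?G\<^esub> x) q \<in> Q" if "q \<in> Q" for q
      using norm(2) that inv_eq[OF xM] cj_eq[OF subgroup.m_inv_closed[OF M xM]] by auto
    show "q [^]\<^bsub>?G\<^esub> card Q = \<one>\<^bsub>?G\<^esub>" if "q \<in> Q" for q using sub_pow_card[OF Q(1) that] pow_eq by simp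
    show "x [^]\<^bsub>?G\<^esub> k = \<one>\<^bsub>?G\<^esub>" using expx pow_eq by simp
    show "q = \<one>\<^bsub>?G\<^esub>" if q: "q \<in> Q" "\<And>v. v \<in> carrier \<beta>.additive \<Longrightarrow> cj q v = v" for q
    proof -
      have "q \<otimes> n = n \<otimes> q" if n: "n \<in> N" for n
      proof -
        have G: "q \<in> carrier G" "n \<in> carrier G" using q(1) Q(2) MG Nc n by auto
        have "cj q n \<otimes> q = n \<otimes> q" using q(2) n by simp
        then show ?thesis using G by (simp add: cj_def m_assoc)
      qed
      then show ?thesis using faithful[OF q(1)] by simp
    qed
  qed (use xM quad expA oddN oddQ cop copx g in auto)
  then show ?thesis by simp
qed

lemma frattini:
  assumes q: "prime q" and L: "subgroup L G" and Q: "sylow_in q L Q"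
    and g: "g \<in> carrier G" "cj g ` L \<subseteq> L"
  obtains l where "l \<in> L" "cj (l \<otimes> g) ` Q = Q"
proof -
  obtain l where l: "l \<in> L" "cj l ` cj g ` Q = Q"
    by (rule sylow_conjugate[OF q L Q sylow_in_cj[OF Q L g]])
  have "l \<in> carrier G" using subgroup.mem_carrier[OF L l(1)] .
  moreover have "y \<in> carrier G" if "y \<in> Q" for y
    using that Q subgroup.mem_carrier by (fastforce simp: sylow_in_def)
  ultimately have "cj l ` cj g ` Q = cj (l \<otimes> g) ` Q"
    using g(1) by (auto simp: image_image cj_cj)
  then show ?thesis using that l by metis
qed

lemma cj_image_pow:
  assumes "g \<in> carrier G" "cj g ` Q \<subseteq> Q" "Q \<subseteq> carrier G"
  shows "cj (g [^] (n :: nat)) ` Q \<subseteq> Q"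
proof (induction n)
  case 0
  then show ?case using assms(3) by auto
next
  case (Suc n)
  have "cj (g [^] Suc n) y \<in> Q" if y: "y \<in> Q" for y
  proof -
    have "cj (g [^] Suc n) y = cj (g [^] n) (cj g y)" using assms(1,3) y by (auto simp: cj_cj)
    moreover have "cj g y \<in> Q" using assms(2) y by blast
    ultimately show ?thesis using Suc by auto
  qed
  then show ?case by blast
qed

lemma cj_image_inv:
  assumes "g \<in> carrier G" "cj g ` Q \<subseteq> Q" "subgroup Q G"
  shows "cj (inv g) ` Q \<subseteq> Q"
proof -
  have QG: "Q \<subseteq> carrier G" using assms(3) by (rule subgroup.subset)
  have "cj g ` Q = Q"
    using card_subset_eq[OF finite_sub[OF assms(3)] assms(2)] card_cj[OF QG assms(1)] by simp
  then have "cj (inv g) ` Q = cj (inv g) ` cj g ` Q" by simp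
  also have "\<dots> = Q" using QG assms(1) by (force simp: image_image)
  finally show ?thesis by simp
qed

text \<open>\<open>O'\<close> is a normal 2-complement. It contains \<open>x\<close>, so the commutator of \<open>x\<close> and \<open>g\<close> lies in \<open>O'\<close> and in \<open>Q\<close>.\<close>

lemma odd_p_element_centralises_2_group:
  assumes O: "subgroup O' G" "odd (card O')" "\<And>g y. \<lbrakk>g \<in> carrier G; y \<in> O'\<rbrakk> \<Longrightarrow> cj g y \<in> O'"
    and quot: "\<And>g. g \<in> carrier G \<Longrightarrow> \<exists>k :: nat. g [^] (2 ^ k :: nat) \<in> O'"
    and p: "prime p" "odd p" and x: "x \<in> carrier G" "p_element p x"
    and Q: "subgroup Q G" "card Q = 2 ^ b" "cj x ` Q \<subseteq> Q" and g: "g \<in> Q"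
  shows "x \<otimes> g = g \<otimes> x"
proof -
  have gG: "g \<in> carrier G" using subgroup.mem_carrier[OF Q(1) g] .
  obtain k :: nat where k: "x [^] (2 ^ k :: nat) \<in> O'" using quot[OF x(1)] by blast
  obtain j where j: "x [^] (p ^ j) = \<one>" using x(2) by (auto simp: p_element_def)
  have xO: "x \<in> O'"
    by (rule coprime_powers_in_subgroup[OF O(1) x(1) k, of "p ^ j"])
      (use j subgroup.one_closed[OF O(1)] p in simp_all)
  have "cmt x g = cj x g \<otimes> inv g" by (rule cmt_eq_cj[OF x(1) gG])
  then have 1: "cmt x g \<in> Q" using g Q subgroup.m_closed[OF Q(1)] subgroup.m_inv_closed[OF Q(1)] by auto
  have "cmt x g = x \<otimes> cj g (inv x)" using x(1) gG by (simp add: cmt_def cj_def m_assoc)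
  then have 2: "cmt x g \<in> O'"
    using O(3)[OF gG subgroup.m_inv_closed[OF O(1) xO]] subgroup.m_closed[OF O(1) xO] by simp
  have "cmt x g = \<one>"
    by (rule coprime_pow_eq_one[OF _ sub_pow_card[OF Q(1) 1] sub_pow_card[OF O(1) 2]])
      (use x(1) gG Q(2) O(2) in simp_all)
  then show ?thesis using cmt_eq_one_iff[OF x(1) gG] by simp
qed

end

context finite_group
begin

section \<open>Normality of Sylow subgroups of class two\<close>

text \<open>Conjugation by \<open>M\<close> permutes the normal subgroups of \<open>L\<close>, so it preserves the largest one of order prime to \<open>p\<close>.\<close>

lemma p'_core_normal_in:
  assumes M: "subgroup M G" and L: "normal_in L M" and K: "normal_in K L" "\<not> p dvd card K"
    and max: "\<And>K'. normal_in K' L \<Longrightarrow> \<not> p dvd card K' \<Longrightarrow> K' \<subseteq> K"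
  shows "normal_in K M"
proof -
  have MG: "y \<in> carrier G" if "y \<in> M" for y using subgroup.mem_carrier[OF M that] .
  have sub: "subgroup L G" "L \<subseteq> M" "subgroup K G" "K \<subseteq> L" using L K by (auto simp: normal_in_def)
  have "cj g ` K \<subseteq> K" if g: "g \<in> M" for g
  proof (rule max)
    have gG: "g \<in> carrier G" "inv g \<in> M" using MG[OF g] subgroup.m_inv_closed[OF M g] by auto
    show "\<not> p dvd card (cj g ` K)" using K(2) card_cj[OF subgroup.subset[OF sub(3)] gG(1)] by simp
    show "normal_in (cj g ` K) L"
      unfolding normal_in_def
    proof (intro conjI ballI)
      show "subgroup (cj g ` K) G" by (rule subgroup_cj[OF sub(3) gG(1)])
      show "cj g ` K \<subseteq> L" using L g sub(4) by (auto simp: normal_in_def)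
      fix l h assume l: "l \<in> L" and "h \<in> cj g ` K"
      then obtain k where k: "k \<in> K" "h = cj g k" by blast
      have G: "l \<in> carrier G" "k \<in> carrier G" using l k(1) sub MG by auto
      have "cj (inv g) l \<in> L" using L gG(2) l by (simp add: normal_in_def)
      then have "cj (cj (inv g) l) k \<in> K" using K(1) k(1) by (simp add: normal_in_def)
      moreover have "cj l h = cj g (cj (cj (inv g) l) k)" using G gG(1) by (simp add: k(2) cj_def word_simps)
      ultimately show "cj l h \<in> cj g ` K" by blast
    qed
  qed
  then show ?thesis using sub by (auto simp: normal_in_def)
qed

text \<open>
  Let \<open>L\<close> be a normal subgroup of prime index. Its Sylow \<open>p\<close>-subgroup \<open>N\<close> inside \<open>P\<close> is normal by
  induction, and it is all of \<open>P\<close> unless the index is \<open>p\<close>. In that case, for every prime \<open>q\<close> other than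
  \<open>p\<close>, a Frattini argument gives an element of \<open>P\<close> outside \<open>L\<close> that normalises a Sylow \<open>q\<close>-subgroup \<open>Q\<close>
  of \<open>L\<close>. It centralises \<open>Q\<close>, which acts faithfully on \<open>N\<close> because \<open>N\<close> is self-centralising in \<open>L\<close>. As \<open>P\<close>
  is generated by this element and \<open>N\<close>, it is normalised by \<open>Q\<close>. So the normaliser of \<open>P\<close> contains a
  Sylow subgroup of \<open>M\<close> for every prime.
\<close>

theorem sylow_normal_in:
  assumes sol: "solvable G" and p: "prime p" "odd p"
    and O: "subgroup O' G" "odd (card O')" "\<And>g y. \<lbrakk>g \<in> carrier G; y \<in> O'\<rbrakk> \<Longrightarrow> cj g y \<in> O'"
    and quot: "\<And>g. g \<in> carrier G \<Longrightarrow> \<exists>k :: nat. g [^] (2 ^ k :: nat) \<in> O'"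
    and M: "subgroup M G" and P: "sylow_in p M P" "class2 P"
    and core: "\<And>K. normal_in K M \<Longrightarrow> \<not> p dvd card K \<Longrightarrow> K = {\<one>}"
  shows "normal_in P M"
  using M P core
proof (induction "card M" arbitrary: M P rule: less_induct)
  case less
  note M = less.prems(1) and P = less.prems(2,3) and core = less.prems(4)
  have MG: "y \<in> carrier G" if "y \<in> M" for y using subgroup.mem_carrier[OF M that] .
  have PG: "subgroup P G" "P \<subseteq> M" "card P = p ^ multiplicity p (card M)" using P(1) by (auto simp: sylow_in_def)
  show ?case
  proof (cases "M = {\<one>}")
    case True
    then show ?thesis using PG by (auto simp: normal_in_def subgroup.one_closed)
  next
    case False
    obtain L r where L: "normal_in L M" "prime r" "card M = r * card L" "\<And>x. x \<in> M \<Longrightarrow> x [^] r \<in> L"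
      "\<And>x. x \<in> M \<Longrightarrow> x \<notin> L \<Longrightarrow> cyc_ext L x = M"
      by (rule prime_index_subgroup[OF sol M False]) blast
    have LG: "subgroup L G" "L \<subseteq> M" using L(1) by (auto simp: normal_in_def)
    have L_cj: "cj g ` L \<subseteq> L" if "g \<in> M" for g using L(1) that by (auto simp: normal_in_def)
    have Lpos: "card L > 0" by (rule card_sub_pos[OF LG(1)])
    have smaller: "card L < card M" using L(3) Lpos prime_gt_1_nat[OF L(2)] by simp
    have coreL: "K = {\<one>}" if K: "normal_in K L" "\<not> p dvd card K" for K
    proof -
      obtain K0 where K0: "normal_in K0 L" "\<not> p dvd card K0" "\<And>K. normal_in K L \<Longrightarrow> \<not> p dvd card K \<Longrightarrow> K \<subseteq> K0"
        by (rule p'_core_exists[OF p(1) LG(1)]) blast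
      have "K0 = {\<one>}" by (rule core[OF p'_core_normal_in[OF M L(1) K0] K0(2)])
      then have "K \<subseteq> {\<one>}" using K0(3)[OF K] by simp
      moreover have "\<one> \<in> K" using K(1) by (simp add: normal_in_def subgroup.one_closed)
      ultimately show ?thesis by blast
    qed
    obtain S where S: "sylow_in p L S" by (rule exists_sylow_in[OF p(1) LG(1)])
    have SG: "subgroup S G" "S \<subseteq> M" "card S = p ^ multiplicity p (card L)"
      using S LG(2) by (auto simp: sylow_in_def)
    obtain m where m: "m \<in> M" "cj m ` S \<subseteq> P" by (rule sylow_absorbs[OF p(1) M P(1) SG])
    define N where "N = cj m ` S"
    have NS: "sylow_in p L N" unfolding N_def by (rule sylow_in_cj[OF S LG(1) MG[OF m(1)] L_cj[OF m(1)]])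
    have N: "subgroup N G" "N \<subseteq> L" "card N = p ^ multiplicity p (card L)" "N \<subseteq> P"
      using NS m(2) by (auto simp: sylow_in_def N_def)
    have "class2 N" using P(2) N(4) unfolding class2_def by blast
    then have nN: "normal_in N L" using less.hyps[OF smaller LG(1) NS] coreL by blast
    have Np: "x \<in> N" if x: "x \<in> L" "p_element p x" for x
    proof -
      obtain l where l: "l \<in> L" "cj l x \<in> N" by (rule p_element_in_sylow[OF p(1) LG(1) NS x])
      have "cj (inv l) (cj l x) \<in> N" using nN l subgroup.m_inv_closed[OF LG(1)] by (simp add: normal_in_def)
      then show ?thesis using subgroup.mem_carrier[OF LG(1)] l(1) x(1) by simp
    qed
    have NM: "normal_in N M"
      unfolding normal_in_def
    proof (intro conjI ballI)
      fix g h assume gh: "g \<in> M" "h \<in> N"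
      then have "cj g h \<in> L" using N(2) L_cj by blast
      moreover have "h \<in> carrier G" using gh(2) N(2) LG(2) MG by blast
      then have "p_element p (cj g h)"
        using p_element_cj[OF sylow_elements[OF NS gh(2)] MG[OF gh(1)]] by simp
      ultimately show "cj g h \<in> N" by (rule Np)
    qed (use N LG(2) in auto)
    show ?thesis
    proof (cases "r = p")
      case False
      then have "multiplicity p r = 0" using p(1) L(2) by (simp add: prime_multiplicity_other)
      then have "multiplicity p (card M) = multiplicity p (card L)"
        using p(1) L(2,3) Lpos by (simp add: prime_elem_multiplicity_mult_distrib prime_gt_0_nat)
      then have "N = P" using card_subset_eq[OF finite_sub[OF PG(1)] N(4)] N(3) PG(3) by simp
      then show ?thesis using NM by simp
    next
      case True
      have mult: "multiplicity p (card M) = Suc (multiplicity p (card L))"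
        using p(1) L(3) Lpos True by (simp add: prime_elem_multiplicity_mult_distrib prime_gt_0_nat)
      have PL: "P \<inter> L \<subseteq> N" using Np sylow_elements[OF P(1)] by blast
      have M_eq: "cyc_ext N x = P" if x: "x \<in> P" "x \<notin> L" for x
      proof
        show "cyc_ext N x \<subseteq> P"
        proof
          fix y assume "y \<in> cyc_ext N x"
          then obtain n and i :: nat where "n \<in> N" "y = n \<otimes> x [^] i" by (rule cyc_extE)
          then show "y \<in> P" using N(4) subgroup.m_closed[OF PG(1) _ sub_pow_closed[OF PG(1) x(1)]] by blast
        qed
        show "P \<subseteq> cyc_ext N x"
        proof
          fix y assume y: "y \<in> P"
          have "y \<in> cyc_ext L x" using L(5)[of x] x y PG(2) by blast
          then obtain l and i :: nat where l: "l \<in> L" "y = l \<otimes> x [^] i" by (rule cyc_extE)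
          have G: "l \<in> carrier G" "x \<in> carrier G" using l(1) x(1) LG(2) PG(2) MG by auto
          have "l = y \<otimes> inv (x [^] i)" using G l(2) by (simp add: m_assoc)
          then have "l \<in> P"
            using subgroup.m_closed[OF PG(1) y subgroup.m_inv_closed[OF PG(1) sub_pow_closed[OF PG(1) x(1)]]] by simp
          then show "y \<in> cyc_ext N x" using l PL cyc_extI by blast
        qed
      qed
      obtain x1 where x1: "x1 \<in> P" "x1 \<notin> L"
      proof -
        have "\<not> P \<subseteq> N"
        proof
          assume "P \<subseteq> N"
          then have "card P \<le> card N" using card_mono[OF finite_sub[OF N(1)]] by blast
          then show False using PG(3) N(3) mult prime_gt_1_nat[OF p(1)] by simp
        qed
        then show ?thesis using that PL by blast
      qed
      define W where "W = {g \<in> M. cj g ` P \<subseteq> P}"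
      have W: "subgroup W G"
      proof (rule subgroupI)
        show "W \<subseteq> carrier G" using MG by (auto simp: W_def)
        have "\<one> \<in> W" using subgroup.one_closed[OF M] subgroup.mem_carrier[OF PG(1)] by (auto simp: W_def)
        then show "W \<noteq> {}" by blast
        show "inv a \<in> W" if "a \<in> W" for a
          using that MG subgroup.m_inv_closed[OF M] cj_image_inv[OF _ _ PG(1)] by (auto simp: W_def)
        show "a \<otimes> b \<in> W" if "a \<in> W" "b \<in> W" for a b
        proof -
          have ab: "a \<in> M" "b \<in> M" "cj a ` P \<subseteq> P" "cj b ` P \<subseteq> P" using that by (auto simp: W_def)
          have "cj (a \<otimes> b) y \<in> P" if y: "y \<in> P" for y
          proof -
            have "cj (a \<otimes> b) y = cj a (cj b y)" using ab(1,2) y PG(2) MG by (auto simp: cj_cj)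
            then show ?thesis using ab(3,4) y by auto
          qed
          then show ?thesis using subgroup.m_closed[OF M ab(1,2)] by (auto simp: W_def)
        qed
      qed
      have WM: "W \<subseteq> M" by (auto simp: W_def)
      have mult_le: "multiplicity q (card M) \<le> multiplicity q (card W)"
        if Q: "sylow_in q M Q" "Q \<subseteq> W" "prime q" for q Q
      proof -
        have "card Q dvd card W" using card_subgroup_dvd[OF _ W Q(2)] Q(1) by (simp add: sylow_in_def)
        then have "q ^ multiplicity q (card M) dvd card W" using Q(1) by (simp add: sylow_in_def)
        then show ?thesis using card_sub_pos[OF W] Q(3) power_dvd_iff_le_multiplicity[of "card W" q]
          by (simp add: prime_nat_iff)
      qed
      have PW: "P \<subseteq> W" using PG(1,2) cj_in_subgroup by (auto simp: W_def)
      have "\<exists>Q. sylow_in q M Q \<and> Q \<subseteq> W" if q: "prime q" "q \<noteq> p" for q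
      proof -
        obtain Q0 where Q0: "sylow_in q L Q0" by (rule exists_sylow_in[OF q(1) LG(1)])
        have Q0G: "subgroup Q0 G" "Q0 \<subseteq> L" "card Q0 = q ^ multiplicity q (card L)"
          using Q0 by (auto simp: sylow_in_def)
        have multq: "multiplicity q (card M) = multiplicity q (card L)"
          using p(1) q L(3) Lpos True
          by (simp add: prime_elem_multiplicity_mult_distrib prime_gt_0_nat prime_multiplicity_other)
        have x1M: "x1 \<in> M" using x1(1) PG(2) by blast
        obtain l where l: "l \<in> L" "cj (l \<otimes> x1) ` Q0 = Q0"
          by (rule frattini[OF q(1) LG(1) Q0 MG[OF x1M] L_cj[OF x1M]])
        define n where "n = l \<otimes> x1"
        have nM: "n \<in> M" using l(1) LG(2) x1M subgroup.m_closed[OF M] by (auto simp: n_def)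
        note nG = MG[OF nM]
        have nL: "n \<notin> L"
        proof
          assume "n \<in> L"
          then have "inv l \<otimes> n \<in> L" using subgroup.m_closed[OF LG(1)] subgroup.m_inv_closed[OF LG(1) l(1)] by blast
          then show False using x1(2) l(1) LG(2) MG x1M by (auto simp: n_def)
        qed
        \<comment> \<open>The \<open>p\<close>-part of \<open>n\<close> still lies outside \<open>L\<close>.\<close>
        define s where "s = card M div p ^ multiplicity p (card M)"
        have cs: "card M = p ^ multiplicity p (card M) * s" by (simp add: s_def multiplicity_dvd)
        have "\<not> p dvd s"
          unfolding s_def by (rule multiplicity_decompose) (use card_sub_pos[OF M] p in \<open>auto simp: prime_nat_iff\<close>)
        then have cop: "coprime s p" using prime_imp_coprime[OF p(1), of s] coprime_commute by blast
        define x0 where "x0 = n [^] s"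
        have x0M: "x0 \<in> M" unfolding x0_def by (rule sub_pow_closed[OF M nM])
        have x0L: "x0 \<notin> L"
          using coprime_powers_in_subgroup[OF LG(1) nG _ _ cop] L(4)[OF nM] nL True by (auto simp: x0_def)
        have "x0 [^] (p ^ multiplicity p (card M)) = n [^] card M"
          unfolding x0_def nat_pow_pow[OF nG] by (simp only: mult.commute[of s] cs[symmetric])
        then have x0p: "p_element p x0" using sub_pow_card[OF M nM] by (auto simp: p_element_def)
        have x0Q: "cj x0 ` Q0 \<subseteq> Q0"
          unfolding x0_def by (rule cj_image_pow[OF nG _ subgroup.subset[OF Q0G(1)]]) (use l(2) in \<open>simp add: n_def\<close>)
        obtain k where k: "k \<in> M" "cj k x0 \<in> P" by (rule p_element_in_sylow[OF p(1) M P(1) x0M x0p])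
        note kG = MG[OF k(1)]
        define x where "x = cj k x0"
        define Q where "Q = cj k ` Q0"
        have x: "x \<in> P" "x \<in> carrier G" using k(2) PG(2) MG by (auto simp: x_def)
        have xL: "x \<notin> L"
        proof
          assume "x \<in> L"
          then have "cj (inv k) x \<in> L" using L_cj[OF subgroup.m_inv_closed[OF M k(1)]] by blast
          then show False using x0L kG MG[OF x0M] by (simp add: x_def)
        qed
        have xp: "p_element p x" using p_element_cj[OF x0p kG MG[OF x0M]] by (simp add: x_def)
        have QL: "sylow_in q L Q" unfolding Q_def by (rule sylow_in_cj[OF Q0 LG(1) kG L_cj[OF k(1)]])
        then have QM: "sylow_in q M Q" using multq LG(2) by (auto simp: sylow_in_def)
        have QG: "subgroup Q G" "Q \<subseteq> L" "card Q = q ^ multiplicity q (card L)" using QL by (auto simp: sylow_in_def)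
        have xQ: "cj x ` Q \<subseteq> Q"
        proof
          fix y assume "y \<in> cj x ` Q"
          then obtain w where w: "w \<in> Q0" "y = cj x (cj k w)" by (auto simp: Q_def)
          have G: "w \<in> carrier G" "x0 \<in> carrier G" using w(1) subgroup.mem_carrier[OF Q0G(1)] MG[OF x0M] by auto
          have "y = cj k (cj x0 w)" using G kG by (simp add: w(2) x_def cj_def word_simps)
          then show "y \<in> Q" using x0Q w(1) by (auto simp: Q_def)
        qed
        obtain j where j: "x [^] (p ^ j) = \<one>" using xp by (auto simp: p_element_def)
        have copq: "coprime (p ^ a) (q ^ b)" for a b using p(1) q by (simp add: primes_coprime)
        have central: "x \<otimes> h = h \<otimes> x" if h: "h \<in> Q" for h
        proof (cases "q = 2")
          case True
          show ?thesis
            by (rule odd_p_element_centralises_2_group[OF O quot p x(2) xp QG(1) _ xQ h])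
              (use QG(3) True in auto)
        next
          case False
          then have "odd q" using q(1) primes_dvd_imp_eq two_is_prime_nat by blast
          show ?thesis
          proof (rule class2_element_centralises[OF sol M NM PG(1,2) N(4) P(2) _ x(1) QG(1) _ xQ cj_image_inv[OF x(2) xQ QG(1)] _ _ _ j _ h])
            show "odd (card N)" using N(3) p(2) by simp
            show "Q \<subseteq> M" using QG(2) LG(2) by blast
            show "odd (card Q)" using QG(3) \<open>odd q\<close> by simp
            show "coprime (card Q) (card N)" using QG(3) N(3) copq by (simp add: coprime_commute)
            show "coprime (p ^ j) (card Q)" using QG(3) copq by simp
            show "h = \<one>" if h: "h \<in> Q" "\<And>n. n \<in> N \<Longrightarrow> h \<otimes> n = n \<otimes> h" for h
            proof -
              have "h \<in> N"
                by (rule self_centralising[OF sol p(1) LG(1) coreL nN Np sylow_elements[OF NS]])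
                  (use h QG(2) in auto)
              then show ?thesis
                using coprime_pow_eq_one[OF subgroup.mem_carrier[OF QG(1) h(1)] sub_pow_card[OF N(1)] sub_pow_card[OF QG(1) h(1)]]
                  N(3) QG(3) copq by simp
            qed
          qed
        qed
        have "Q \<subseteq> W"
        proof
          fix h assume h: "h \<in> Q"
          have hM: "h \<in> M" using h QG(2) LG(2) by blast
          have "cj h y \<in> P" if y: "y \<in> P" for y
          proof -
            have "y \<in> cyc_ext N x" using M_eq[OF x(1) xL] y by simp
            then obtain n and i :: nat where n: "n \<in> N" "y = n \<otimes> x [^] i" by (rule cyc_extE)
            have G: "n \<in> carrier G" "h \<in> carrier G" using subgroup.mem_carrier[OF N(1) n(1)] MG[OF hM] .
            have "x [^] i \<otimes> h = h \<otimes> x [^] i" by (rule group_commutes_pow[OF central[OF h] x(2) G(2)])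
            then have "cj h (x [^] i) = x [^] i \<otimes> h \<otimes> inv h" by (simp add: cj_def)
            then have "cj h (x [^] i) = x [^] i" using x(2) G by (simp add: m_assoc)
            then have "cj h y = cj h n \<otimes> x [^] i" using n(2) G x(2) by (simp add: cj_mult)
            moreover have "cj h n \<in> P" using NM hM n(1) N(4) by (auto simp: normal_in_def)
            ultimately show ?thesis using subgroup.m_closed[OF PG(1) _ sub_pow_closed[OF PG(1) x(1)]] by simp
          qed
          then show "h \<in> W" using hM by (auto simp: W_def)
        qed
        then show ?thesis using QM by blast
      qed
      then have "multiplicity q (card M) \<le> multiplicity q (card W)" if "prime q" for q
        using mult_le[OF _ _ that] P(1) PW that by metis
      then have "card M dvd card W" using card_sub_pos[OF M] by (intro multiplicity_le_imp_dvd) auto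
      then have "card M \<le> card W" using card_sub_pos[OF W] by (rule dvd_imp_le)
      then have "W = M" using card_seteq[OF finite_sub[OF M] WM] by simp
      then have "\<forall>g\<in>M. cj g ` P \<subseteq> P" by (auto simp: W_def)
      then show ?thesis using PG by (auto simp: normal_in_def)
    qed
  qed
qed

end

context finite_group
begin

section \<open>Complements of normal Sylow subgroups of class two\<close>

lemma normal_sylow_contains_p_elements:
  assumes p: "prime p" and M: "subgroup M G" and P: "sylow_in p M P" "normal_in P M"
    and x: "x \<in> M" "p_element p x"
  shows "x \<in> P"
proof -
  obtain m where m: "m \<in> M" "cj m x \<in> P" by (rule p_element_in_sylow[OF p M P(1) x])
  have "cj (inv m) (cj m x) \<in> P" using P(2) m subgroup.m_inv_closed[OF M] by (simp add: normal_in_def)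
  then show ?thesis using subgroup.mem_carrier[OF M] m(1) x(1) by simp
qed

lemma finprod_conjugates:
  assumes A: "comm_group A" and M: "subgroup M G" and P: "normal_in P M"
    and q: "\<And>u. u \<in> P \<Longrightarrow> q u \<in> carrier A" "\<And>u v. \<lbrakk>u \<in> P; v \<in> P\<rbrakk> \<Longrightarrow> q (u \<otimes> v) = q u \<otimes>\<^bsub>A\<^esub> q v"
    and I: "finite I" "\<And>i. i \<in> I \<Longrightarrow> f i \<in> P"
  shows "\<exists>w\<in>P. \<forall>g\<in>M. finprod A (\<lambda>i. q (cj g (f i))) I = q (cj g w)"
proof -
  interpret A: comm_group A by (rule A)
  have PG: "subgroup P G" using P by (simp add: normal_in_def)
  have Pc: "u \<in> carrier G" if "u \<in> P" for u using subgroup.mem_carrier[OF PG that] .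
  have Mc: "u \<in> carrier G" if "u \<in> M" for u using subgroup.mem_carrier[OF M that] .
  have P_cj: "cj g u \<in> P" if "g \<in> M" "u \<in> P" for g u using P that by (simp add: normal_in_def)
  have one: "\<one> \<in> P" by (rule subgroup.one_closed[OF PG])
  have q1: "q \<one> = \<one>\<^bsub>A\<^esub>" using q(2)[OF one one] q(1)[OF one] by simp
  show ?thesis
    using I
  proof (induction I rule: finite_induct)
    case empty
    then show ?case using one q1 Mc by (intro bexI[of _ \<one>]) simp_all
  next
    case (insert i I)
    then obtain w where w: "w \<in> P" "\<forall>g\<in>M. finprod A (\<lambda>i. q (cj g (f i))) I = q (cj g w)" by auto
    have fi: "f i \<in> P" using insert.prems by simp
    have "finprod A (\<lambda>i. q (cj g (f i))) (insert i I) = q (cj g (f i \<otimes> w))" if g: "g \<in> M" for g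
    proof -
      have "finprod A (\<lambda>i. q (cj g (f i))) (insert i I)
          = q (cj g (f i)) \<otimes>\<^bsub>A\<^esub> finprod A (\<lambda>i. q (cj g (f i))) I"
        by (rule A.finprod_insert) (use insert.hyps insert.prems q(1) P_cj g in auto)
      also have "\<dots> = q (cj g (f i) \<otimes> cj g w)" using w g fi P_cj q(2) by simp
      finally show ?thesis using Mc[OF g] Pc fi w(1) by (simp add: cj_mult)
    qed
    then show ?case using subgroup.m_closed[OF PG fi w(1)] by blast
  qed
qed

text \<open>
  For a transversal \<open>T\<close> of \<open>P\<close> and \<open>g * s = u * t\<close> with \<open>s, t \<in> T\<close> and \<open>u \<in> P\<close>, the product \<open>F g\<close> of the
  \<open>q u\<close> over all \<open>s\<close> satisfies the cocycle rule and is the power of \<open>q\<close> by the index on \<open>P\<close>.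
  Its zeros form the required subgroup.
\<close>

lemma complement_modulo_kernel:
  assumes A: "comm_group A" and p: "prime p" and M: "subgroup M G" and P: "normal_in P M" "sylow_in p M P"
    and q: "\<And>u. u \<in> P \<Longrightarrow> q u \<in> carrier A" "\<And>u v. \<lbrakk>u \<in> P; v \<in> P\<rbrakk> \<Longrightarrow> q (u \<otimes> v) = q u \<otimes>\<^bsub>A\<^esub> q v"
    and Z: "Z = {u \<in> P. q u = \<one>\<^bsub>A\<^esub>}" "normal_in Z M"
  obtains K where "subgroup K G" "K \<subseteq> M" "K \<inter> P = Z" "\<And>g. g \<in> M \<Longrightarrow> \<exists>u\<in>P. \<exists>k\<in>K. g = u \<otimes> k"
proof -
  interpret A: comm_group A by (rule A)
  have PG: "subgroup P G" "P \<subseteq> M" using P by (auto simp: normal_in_def)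
  have ZG: "subgroup Z G" using Z(2) by (simp add: normal_in_def)
  have Pc [simp]: "u \<in> carrier G" if "u \<in> P" for u using subgroup.mem_carrier[OF PG(1) that] .
  have Mc [simp]: "u \<in> carrier G" if "u \<in> M" for u using subgroup.mem_carrier[OF M that] .
  have P_cj: "cj g u \<in> P" if "g \<in> M" "u \<in> P" for g u using P(1) that by (simp add: normal_in_def)
  have Mm: "x \<otimes> y \<in> M" if "x \<in> M" "y \<in> M" for x y using subgroup.m_closed[OF M that] .
  have Mi: "inv x \<in> M" if "x \<in> M" for x using subgroup.m_inv_closed[OF M that] .
  have one: "\<one> \<in> P" "\<one> \<in> M" using subgroup.one_closed[OF PG(1)] subgroup.one_closed[OF M] .
  have q1: "q \<one> = \<one>\<^bsub>A\<^esub>" using q(2)[OF one(1) one(1)] q(1)[OF one(1)] by simp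
  have q_pow: "q (u [^] (k :: nat)) = q u [^]\<^bsub>A\<^esub> k" if u: "u \<in> P" for u k
    by (induction k) (use u q q1 sub_pow_closed[OF PG(1) u] in simp_all)
  define R where "R x y \<longleftrightarrow> x \<otimes> inv y \<in> P" for x y
  have R_refl: "R x x" if "x \<in> M" for x using that one by (simp add: R_def)
  have R_sym: "R y x" if "x \<in> M" "y \<in> M" "R x y" for x y
  proof -
    have "inv (x \<otimes> inv y) \<in> P" using that(3) subgroup.m_inv_closed[OF PG(1)] by (simp add: R_def)
    then show ?thesis using that(1,2) by (simp add: R_def inv_mult_group)
  qed
  have R_trans: "R x z" if "x \<in> M" "y \<in> M" "z \<in> M" "R x y" "R y z" for x y z
  proof -
    have "(x \<otimes> inv y) \<otimes> (y \<otimes> inv z) \<in> P" using that(4,5) subgroup.m_closed[OF PG(1)] by (simp add: R_def)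
    then show ?thesis using that(1-3) by (simp add: R_def m_assoc)
  qed
  have R_left: "R (g \<otimes> x) (g \<otimes> y)" if "g \<in> M" "x \<in> M" "y \<in> M" "R x y" for g x y
  proof -
    have "cj g (x \<otimes> inv y) \<in> P" using that P_cj by (simp add: R_def)
    then show ?thesis using that(1-3) by (simp add: R_def cj_def word_simps)
  qed
  define t where "t x = (SOME y. y \<in> M \<and> R x y)" for x
  have t: "t x \<in> M" "R x (t x)" if "x \<in> M" for x
    using someI[of "\<lambda>y. y \<in> M \<and> R x y" x] that R_refl[OF that] by (simp_all add: t_def)
  have t_cong: "t x = t y" if "x \<in> M" "y \<in> M" "R x y" for x y
  proof -
    have "(\<lambda>z. z \<in> M \<and> R x z) = (\<lambda>z. z \<in> M \<and> R y z)"
      using that R_trans R_sym by blast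
    then show ?thesis unfolding t_def by simp
  qed
  define T where "T = t ` M"
  have TM: "s \<in> M" if "s \<in> T" for s using that t(1) by (auto simp: T_def)
  have tT: "t x \<in> T" if "x \<in> M" for x using that by (simp add: T_def)
  have t_T: "t s = s" if s: "s \<in> T" for s
  proof -
    obtain x where x: "x \<in> M" "s = t x" using s by (auto simp: T_def)
    show ?thesis using t_cong[OF x(1) t(1)[OF x(1)] t(2)[OF x(1)]] x(2) by simp
  qed
  have finT: "finite T" using finite_sub[OF M] by (simp add: T_def)
  have "card T = card (rcosets\<^bsub>G\<lparr>carrier := M\<rparr>\<^esub> P)"
  proof -
    have "bij_betw (\<lambda>s. P #> s) T (rcosets\<^bsub>G\<lparr>carrier := M\<rparr>\<^esub> P)"
    proof (rule bij_betwI')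
      fix x y assume xy: "x \<in> T" "y \<in> T"
      note m = TM[OF xy(1)] TM[OF xy(2)]
      show "(P #> x = P #> y) = (x = y)"
      proof
        assume "P #> x = P #> y"
        then have "x \<in> P #> y" using rcos_self[of x P] m PG(1) by simp
        then obtain u where "u \<in> P" "x = u \<otimes> y" by (auto simp: r_coset_def)
        then have "R x y" using m by (simp add: R_def m_assoc)
        then show "x = y" using t_cong[OF m] t_T xy by simp
      qed simp
      show "P #> x \<in> rcosets\<^bsub>G\<lparr>carrier := M\<rparr>\<^esub> P" using m by (auto simp: RCOSETS_def)
    next
      fix C assume "C \<in> rcosets\<^bsub>G\<lparr>carrier := M\<rparr>\<^esub> P"
      then obtain x where x: "x \<in> M" "C = P #> x" by (auto simp: RCOSETS_def)
      have "x \<otimes> inv (t x) \<in> P" using t(2)[OF x(1)] by (simp add: R_def)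
      then have "x \<in> P #> t x"
        using x(1) t(1)[OF x(1)] rcosI[of "x \<otimes> inv (t x)" P "t x"] subgroup.subset[OF PG(1)] by (simp add: m_assoc)
      then have "P #> t x = C" using repr_independence[of x P "t x"] t(1)[OF x(1)] PG(1) x(2) by simp
      then show "\<exists>s\<in>T. C = P #> s" using tT[OF x(1)] by blast
    qed
    then show ?thesis by (rule bij_betw_same_card)
  qed
  then have "\<not> p dvd card T" using index_not_dvd[OF P(2) p M] by simp
  then have cop: "coprime (card T) (card P)"
    using prime_imp_coprime[OF p, of "card T"] P(2) by (simp add: sylow_in_def coprime_commute)
  define f where "f g s = g \<otimes> s \<otimes> inv (t (g \<otimes> s))" for g s
  have f_P: "f g s \<in> P" if "g \<in> M" "s \<in> M" for g s
    using t(2)[OF Mm[OF that]] by (simp add: f_def R_def)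
  have f_mult: "f (g \<otimes> h) s = cj g (f h s) \<otimes> f g (t (h \<otimes> s))" if g: "g \<in> M" "h \<in> M" "s \<in> M" for g h s
  proof -
    have m: "t (h \<otimes> s) \<in> M" "t (g \<otimes> h \<otimes> s) \<in> M" using t(1) g Mm by simp_all
    have "R (g \<otimes> (h \<otimes> s)) (g \<otimes> t (h \<otimes> s))"
      by (rule R_left) (use g Mm t in simp_all)
    then have e: "t (g \<otimes> t (h \<otimes> s)) = t (g \<otimes> h \<otimes> s)"
      using t_cong[of "g \<otimes> (h \<otimes> s)" "g \<otimes> t (h \<otimes> s)"] g Mm m(1) by (simp add: m_assoc)
    show ?thesis using g m by (simp add: f_def e cj_def word_simps)
  qed
  have t_bij: "bij_betw (\<lambda>s. t (h \<otimes> s)) T T" if h: "h \<in> M" for h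
  proof -
    have "inj_on (\<lambda>s. t (h \<otimes> s)) T"
    proof (rule inj_onI)
      fix x y assume xy: "x \<in> T" "y \<in> T" and eq: "t (h \<otimes> x) = t (h \<otimes> y)"
      note m = TM[OF xy(1)] TM[OF xy(2)]
      have hm: "h \<otimes> x \<in> M" "h \<otimes> y \<in> M" using Mm h m by simp_all
      have "R (h \<otimes> x) (h \<otimes> y)"
        using R_trans[OF hm(1) t(1)[OF hm(1)] hm(2) t(2)[OF hm(1)]] R_sym[OF hm(2) t(1)[OF hm(2)] t(2)[OF hm(2)]] eq by simp
      then have "R (inv h \<otimes> (h \<otimes> x)) (inv h \<otimes> (h \<otimes> y))" using R_left[OF Mi[OF h] hm] by simp
      then have "R x y" using h m by simp
      then show "x = y" using t_cong[OF m] t_T xy by simp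
    qed
    moreover have "(\<lambda>s. t (h \<otimes> s)) ` T \<subseteq> T" using tT Mm h TM by auto
    ultimately show ?thesis using finT by (simp add: bij_betw_def endo_inj_surj)
  qed
  define F where "F g = finprod A (\<lambda>s. q (f g s)) T" for g
  have qf: "q (f g s) \<in> carrier A" "q (cj h (f g s)) \<in> carrier A" if "g \<in> M" "s \<in> T" "h \<in> M" for g s h
    using q(1) f_P P_cj that TM by simp_all
  have F_closed: "F g \<in> carrier A" if "g \<in> M" for g
    unfolding F_def by (rule A.finprod_closed) (use that qf in auto)
  have F_mult: "F (g \<otimes> h) = finprod A (\<lambda>s. q (cj g (f h s))) T \<otimes>\<^bsub>A\<^esub> F g" if g: "g \<in> M" "h \<in> M" for g h
  proof -
    have "F (g \<otimes> h) = finprod A (\<lambda>s. q (cj g (f h s)) \<otimes>\<^bsub>A\<^esub> q (f g (t (h \<otimes> s)))) T"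
      unfolding F_def
      by (rule A.finprod_cong') (use g f_mult f_P P_cj q TM t(1) Mm in auto)
    also have "\<dots> = finprod A (\<lambda>s. q (cj g (f h s))) T \<otimes>\<^bsub>A\<^esub> finprod A (\<lambda>s. q (f g (t (h \<otimes> s)))) T"
      by (rule A.finprod_multf) (use g qf tT Mm TM in auto)
    also have "finprod A (\<lambda>s. q (f g (t (h \<otimes> s)))) T = finprod A (\<lambda>s. q (f g s)) ((\<lambda>s. t (h \<otimes> s)) ` T)"
      by (rule A.finprod_reindex[symmetric]) (use t_bij[OF g(2)] qf g in \<open>auto simp: bij_betw_def\<close>)
    finally show ?thesis using t_bij[OF g(2)] by (simp add: F_def bij_betw_def)
  qed
  have F_conj: "\<exists>w\<in>P. F h = q w \<and> (\<forall>g\<in>M. finprod A (\<lambda>s. q (cj g (f h s))) T = q (cj g w))" if h: "h \<in> M" for h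
  proof -
    obtain w where w: "w \<in> P" "\<forall>g\<in>M. finprod A (\<lambda>s. q (cj g (f h s))) T = q (cj g w)"
      using finprod_conjugates[OF A M P(1) q finT, of "f h"] f_P[OF h] TM by blast
    have "finprod A (\<lambda>s. q (cj \<one> (f h s))) T = F h"
      unfolding F_def by (rule A.finprod_cong') (use f_P[OF h] TM q in auto)
    moreover have "finprod A (\<lambda>s. q (cj \<one> (f h s))) T = q (cj \<one> w)" using w(2) one(2) by blast
    ultimately have "F h = q w" using w(1) by simp
    then show ?thesis using w by blast
  qed
  have F_zero: "F (g \<otimes> h) = F g" if g: "g \<in> M" "h \<in> M" "F h = \<one>\<^bsub>A\<^esub>" for g h
  proof -
    obtain w where w: "w \<in> P" "F h = q w" "\<forall>g\<in>M. finprod A (\<lambda>s. q (cj g (f h s))) T = q (cj g w)"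
      using F_conj[OF g(2)] by blast
    have "w \<in> Z" using w g(3) Z(1) by simp
    then have "cj g w \<in> Z" using Z(2) g(1) by (simp add: normal_in_def)
    then have "q (cj g w) = \<one>\<^bsub>A\<^esub>" using Z(1) by simp
    then show ?thesis using F_mult[OF g(1,2)] w(3) g(1) F_closed by simp
  qed
  have F_P: "F u = q (u [^] card T)" if u: "u \<in> P" for u
  proof -
    have "f u s = u" if s: "s \<in> T" for s
    proof -
      have sM: "s \<in> M" using TM[OF s] .
      have uM: "u \<in> M" using u PG(2) by blast
      have "R (u \<otimes> s) s" using u sM by (simp add: R_def m_assoc)
      then have "t (u \<otimes> s) = s" using t_cong[OF Mm[OF uM sM] sM] t_T[OF s] by simp
      then show ?thesis using u sM by (simp add: f_def m_assoc)
    qed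
    then have "F u = finprod A (\<lambda>s. q u) T" unfolding F_def by (intro A.finprod_cong') (use q u in auto)
    also have "\<dots> = q u [^]\<^bsub>A\<^esub> card T" using q(1)[OF u] by (rule A.finprod_const)
    finally show ?thesis using q_pow[OF u] by simp
  qed
  define K where "K = {g \<in> M. F g = \<one>\<^bsub>A\<^esub>}"
  have F1: "F \<one> = \<one>\<^bsub>A\<^esub>" using F_P[OF one(1)] q1 by simp
  have "subgroup K G"
  proof (rule subgroupI)
    show "K \<subseteq> carrier G" by (auto simp: K_def)
    show "K \<noteq> {}" using F1 one(2) by (auto simp: K_def)
    show "inv a \<in> K" if "a \<in> K" for a
      using that F_zero[of "inv a" a] F1 Mi by (simp add: K_def)
    show "a \<otimes> b \<in> K" if "a \<in> K" "b \<in> K" for a b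
      using that F_zero[of a b] Mm by (simp add: K_def)
  qed
  moreover have "K \<subseteq> M" by (auto simp: K_def)
  moreover have "K \<inter> P = Z"
  proof
    show "Z \<subseteq> K \<inter> P"
    proof
      fix u assume u: "u \<in> Z"
      have "u [^] card T \<in> Z" by (rule sub_pow_closed[OF ZG u])
      then show "u \<in> K \<inter> P" using F_P[of u] u PG(2) by (auto simp: K_def Z(1))
    qed
    show "K \<inter> P \<subseteq> Z"
    proof
      fix u assume u: "u \<in> K \<inter> P"
      then have "u [^] card T \<in> Z" using F_P[of u] sub_pow_closed[OF PG(1)] by (auto simp: K_def Z(1))
      moreover have "u [^] card P \<in> Z" using sub_pow_card[OF PG(1)] u subgroup.one_closed[OF ZG] by auto
      ultimately show "u \<in> Z" using coprime_powers_in_subgroup[OF ZG _ _ _ cop] u by auto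
    qed
  qed
  moreover have "\<exists>u\<in>P. \<exists>k\<in>K. g = u \<otimes> k" if g: "g \<in> M" for g
  proof -
    obtain w where w: "w \<in> P" "F g = q w" using F_conj[OF g] by blast
    \<comment> \<open>\<open>u\<close> is the root of \<open>inv w\<close> whose exponent is the index.\<close>
    have "\<exists>u\<in>P. u [^] card T = inv w"
    proof (cases "card P = 1")
      case True
      then have "w = \<one>" using sub_pow_card[OF PG(1) w(1)] w(1) by simp
      then show ?thesis using one(1) by (intro bexI[of _ \<one>]) simp_all
    next
      case False
      obtain j v where jv: "card T * j = card P * v + 1" using coprime_bezout_strong[OF cop False] by blast
      have iw: "inv w \<in> P" using subgroup.m_inv_closed[OF PG(1) w(1)] .
      have "(inv w [^] j) [^] card T = inv w [^] (card P * v + 1)"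
        using w(1) jv by (simp only: nat_pow_pow inv_closed Pc mult.commute[of j])
      also have "\<dots> = (inv w [^] card P) [^] v \<otimes> inv w"
        using w(1) by (simp add: nat_pow_pow)
      also have "\<dots> = inv w" using sub_pow_card[OF PG(1) iw] w(1) by simp
      finally show ?thesis using sub_pow_closed[OF PG(1) iw] by blast
    qed
    then obtain u where u: "u \<in> P" "u [^] card T = inv w" by blast
    have uM: "u \<in> M" using u(1) PG(2) by blast
    have q_cj: "q (cj u x) = q x" if x: "x \<in> P" for x
    proof -
      have iu: "inv u \<in> P" using subgroup.m_inv_closed[OF PG(1) u(1)] .
      have "q (cj u x) = q u \<otimes>\<^bsub>A\<^esub> q x \<otimes>\<^bsub>A\<^esub> q (inv u)"
        using q(2) subgroup.m_closed[OF PG(1)] u(1) x iu by (simp add: cj_def)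
      also have "\<dots> = q x \<otimes>\<^bsub>A\<^esub> (q u \<otimes>\<^bsub>A\<^esub> q (inv u))"
        using q(1) u(1) x iu by (simp add: A.m_ac)
      also have "q u \<otimes>\<^bsub>A\<^esub> q (inv u) = \<one>\<^bsub>A\<^esub>" using q(2)[OF u(1) iu] u(1) q1 by simp
      finally show ?thesis using q(1)[OF x] by simp
    qed
    have "finprod A (\<lambda>s. q (cj u (f g s))) T = F g"
      unfolding F_def by (rule A.finprod_cong') (use q_cj f_P[OF g] TM q in auto)
    then have "F (u \<otimes> g) = q w \<otimes>\<^bsub>A\<^esub> q (inv w)" using F_mult[OF uM g] w(2) F_P[OF u(1)] u(2) by simp
    also have "\<dots> = \<one>\<^bsub>A\<^esub>"
      using q(2)[OF w(1) subgroup.m_inv_closed[OF PG(1) w(1)]] w(1) q1 by simp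
    finally have "u \<otimes> g \<in> K" using Mm[OF uM g] by (simp add: K_def)
    moreover have "g = inv u \<otimes> (u \<otimes> g)" using u(1) g by simp
    ultimately show ?thesis using subgroup.m_inv_closed[OF PG(1) u(1)] by blast
  qed
  ultimately show ?thesis by (rule that)
qed

text \<open>Two steps: first modulo the derived subgroup of \<open>P\<close>, then inside the latter, which is central in \<open>P\<close>.\<close>

theorem class2_complement:
  assumes p: "prime p" and M: "subgroup M G" and P: "normal_in P M" "sylow_in p M P" "class2 P"
  obtains H where "subgroup H G" "H \<subseteq> M" "H \<inter> P = {\<one>}" "\<And>g. g \<in> M \<Longrightarrow> \<exists>u\<in>P. \<exists>h\<in>H. g = u \<otimes> h"
proof -
  have PG: "subgroup P G" "P \<subseteq> M" using P by (auto simp: normal_in_def)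
  have Pc: "u \<in> carrier G" if "u \<in> P" for u using subgroup.mem_carrier[OF PG(1) that] .
  have Mc: "u \<in> carrier G" if "u \<in> M" for u using subgroup.mem_carrier[OF M that] .
  define Z where "Z = derived G P"
  have Z: "subgroup Z G" "Z \<subseteq> P"
    using derived_is_subgroup[OF subgroup.subset[OF PG(1)]] derived_incl[OF subset_refl PG(1)] by (auto simp: Z_def)
  define C where "C = {z \<in> P. \<forall>c\<in>P. z \<otimes> c = c \<otimes> z}"
  have C: "subgroup C G"
  proof (rule subgroupI)
    show "C \<subseteq> carrier G" using Pc by (auto simp: C_def)
    have "\<one> \<in> C" using subgroup.one_closed[OF PG(1)] Pc by (simp add: C_def)
    then show "C \<noteq> {}" by blast
  next
    fix a assume "a \<in> C"
    then have a: "a \<in> P" "\<And>c. c \<in> P \<Longrightarrow> a \<otimes> c = c \<otimes> a" unfolding C_def by blast+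
    have "inv a \<otimes> c = c \<otimes> inv a" if "c \<in> P" for c
      using commute_inv[OF Pc[OF a(1)] Pc[OF that] a(2)[OF that]] .
    then show "inv a \<in> C" using subgroup.m_inv_closed[OF PG(1) a(1)] unfolding C_def by blast
  next
    fix a b assume "a \<in> C" "b \<in> C"
    then have ab: "a \<in> P" "b \<in> P" "\<And>c. c \<in> P \<Longrightarrow> a \<otimes> c = c \<otimes> a" "\<And>c. c \<in> P \<Longrightarrow> b \<otimes> c = c \<otimes> b"
      unfolding C_def by blast+
    have "a \<otimes> b \<otimes> c = c \<otimes> (a \<otimes> b)" if "c \<in> P" for c
      using commute_mult[OF Pc[OF ab(1)] Pc[OF ab(2)] Pc[OF that] ab(3)[OF that] ab(4)[OF that]] .
    then show "a \<otimes> b \<in> C" using subgroup.m_closed[OF PG(1) ab(1,2)] unfolding C_def by blast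
  qed
  have "derived_set G P \<subseteq> C"
  proof
    fix x assume "x \<in> derived_set G P"
    then obtain a b where ab: "a \<in> P" "b \<in> P" "x = a \<otimes> b \<otimes> inv a \<otimes> inv b" by (elim UN_E singletonE)
    then have "x = cmt a b" by (simp only: cmt_def)
    then show "x \<in> C" using class2D[OF P(3) ab(1,2)] cmt_in_subgroup[OF PG(1) ab(1,2)] by (simp add: C_def)
  qed
  then have "Z \<subseteq> C" unfolding Z_def derived_def by (rule generate_subgroup_incl[OF _ C])
  then have Zc: "z \<otimes> c = c \<otimes> z" if "z \<in> Z" "c \<in> P" for z c using that unfolding C_def by blast
  have ZM: "normal_in Z M"
  proof -
    have "cj g ` P \<subseteq> P" if "g \<in> M" for g using P(1) that by (auto simp: normal_in_def)
    then have "cj g ` Z \<subseteq> Z" if "g \<in> M" for g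
      unfolding Z_def using cj_derived[OF Mc[OF that] subgroup.subset[OF PG(1)]] that by blast
    then show ?thesis using Z PG(2) by (auto simp: normal_in_def)
  qed
  let ?P = "G\<lparr>carrier := P\<rparr>"
  let ?A = "?P Mod Z"
  have A: "comm_group ?A" unfolding Z_def by (rule derived_quot_of_subgroup_is_comm_group[OF PG(1)])
  have "Z \<lhd> ?P" unfolding Z_def by (rule derived_subgroup_is_normal[OF PG(1)])
  then have "(\<lambda>u. Z #> u) \<in> hom ?P ?A" using normal.r_coset_hom_Mod[of Z ?P] by simp
  then have hom: "Z #> u \<in> carrier ?A" "Z #> (u \<otimes> v) = (Z #> u) \<otimes>\<^bsub>?A\<^esub> (Z #> v)"
    if "u \<in> P" "v \<in> P" for u v using that hom_in_carrier[of _ ?P ?A u] hom_mult[of _ ?P ?A u v] by auto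
  have ker: "Z = {u \<in> P. Z #> u = \<one>\<^bsub>?A\<^esub>}"
    using Z Pc coset_join1[of Z] coset_join2[of _ Z] subgroup.subset[OF Z(1)] by auto
  obtain K where K: "subgroup K G" "K \<subseteq> M" "K \<inter> P = Z" "\<And>g. g \<in> M \<Longrightarrow> \<exists>u\<in>P. \<exists>k\<in>K. g = u \<otimes> k"
    by (rule complement_modulo_kernel[OF A p M P(1,2), of "\<lambda>u. Z #> u", OF hom ker ZM]) blast+
  have ZK: "normal_in Z K" using ZM K(2,3) by (auto simp: normal_in_def)
  have sylZ: "sylow_in p K Z"
  proof -
    obtain S where S: "sylow_in p K S" by (rule exists_sylow_in[OF p K(1)])
    have SG: "subgroup S G" "S \<subseteq> K" "card S = p ^ multiplicity p (card K)" using S by (auto simp: sylow_in_def)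
    have "S \<subseteq> P" using normal_sylow_contains_p_elements[OF p M P(2,1)] sylow_elements[OF S] SG(2) K(2) by blast
    then have SZ: "S \<subseteq> Z" using SG(2) K(3) by blast
    have "card Z dvd card P" by (rule card_subgroup_dvd[OF Z(1) PG(1) Z(2)])
    then obtain j where j: "card Z = p ^ j" using P(2) divides_primepow_nat[OF p] by (auto simp: sylow_in_def)
    have "card Z dvd card K" using card_subgroup_dvd[OF Z(1) K(1)] K(3) by blast
    then have "j \<le> multiplicity p (card K)"
      using card_sub_pos[OF K(1)] p power_dvd_iff_le_multiplicity[of "card K" p j] j by (simp add: prime_nat_iff)
    then have "card Z \<le> card S" using j SG(3) prime_gt_0_nat[OF p] by (simp add: power_increasing)
    then have "S = Z" using card_seteq[OF finite_sub[OF Z(1)] SZ] by simp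
    then show ?thesis using S by simp
  qed
  have cgZ: "comm_group (G\<lparr>carrier := Z\<rparr>)"
    by (rule group.group_comm_groupI[OF subgroup_imp_group[OF Z(1)]]) (simp, metis Zc Z(2) subsetD partial_object.select_convs(1) partial_object.update_convs(1))
  have n1: "normal_in {\<one>} K" using K(1) Mc K(2) by (auto simp: normal_in_def triv_subgroup subgroup.one_closed)
  have k1: "{\<one>} = {u \<in> Z. u = \<one>\<^bsub>G\<lparr>carrier := Z\<rparr>\<^esub>}" using subgroup.one_closed[OF Z(1)] by auto
  obtain H where H: "subgroup H G" "H \<subseteq> K" "H \<inter> Z = {\<one>}" "\<And>g. g \<in> K \<Longrightarrow> \<exists>u\<in>Z. \<exists>h\<in>H. g = u \<otimes> h"
    by (rule complement_modulo_kernel[OF cgZ p K(1) ZK sylZ _ _ k1 n1]) (simp, simp, blast)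
  have "H \<inter> P = {\<one>}" using H(2,3) K(3) by blast
  moreover have "\<exists>u\<in>P. \<exists>h\<in>H. g = u \<otimes> h" if g: "g \<in> M" for g
  proof -
    obtain u k where uk: "u \<in> P" "k \<in> K" "g = u \<otimes> k" using K(4)[OF g] by blast
    obtain z h where zh: "z \<in> Z" "h \<in> H" "k = z \<otimes> h" using H(4)[OF uk(2)] by blast
    have "u \<in> carrier G" "z \<in> carrier G" "h \<in> carrier G"
      using Pc uk(1) zh(1) Z(2) subgroup.mem_carrier[OF H(1) zh(2)] by auto
    then have "g = (u \<otimes> z) \<otimes> h" by (simp add: uk(3) zh(3) m_assoc)
    moreover have "u \<otimes> z \<in> P" using subgroup.m_closed[OF PG(1) uk(1)] zh(1) Z(2) by blast
    ultimately show ?thesis using zh(2) by blast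
  qed
  ultimately show ?thesis using that[OF H(1)] H(2) K(2) by blast
qed

end

context finite_group
begin

section \<open>Bilinear forms on groups of class two\<close>

definition centre :: "'a set" where
  "centre = {z \<in> carrier G. \<forall>g\<in>carrier G. z \<otimes> g = g \<otimes> z}"

lemma centreD: "\<lbrakk>z \<in> centre; g \<in> carrier G\<rbrakk> \<Longrightarrow> z \<otimes> g = g \<otimes> z" "z \<in> centre \<Longrightarrow> z \<in> carrier G"
  unfolding centre_def by blast+

lemma subgroup_centre: "subgroup centre G"
proof (rule subgroupI)
  show "centre \<subseteq> carrier G" unfolding centre_def by blast
  have "\<one> \<in> centre" by (simp add: centre_def)
  then show "centre \<noteq> {}" by blast
next
  fix a assume a: "a \<in> centre"
  have "inv a \<otimes> g = g \<otimes> inv a" if "g \<in> carrier G" for g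
    using commute_inv[OF centreD(2)[OF a] that centreD(1)[OF a that]] .
  then show "inv a \<in> centre" using centreD(2)[OF a] unfolding centre_def by blast
next
  fix a b assume ab: "a \<in> centre" "b \<in> centre"
  have "a \<otimes> b \<otimes> g = g \<otimes> (a \<otimes> b)" if "g \<in> carrier G" for g
    using commute_mult[OF centreD(2)[OF ab(1)] centreD(2)[OF ab(2)] that centreD(1)[OF ab(1) that] centreD(1)[OF ab(2) that]] .
  moreover have "a \<otimes> b \<in> carrier G" using centreD(2) ab by simp
  ultimately show "a \<otimes> b \<in> centre" unfolding centre_def by blast
qed

lemma class2_cmt_centre: "\<lbrakk>class2 (carrier G); a \<in> carrier G; b \<in> carrier G\<rbrakk> \<Longrightarrow> cmt a b \<in> centre"
  using class2D[of "carrier G" a b] unfolding centre_def by simp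

lemma normal_in_above_centre:
  assumes c2: "class2 (carrier G)" and N: "subgroup N G" "centre \<subseteq> N"
  shows "normal_in N (carrier G)"
proof -
  have "cj g n \<in> N" if g: "g \<in> carrier G" and n: "n \<in> N" for g n
  proof -
    have nG: "n \<in> carrier G" using subgroup.mem_carrier[OF N(1) n] .
    have "cmt g n \<in> N" using class2_cmt_centre[OF c2 g nG] N(2) by blast
    then have "cmt g n \<otimes> n \<in> N" using subgroup.m_closed[OF N(1) _ n] by blast
    then show ?thesis using g nG by (simp add: cmt_eq_cj m_assoc)
  qed
  then show ?thesis using N(1) subgroup.subset[OF N(1)] by (simp add: normal_in_def)
qed

lemma class2_mult_pow:
  assumes c2: "class2 (carrier G)" and ab: "a \<in> carrier G" "b \<in> carrier G"
  shows "\<exists>z\<in>centre. (a \<otimes> b) [^] (n :: nat) = z \<otimes> (a [^] n \<otimes> b [^] n)"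
proof (induction n)
  case 0
  show ?case using subgroup.one_closed[OF subgroup_centre] by (intro bexI[of _ \<one>]) simp_all
next
  case (Suc n)
  then obtain z where z: "z \<in> centre" "(a \<otimes> b) [^] n = z \<otimes> (a [^] n \<otimes> b [^] n)" by blast
  define k where "k = cmt (b [^] n) a"
  have k: "k \<in> centre" using class2_cmt_centre[OF c2] ab by (simp add: k_def)
  note G = centreD(2)[OF z(1)] centreD(2)[OF k]
  have bk: "b [^] n \<otimes> a = k \<otimes> (a \<otimes> b [^] n)" using ab by (simp add: k_def cmt_def word_simps)
  have "(a \<otimes> b) [^] Suc n = z \<otimes> (a [^] n \<otimes> ((b [^] n \<otimes> a) \<otimes> b))" using z(2) ab G by (simp add: m_assoc)
  also have "\<dots> = z \<otimes> ((a [^] n \<otimes> k) \<otimes> (a \<otimes> (b [^] n \<otimes> b)))" unfolding bk using ab G by (simp add: m_assoc)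
  also have "a [^] n \<otimes> k = k \<otimes> a [^] n" using centreD(1)[OF k] ab by simp
  finally have "(a \<otimes> b) [^] Suc n = (z \<otimes> k) \<otimes> (a [^] Suc n \<otimes> b [^] Suc n)" using ab G by (simp add: m_assoc)
  then show ?case using subgroup.m_closed[OF subgroup_centre z(1) k] by blast
qed

text \<open>
  An element \<open>x\<close> of \<open>N\<close> of largest order modulo the centre generates a direct factor of \<open>N\<close>
  modulo the centre.
\<close>

lemma split_cyclic_factor:
  assumes p: "prime p" and c2: "class2 (carrier G)" and pG: "\<And>g. g \<in> carrier G \<Longrightarrow> g [^] (p ^ k :: nat) = \<one>"
    and N: "subgroup N G" "centre \<subseteq> N" "N \<noteq> centre"
  obtains N' x where "subgroup N' G" "centre \<subseteq> N'" "N' \<subseteq> N" "x \<in> N" "x \<notin> centre"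
    "N' \<inter> cyc_ext centre x = centre" "\<And>y. y \<in> N \<Longrightarrow> \<exists>n\<in>N'. \<exists>c\<in>cyc_ext centre x. y = n \<otimes> c"
proof -
  note Z = subgroup_centre
  have NG: "y \<in> carrier G" if "y \<in> N" for y using subgroup.mem_carrier[OF N(1) that] .
  have ZN: "normal_in centre N"
    using normal_in_above_centre[OF c2 Z subset_refl] N(2) NG by (simp add: normal_in_def)
  have "\<forall>y\<in>N. y [^] (p ^ k :: nat) \<in> centre"
    using pG NG subgroup.one_closed[OF Z] by simp
  moreover have "\<not> (\<forall>y\<in>N. y [^] (p ^ 0 :: nat) \<in> centre)" using N(2,3) NG by auto
  ultimately obtain e where e: "\<forall>y\<in>N. y [^] (p ^ Suc e :: nat) \<in> centre" "\<not> (\<forall>y\<in>N. y [^] (p ^ e :: nat) \<in> centre)"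
    using ex_least_nat_less[of "\<lambda>e. \<forall>y\<in>N. y [^] (p ^ e :: nat) \<in> centre" k] by blast
  define m where "m = p ^ e"
  obtain x where x: "x \<in> N" "x [^] m \<notin> centre" using e(2) by (auto simp: m_def)
  note xG = NG[OF x(1)]
  have xpm: "y [^] (p * m) \<in> centre" if "y \<in> N" for y using e(1) that by (simp add: m_def)
  have xZ: "x \<notin> centre" using x(2) sub_pow_closed[OF Z] by blast
  define C where "C = cyc_ext centre x"
  have C: "subgroup C G" "C \<subseteq> N" "centre \<subseteq> C" "x \<in> C"
    unfolding C_def using cyc_ext[OF N(1) ZN x(1)] by blast+
  let ?P = "\<lambda>K. subgroup K G \<and> centre \<subseteq> K \<and> K \<subseteq> N \<and> K \<inter> C = centre"
  have P1: "?P centre" using Z N(2) C(3) by blast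
  have bound: "\<forall>K. ?P K \<longrightarrow> card K < Suc (card N)"
    using finite_sub[OF N(1)] by (simp add: card_mono less_Suc_eq_le)
  obtain N' where N': "?P N'" and max: "\<forall>K. ?P K \<longrightarrow> card K \<le> card N'"
    using Lattices_Big.ex_has_greatest_nat[of ?P, OF P1 bound] by blast
  have N's: "subgroup N' G" "centre \<subseteq> N'" "N' \<subseteq> N" "N' \<inter> C = centre" using N' by blast+
  define W where "W = N' <#> C"
  have nC: "normal_in N' (carrier G)" "normal_in C (carrier G)"
    using normal_in_above_centre[OF c2] N's C by blast+
  have W: "subgroup W G" using normal_in_mult[OF subgroup_self nC] by (simp add: W_def normal_in_def)
  have WI: "n \<otimes> c \<in> W" if "n \<in> N'" "c \<in> C" for n c using that by (auto simp: W_def set_mult_def)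
  have N'W: "n \<in> W" if "n \<in> N'" for n
    using WI[OF that subgroup.one_closed[OF C(1)]] subgroup.mem_carrier[OF N's(1) that] by simp
  have CW: "c \<in> W" if "c \<in> C" for c
    using WI[OF subgroup.one_closed[OF N's(1)] that] subgroup.mem_carrier[OF C(1) that] by simp
  have "N \<subseteq> W"
  proof (rule ccontr)
    assume "\<not> N \<subseteq> W"
    then obtain y1 where y1: "y1 \<in> N" "y1 \<notin> W" by blast
    \<comment> \<open>The last of the iterated \<open>p\<close>-th powers of \<open>y1\<close> outside \<open>W\<close> has its \<open>p\<close>-th power in \<open>W\<close>.\<close>
    have "y1 [^] (p ^ k :: nat) \<in> W" using pG[OF NG[OF y1(1)]] subgroup.one_closed[OF W] by simp
    moreover have "y1 [^] (p ^ 0 :: nat) \<notin> W" using y1 NG by simp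
    ultimately obtain j where j: "y1 [^] (p ^ Suc j :: nat) \<in> W" "y1 [^] (p ^ j :: nat) \<notin> W"
      using ex_least_nat_less[of "\<lambda>k. y1 [^] (p ^ k :: nat) \<in> W" k] by blast
    define y where "y = y1 [^] (p ^ j :: nat)"
    have y: "y \<in> N" "y \<notin> W" "y [^] p \<in> W"
      using sub_pow_closed[OF N(1) y1(1)] j NG[OF y1(1)] by (simp_all add: y_def nat_pow_pow mult.commute)
    note yG = NG[OF y(1)]
    obtain n1 c where n1: "n1 \<in> N'" "c \<in> C" "y [^] p = n1 \<otimes> c" using y(3) by (auto simp: W_def set_mult_def)
    obtain z i where zi: "z \<in> centre" "c = z \<otimes> x [^] (i :: nat)" using n1(2) unfolding C_def by (rule cyc_extE)
    define n where "n = n1 \<otimes> z"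
    have n: "n \<in> N'" using subgroup.m_closed[OF N's(1) n1(1)] zi(1) N's(2) by (auto simp: n_def)
    have nG: "n \<in> carrier G" "n1 \<in> carrier G" "z \<in> carrier G"
      using subgroup.mem_carrier[OF N's(1)] n n1(1) centreD(2)[OF zi(1)] by auto
    have yp: "y [^] p = n \<otimes> x [^] i" using n1(3) zi(2) nG xG by (simp add: n_def m_assoc)
    \<comment> \<open>By maximality of the order of \<open>x\<close>, the exponent \<open>i\<close> is divisible by \<open>p\<close>.\<close>
    have "p dvd i"
    proof (rule ccontr)
      assume "\<not> p dvd i"
      then have cop: "coprime i p" using prime_imp_coprime[OF p, of i] coprime_commute by blast
      obtain w where w: "w \<in> centre" "(n \<otimes> x [^] i) [^] m = w \<otimes> (n [^] m \<otimes> (x [^] i) [^] m)"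
        using class2_mult_pow[OF c2 nG(1), of "x [^] i" m] xG by auto
      have wG: "w \<in> carrier G" using centreD(2)[OF w(1)] .
      have "(n \<otimes> x [^] i) [^] m = y [^] (p * m)" using yG by (simp add: yp[symmetric] nat_pow_pow)
      then have cz: "w \<otimes> (n [^] m \<otimes> (x [^] i) [^] m) \<in> centre" using xpm[OF y(1)] w(2) by simp
      have wn: "inv (w \<otimes> n [^] m) \<in> N'"
        using subgroup.m_inv_closed[OF N's(1) subgroup.m_closed[OF N's(1) _ sub_pow_closed[OF N's(1) n]]] w(1) N's(2) by blast
      have "inv (w \<otimes> n [^] m) \<otimes> (w \<otimes> (n [^] m \<otimes> (x [^] i) [^] m)) = (x [^] i) [^] m"
        using wG nG xG by (simp add: word_simps)
      then have "(x [^] i) [^] m \<in> N'"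
        using subgroup.m_closed[OF N's(1) wn] cz N's(2) by (metis subsetD)
      moreover have "(x [^] i) [^] m \<in> C" by (rule sub_pow_closed[OF C(1) sub_pow_closed[OF C(1) C(4)]])
      ultimately have "(x [^] i) [^] m \<in> centre" using N's(4) by blast
      then have "(x [^] m) [^] i \<in> centre" using xG by (simp add: nat_pow_pow mult.commute)
      moreover have "(x [^] m) [^] p \<in> centre" using xpm[OF x(1)] xG by (simp add: nat_pow_pow mult.commute)
      ultimately have "x [^] m \<in> centre" using coprime_powers_in_subgroup[OF Z _ _ _ cop] xG by simp
      then show False using x(2) by blast
    qed
    then obtain i' where i': "i = p * i'" by (rule dvdE)
    define y0 where "y0 = y \<otimes> inv (x [^] i')"
    have y0G: "y0 \<in> carrier G" using yG xG by (simp add: y0_def)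
    have y0N: "y0 \<in> N"
      unfolding y0_def by (rule subgroup.m_closed[OF N(1) y(1) subgroup.m_inv_closed[OF N(1) sub_pow_closed[OF N(1) x(1)]]])
    have y0W: "y0 \<notin> W"
    proof
      assume "y0 \<in> W"
      then have "y0 \<otimes> x [^] i' \<in> W" using subgroup.m_closed[OF W _ sub_pow_closed[OF W CW[OF C(4)]]] by blast
      then show False using y(2) yG xG by (simp add: y0_def m_assoc)
    qed
    have y0p: "y0 [^] p \<in> N'"
    proof -
      obtain w where w: "w \<in> centre" "y0 [^] p = w \<otimes> (y [^] p \<otimes> inv (x [^] i') [^] p)"
        using class2_mult_pow[OF c2 yG, of "inv (x [^] i')" p] xG by (auto simp: y0_def)
      have "inv (x [^] i') [^] p = inv (x [^] i)" using xG by (simp add: nat_pow_inv nat_pow_pow i' mult.commute)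
      then have "y0 [^] p = w \<otimes> n" using w(2) yp nG xG by (simp add: m_assoc)
      then show ?thesis using subgroup.m_closed[OF N's(1) _ n] w(1) N's(2) by auto
    qed
    have nN': "normal_in N' N" using nC(1) N's(3) NG by (simp add: normal_in_def)
    define N1 where "N1 = cyc_ext N' y0"
    have N1: "subgroup N1 G" "N1 \<subseteq> N" "N' \<subseteq> N1" "y0 \<in> N1"
      unfolding N1_def using cyc_ext[OF N(1) nN' y0N] by blast+
    have "N1 \<inter> C \<subseteq> centre"
    proof
      fix v assume v: "v \<in> N1 \<inter> C"
      then obtain k j where k: "k \<in> N'" "v = k \<otimes> y0 [^] (j :: nat)" unfolding N1_def by (blast elim: cyc_extE)
      have kG: "k \<in> carrier G" using subgroup.mem_carrier[OF N's(1) k(1)] .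
      have "p dvd j"
      proof (rule ccontr)
        assume "\<not> p dvd j"
        then have cop: "coprime j p" using prime_imp_coprime[OF p, of j] coprime_commute by blast
        have "inv k \<otimes> v = y0 [^] j" using k(2) kG y0G by simp
        moreover have "inv k \<otimes> v \<in> W"
          using v subgroup.m_closed[OF W N'W[OF subgroup.m_inv_closed[OF N's(1) k(1)]] CW] by blast
        ultimately show False using coprime_powers_in_subgroup[OF W y0G _ N'W[OF y0p] cop] y0W by simp
      qed
      then obtain j' where "j = p * j'" by (rule dvdE)
      then have "y0 [^] j = (y0 [^] p) [^] j'" using y0G by (simp add: nat_pow_pow)
      then have "v \<in> N'" using k subgroup.m_closed[OF N's(1) k(1) sub_pow_closed[OF N's(1) y0p]] by simp
      then show "v \<in> centre" using v N's(4) by blast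
    qed
    then have "?P N1" using N1 N's(2) C(3) by blast
    then have "card N1 \<le> card N'" using max by blast
    then have "N' = N1" using card_seteq[OF finite_sub[OF N1(1)] N1(3)] by simp
    then show False using N1(4) y0W N'W by blast
  qed
  then have "\<exists>n\<in>N'. \<exists>c\<in>cyc_ext centre x. y = n \<otimes> c" if "y \<in> N" for y
    using that unfolding W_def C_def set_mult_def by blast
  then show ?thesis using that[OF N's(1-3) x(1) xZ] N's(4) by (simp add: C_def)
qed

text \<open>A central form on \<open>N\<close> that is also trivial on the centre, which is what the induction below needs.\<close>

definition splits_cmt :: "'a set \<Rightarrow> ('a \<Rightarrow> 'a \<Rightarrow> 'a) \<Rightarrow> bool" where
  "splits_cmt N \<beta> \<longleftrightarrow>
     (\<forall>x\<in>N. \<forall>y\<in>N. \<beta> x y \<in> centre \<and> \<beta> x y \<otimes> inv (\<beta> y x) = cmt x y) \<and>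
     (\<forall>x\<in>N. \<forall>y\<in>N. \<forall>z\<in>N. \<beta> (x \<otimes> y) z = \<beta> x z \<otimes> \<beta> y z \<and> \<beta> x (y \<otimes> z) = \<beta> x y \<otimes> \<beta> x z) \<and>
     (\<forall>x\<in>N. \<forall>z\<in>centre. \<beta> x z = \<one> \<and> \<beta> z x = \<one>)"

lemma splits_cmtD:
  assumes "splits_cmt N \<beta>"
  shows "\<lbrakk>x \<in> N; y \<in> N\<rbrakk> \<Longrightarrow> \<beta> x y \<in> centre \<and> \<beta> x y \<otimes> inv (\<beta> y x) = cmt x y"
    and "\<lbrakk>x \<in> N; y \<in> N; z \<in> N\<rbrakk> \<Longrightarrow> \<beta> (x \<otimes> y) z = \<beta> x z \<otimes> \<beta> y z \<and> \<beta> x (y \<otimes> z) = \<beta> x y \<otimes> \<beta> x z"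
    and "\<lbrakk>x \<in> N; z \<in> centre\<rbrakk> \<Longrightarrow> \<beta> x z = \<one> \<and> \<beta> z x = \<one>"
  using assms unfolding splits_cmt_def by blast+

text \<open>
  By induction there is a form \<open>\<gamma>\<close> on a complement \<open>N'\<close> of a direct factor \<open>C\<close> that is cyclic modulo the
  centre. As \<open>C\<close> is abelian, \<open>\<beta> (n c) (n' c') = \<gamma> n n' * cmt c n'\<close> has the right alternating part.
\<close>

lemma class2_form_exists:
  assumes p: "prime p" and c2: "class2 (carrier G)" and pG: "\<And>g. g \<in> carrier G \<Longrightarrow> g [^] (p ^ k :: nat) = \<one>"
    and N: "subgroup N G" "centre \<subseteq> N"
  shows "\<exists>\<beta>. splits_cmt N \<beta>"
  using N
proof (induction "card N" arbitrary: N rule: less_induct)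
  case less
  note N = less.prems
  note Z = subgroup_centre
  have NG: "y \<in> carrier G" if "y \<in> N" for y using subgroup.mem_carrier[OF N(1) that] .
  note ZG = centreD(2)
  show ?case
  proof (cases "N = centre")
    case True
    have "cmt x y = \<one>" if "x \<in> centre" "y \<in> centre" for x y
      using cmt_eq_one_iff[OF ZG[OF that(1)] ZG[OF that(2)]] centreD(1)[OF that(1) ZG[OF that(2)]] by simp
    then show ?thesis
      using True subgroup.one_closed[OF Z] unfolding splits_cmt_def by (intro exI[of _ "\<lambda>x y. \<one>"]) simp
  next
    case False
    obtain N' x where N': "subgroup N' G" "centre \<subseteq> N'" "N' \<subseteq> N" and x: "x \<in> N" "x \<notin> centre"
      and C0: "N' \<inter> cyc_ext centre x = centre" "\<And>y. y \<in> N \<Longrightarrow> \<exists>n\<in>N'. \<exists>c\<in>cyc_ext centre x. y = n \<otimes> c"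
      by (rule split_cyclic_factor[OF p c2 pG N False]) blast+
    define C where "C = cyc_ext centre x"
    have ZN: "normal_in centre N"
      using normal_in_above_centre[OF c2 Z subset_refl] N(2) NG by (simp add: normal_in_def)
    have C: "subgroup C G" "C \<subseteq> N" "centre \<subseteq> C" "x \<in> C"
      unfolding C_def using cyc_ext[OF N(1) ZN x(1)] by blast+
    have N'C: "N' \<inter> C = centre" using C0(1) by (simp add: C_def)
    have N'G: "n \<in> carrier G" if "n \<in> N'" for n using subgroup.mem_carrier[OF N'(1) that] .
    have CG: "n \<in> carrier G" if "n \<in> C" for n using subgroup.mem_carrier[OF C(1) that] .
    have "N' \<subset> N" using N'(3) x C(4) N'C by blast
    then have "card N' < card N" using finite_sub[OF N(1)] by (simp add: psubset_card_mono)
    then obtain \<gamma> where \<gamma>: "splits_cmt N' \<gamma>" using less.hyps[OF _ N'(1,2)] by blast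
    note g_cmt = splits_cmtD(1)[OF \<gamma>] and g_bil = splits_cmtD(2)[OF \<gamma>] and g_cen = splits_cmtD(3)[OF \<gamma>]
    have split: "\<exists>n c. n \<in> N' \<and> c \<in> C \<and> y = n \<otimes> c" if "y \<in> N" for y
      using C0(2)[OF that] by (auto simp: C_def)
    define nn where "nn y = (SOME n. n \<in> N' \<and> (\<exists>c\<in>C. y = n \<otimes> c))" for y
    define cc where "cc y = inv (nn y) \<otimes> y" for y
    have nn: "nn y \<in> N'" "cc y \<in> C" "y = nn y \<otimes> cc y" if y: "y \<in> N" for y
    proof -
      have "\<exists>n. n \<in> N' \<and> (\<exists>c\<in>C. y = n \<otimes> c)" using split[OF y] by blast
      from someI_ex[OF this] have a: "nn y \<in> N'" "\<exists>c\<in>C. y = nn y \<otimes> c" by (simp_all add: nn_def)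
      then obtain c where c: "c \<in> C" "y = nn y \<otimes> c" by blast
      have "cc y = inv (nn y) \<otimes> (nn y \<otimes> c)" using c(2) by (simp add: cc_def)
      then have "cc y = c" using N'G[OF a(1)] CG[OF c(1)] by simp
      then show "nn y \<in> N'" "cc y \<in> C" "y = nn y \<otimes> cc y" using a c by simp_all
    qed
    have cen: "cmt a b \<in> centre" if "a \<in> carrier G" "b \<in> carrier G" for a b
      using class2_cmt_centre[OF c2 that] .
    have cmt_l: "cmt (a \<otimes> b) c = cmt a c \<otimes> cmt b c" and cmt_r: "cmt a (b \<otimes> c) = cmt a b \<otimes> cmt a c"
      if "a \<in> carrier G" "b \<in> carrier G" "c \<in> carrier G" for a b c
      using class2_cmt_left[OF subgroup_self c2 that] class2_cmt_right[OF subgroup_self c2 that] .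
    have cmt_z: "cmt z a = \<one>" "cmt a z = \<one>" if "z \<in> centre" "a \<in> carrier G" for z a
      using cmt_eq_one_iff ZG[OF that(1)] centreD(1)[OF that] that(2) by simp_all
    have C_abelian: "cmt a b = \<one>" if ab: "a \<in> C" "b \<in> C" for a b
    proof -
      obtain z i where a: "z \<in> centre" "a = z \<otimes> x [^] (i :: nat)" using ab(1) unfolding C_def by (rule cyc_extE)
      obtain w j where b: "w \<in> centre" "b = w \<otimes> x [^] (j :: nat)" using ab(2) unfolding C_def by (rule cyc_extE)
      have xG: "x \<in> carrier G" using NG[OF x(1)] .
      have "cmt (x [^] i) (x [^] j) = \<one>"
        using xG by (simp add: cmt_eq_one_iff nat_pow_mult add.commute)
      then show ?thesis using a b xG ZG cmt_z by (simp add: cmt_l cmt_r)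
    qed
    define \<beta> where "\<beta> y y' = \<gamma> (nn y) (nn y') \<otimes> cmt (cc y) (nn y')" for y y'
    \<comment> \<open>The value does not depend on the chosen factorisations.\<close>
    have \<beta>_eq: "\<beta> (n \<otimes> c) (n' \<otimes> c') = \<gamma> n n' \<otimes> cmt c n'"
      if h: "n \<in> N'" "c \<in> C" "n' \<in> N'" "c' \<in> C" for n c n' c'
    proof -
      have rep: "\<exists>z\<in>centre. nn (n \<otimes> c) = n \<otimes> z \<and> c = z \<otimes> cc (n \<otimes> c)" if h: "n \<in> N'" "c \<in> C" for n c
      proof -
        have "n \<otimes> c \<in> N" using subgroup.m_closed[OF N(1)] h N'(3) C(2) by blast
        from nn[OF this] have a: "nn (n \<otimes> c) \<in> N'" "cc (n \<otimes> c) \<in> C" "n \<otimes> c = nn (n \<otimes> c) \<otimes> cc (n \<otimes> c)" .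
        define z where "z = inv n \<otimes> nn (n \<otimes> c)"
        note G = N'G[OF h(1)] CG[OF h(2)] N'G[OF a(1)] CG[OF a(2)]
        have zN: "z \<in> N'" using subgroup.m_closed[OF N'(1) subgroup.m_inv_closed[OF N'(1) h(1)] a(1)] by (simp add: z_def)
        have "inv n \<otimes> (n \<otimes> c) = inv n \<otimes> (nn (n \<otimes> c) \<otimes> cc (n \<otimes> c))" using a(3) by simp
        then have c: "c = z \<otimes> cc (n \<otimes> c)" using G by (simp add: z_def m_assoc)
        then have "c \<otimes> inv (cc (n \<otimes> c)) = z \<otimes> cc (n \<otimes> c) \<otimes> inv (cc (n \<otimes> c))" by simp
        then have "z = c \<otimes> inv (cc (n \<otimes> c))" using G N'G[OF zN] by (simp add: m_assoc)
        then have "z \<in> C" using subgroup.m_closed[OF C(1) h(2) subgroup.m_inv_closed[OF C(1) a(2)]] by simp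
        then have "z \<in> centre" using zN N'C by blast
        moreover have "nn (n \<otimes> c) = n \<otimes> z" using G by (simp add: z_def)
        ultimately show ?thesis using c by blast
      qed
      obtain z where z: "z \<in> centre" "nn (n \<otimes> c) = n \<otimes> z" "c = z \<otimes> cc (n \<otimes> c)" using rep[OF h(1,2)] by blast
      obtain z' where z': "z' \<in> centre" "nn (n' \<otimes> c') = n' \<otimes> z'" using rep[OF h(3,4)] by blast
      have "n \<otimes> c \<in> N" using subgroup.m_closed[OF N(1)] h N'(3) C(2) by blast
      then have ccG: "cc (n \<otimes> c) \<in> carrier G" using nn(2) CG by blast
      have zz: "z \<in> N'" "z' \<in> N'" using z(1) z'(1) N'(2) by blast+
      have "\<gamma> (n \<otimes> z) (n' \<otimes> z') = \<gamma> n n'"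
        using g_bil[OF h(1) zz(1) subgroup.m_closed[OF N'(1) h(3) zz(2)]] g_bil[OF h(1,3) zz(2)]
          g_cen[OF h(1) z'(1)] g_cen[OF subgroup.m_closed[OF N'(1) h(3) zz(2)] z(1)] ZG g_cmt[OF h(1,3)] by simp
      moreover have "cmt (cc (n \<otimes> c)) (n' \<otimes> z') = cmt c n'"
      proof -
        have "cmt c n' = cmt (z \<otimes> cc (n \<otimes> c)) n'" using z(3) by simp
        also have "\<dots> = cmt (cc (n \<otimes> c)) n'"
          using cmt_l[OF ZG[OF z(1)] ccG N'G[OF h(3)]] cmt_z(1)[OF z(1) N'G[OF h(3)]] ccG N'G[OF h(3)] by simp
        finally show ?thesis
          using cmt_r[OF ccG N'G[OF h(3)] ZG[OF z'(1)]] cmt_z(2)[OF z'(1) ccG] ccG N'G[OF h(3)] by simp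
      qed
      ultimately show ?thesis by (simp add: \<beta>_def z(2) z'(2))
    qed
    interpret Zg: comm_group "G\<lparr>carrier := centre\<rparr>"
      by (rule group.group_comm_groupI[OF subgroup_imp_group[OF Z]])
        (simp, metis centreD partial_object.select_convs(1) partial_object.update_convs(1))
    note zac = Zg.m_ac[simplified]
    have zinv: "inv z \<in> centre" if "z \<in> centre" for z using subgroup.m_inv_closed[OF Z that] .
    have zmult: "z \<otimes> w \<in> centre" if "z \<in> centre" "w \<in> centre" for z w using subgroup.m_closed[OF Z that] .
    have prod: "\<exists>k\<in>centre. (n \<otimes> c) \<otimes> (n' \<otimes> c') = (n \<otimes> n' \<otimes> k) \<otimes> (c \<otimes> c')"
      if h: "n \<in> N'" "c \<in> C" "n' \<in> N'" "c' \<in> C" for n c n' c'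
    proof -
      note G = N'G[OF h(1)] CG[OF h(2)] N'G[OF h(3)] CG[OF h(4)]
      have k: "cmt (inv n') c \<in> centre" using cen G by simp
      have "(n \<otimes> c) \<otimes> (n' \<otimes> c') = (n \<otimes> n' \<otimes> cmt (inv n') c) \<otimes> (c \<otimes> c')"
        using G by (simp add: cmt_def word_simps)
      then show ?thesis using k by blast
    qed
    have fac: "\<exists>n\<in>N'. \<exists>c\<in>C. y = n \<otimes> c" if "y \<in> N" for y using split[OF that] by blast
    show ?thesis
      unfolding splits_cmt_def
    proof (intro exI[of _ \<beta>] conjI ballI)
      fix a b assume ab: "a \<in> N" "b \<in> N"
      obtain n c where h1: "n \<in> N'" "c \<in> C" "a = n \<otimes> c" using fac[OF ab(1)] by blast
      obtain n' c' where h2: "n' \<in> N'" "c' \<in> C" "b = n' \<otimes> c'" using fac[OF ab(2)] by blast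
      note h = h1(1,2) h2(1,2) h1(3) h2(3)
      note G = N'G[OF h(1)] CG[OF h(2)] N'G[OF h(3)] CG[OF h(4)]
      have Zs: "\<gamma> n n' \<in> centre" "\<gamma> n' n \<in> centre" "cmt c n' \<in> centre" "cmt c' n \<in> centre" "cmt n c' \<in> centre"
        using g_cmt h(1,3) cen G by simp_all
      have e: "\<beta> a b = \<gamma> n n' \<otimes> cmt c n'" "\<beta> b a = \<gamma> n' n \<otimes> cmt c' n" using \<beta>_eq h by simp_all
      then show "\<beta> a b \<in> centre" using zmult Zs by simp
      have "\<beta> a b \<otimes> inv (\<beta> b a) = (\<gamma> n n' \<otimes> inv (\<gamma> n' n)) \<otimes> (cmt c n' \<otimes> cmt n c')"
        unfolding e using Zs zinv zmult ZG G by (simp add: inv_mult_group inv_cmt zac)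
      also have "\<dots> = cmt n n' \<otimes> (cmt c n' \<otimes> cmt n c')" using g_cmt[OF h(1,3)] by simp
      also have "\<dots> = cmt a b"
        using G C_abelian[OF h(2,4)] by (simp add: h(5,6) cmt_l cmt_r m_assoc)
      finally show "\<beta> a b \<otimes> inv (\<beta> b a) = cmt a b" .
    next
      fix a b d assume abd: "a \<in> N" "b \<in> N" "d \<in> N"
      obtain n c where h1: "n \<in> N'" "c \<in> C" "a = n \<otimes> c" using fac[OF abd(1)] by blast
      obtain n' c' where h2: "n' \<in> N'" "c' \<in> C" "b = n' \<otimes> c'" using fac[OF abd(2)] by blast
      obtain n'' c'' where h3: "n'' \<in> N'" "c'' \<in> C" "d = n'' \<otimes> c''" using fac[OF abd(3)] by blast
      note h = h1(1,2) h2(1,2) h3(1,2) h1(3) h2(3) h3(3)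
      note G = N'G[OF h(1)] CG[OF h(2)] N'G[OF h(3)] CG[OF h(4)] N'G[OF h(5)] CG[OF h(6)]
      have Zs: "\<gamma> u v \<in> centre" if "u \<in> N'" "v \<in> N'" for u v using g_cmt[OF that] by simp
      have mN: "u \<otimes> v \<in> N'" if "u \<in> N'" "v \<in> N'" for u v using subgroup.m_closed[OF N'(1) that] .
      have mC: "u \<otimes> v \<in> C" if "u \<in> C" "v \<in> C" for u v using subgroup.m_closed[OF C(1) that] .
      obtain k where k: "k \<in> centre" "a \<otimes> b = (n \<otimes> n' \<otimes> k) \<otimes> (c \<otimes> c')" using prod[OF h(1-4)] h(7,8) by auto
      obtain l where l: "l \<in> centre" "b \<otimes> d = (n' \<otimes> n'' \<otimes> l) \<otimes> (c' \<otimes> c'')" using prod[OF h(3-6)] h(8,9) by auto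
      have kl: "k \<in> N'" "l \<in> N'" using k(1) l(1) N'(2) by blast+
      have "\<beta> (a \<otimes> b) d = \<gamma> (n \<otimes> n' \<otimes> k) n'' \<otimes> cmt (c \<otimes> c') n''"
        unfolding k(2) h(9) by (rule \<beta>_eq) (use h mN mC kl in simp_all)
      also have "\<dots> = (\<gamma> n n'' \<otimes> \<gamma> n' n'') \<otimes> (cmt c n'' \<otimes> cmt c' n'')"
        using h mN kl g_bil[of "n \<otimes> n'" k n''] g_bil[of n n' n''] g_cen[OF h(5) k(1)] Zs ZG G
        by (simp add: cmt_l)
      also have "\<dots> = \<beta> a d \<otimes> \<beta> b d"
        using h Zs[OF h(1,5)] Zs[OF h(3,5)] cen[OF G(2,5)] cen[OF G(4,5)] zmult by (simp add: \<beta>_eq zac)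
      finally show "\<beta> (a \<otimes> b) d = \<beta> a d \<otimes> \<beta> b d" .
      have "\<beta> a (b \<otimes> d) = \<gamma> n (n' \<otimes> n'' \<otimes> l) \<otimes> cmt c (n' \<otimes> n'' \<otimes> l)"
        unfolding l(2) h(7) by (rule \<beta>_eq) (use h mN mC kl in simp_all)
      also have "\<dots> = (\<gamma> n n' \<otimes> \<gamma> n n'') \<otimes> (cmt c n' \<otimes> cmt c n'')"
        using h mN kl g_bil[of n "n' \<otimes> n''" l] g_bil[of n n' n''] g_cen[OF h(1) l(1)] Zs ZG G cmt_z(2)[OF l(1) G(2)]
        by (simp add: cmt_r N'G[OF kl(2)])
      also have "\<dots> = \<beta> a b \<otimes> \<beta> a d"
        using h Zs[OF h(1,3)] Zs[OF h(1,5)] cen[OF G(2,3)] cen[OF G(2,5)] zmult by (simp add: \<beta>_eq zac)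
      finally show "\<beta> a (b \<otimes> d) = \<beta> a b \<otimes> \<beta> a d" .
    next
      fix a z assume a: "a \<in> N" and z: "z \<in> centre"
      obtain n c where h: "n \<in> N'" "c \<in> C" "a = n \<otimes> c" using fac[OF a] by blast
      note G = N'G[OF h(1)] CG[OF h(2)]
      have z1: "z = z \<otimes> \<one>" "z \<in> N'" "\<one> \<in> C" using z ZG N'(2) subgroup.one_closed[OF C(1)] by auto
      have "\<beta> a (z \<otimes> \<one>) = \<gamma> n z \<otimes> cmt c z" unfolding h(3) by (rule \<beta>_eq[OF h(1,2) z1(2,3)])
      then show "\<beta> a z = \<one>" using g_cen[OF h(1) z] cmt_z(2)[OF z G(2)] ZG[OF z] by simp
      have "\<beta> (z \<otimes> \<one>) a = \<gamma> z n \<otimes> cmt \<one> n" unfolding h(3) by (rule \<beta>_eq[OF z1(2,3) h(1,2)])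
      then show "\<beta> z a = \<one>" using g_cen[OF h(1) z] cmt_z(1)[OF subgroup.one_closed[OF Z] G(1)] ZG[OF z] by simp
    qed
  qed
qed

theorem class2_p_group_cocycle:
  assumes p: "prime p" and c2: "class2 (carrier G)" and card: "card (carrier G) = p ^ k"
  shows "has_surj_cocycle G (card (carrier G))"
proof -
  have pG: "g [^] (p ^ k :: nat) = \<one>" if "g \<in> carrier G" for g
    using sub_pow_card[OF subgroup_self that] card by simp
  obtain \<beta> where \<beta>: "splits_cmt (carrier G) \<beta>"
    using class2_form_exists[OF p c2 pG subgroup_self subgroup.subset[OF subgroup_centre]] by blast
  note b = splits_cmtD[OF \<beta>]
  interpret central_form G "carrier G" \<beta>
  proof (intro central_form.intro central_form_axioms.intro)
    show "group G" "subgroup (carrier G) G" by (rule is_group, rule subgroup_self)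
    fix x y assume xy: "x \<in> carrier G" "y \<in> carrier G"
    note bz = conjunct1[OF b(1)[OF xy]]
    show "\<beta> x y \<in> carrier G" using centreD(2)[OF bz] .
    show "\<beta> x y \<otimes> inv (\<beta> y x) = cmt x y" using b(1)[OF xy] by blast
    fix z assume z: "z \<in> carrier G"
    show "\<beta> x y \<otimes> z = z \<otimes> \<beta> x y" using centreD(1)[OF bz z] .
    show "\<beta> (x \<otimes> y) z = \<beta> x z \<otimes> \<beta> y z" "\<beta> x (y \<otimes> z) = \<beta> x y \<otimes> \<beta> x z" using b(2)[OF xy z] by blast+
    show "\<beta> (\<beta> x y) z = \<one>" "\<beta> z (\<beta> x y) = \<one>" using b(3)[OF z bz] by blast+
  qed
  show ?thesis
  proof (rule has_surj_cocycle_of_complement[OF fin triv_subgroup])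
    show "carrier G \<inter> {\<one>} = {\<one>}" by auto
    show "\<exists>s\<in>carrier G. \<exists>h\<in>{\<one>}. g = s \<otimes> h" if "g \<in> carrier G" for g using that by auto
    show "cj g s \<in> carrier G" if "g \<in> carrier G" "s \<in> carrier G" for g s using that by simp
    show "\<beta> (cj g x) (cj g y) = cj g (\<beta> x y)" if g: "g \<in> carrier G" "x \<in> carrier G" "y \<in> carrier G" for g x y
    proof -
      have cz: "cj g u = cmt g u \<otimes> u" if "u \<in> carrier G" for u using g(1) that by (simp add: cmt_eq_cj m_assoc)
      have z: "cmt g x \<in> centre" "cmt g y \<in> centre" using class2_cmt_centre[OF c2] g by simp_all
      have "\<beta> (cj g x) (cj g y) = \<beta> x y" using b g z centreD(2) cz by simp
      moreover have "cj g (\<beta> x y) = \<beta> x y"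
      proof -
        note bz = conjunct1[OF b(1)[OF g(2,3)]]
        have "cj g (\<beta> x y) = \<beta> x y \<otimes> g \<otimes> inv g" unfolding cj_def centreD(1)[OF bz g(1)] ..
        then show ?thesis using g(1) centreD(2)[OF bz] by (simp add: m_assoc)
      qed
      ultimately show ?thesis by simp
    qed
  qed
qed

end

section \<open>Cocycles from quotients\<close>

context finite_group
begin

lemma normal_in_imp_normal: "normal_in K (carrier G) \<Longrightarrow> K \<lhd> G"
  unfolding normal_inv_iff normal_in_def cj_def by blast

lemma finite_group_Mod: "K \<lhd> G \<Longrightarrow> finite_group (G Mod K)"
  by (intro finite_group.intro finite_group_axioms.intro normal.factorgroup_is_group)
    (simp_all add: carrier_FactGroup fin)

lemma quotient_hom: "K \<lhd> G \<Longrightarrow> group_hom G (G Mod K) (\<lambda>x. K #> x)"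
  by (intro group_hom.intro group_hom_axioms.intro is_group normal.factorgroup_is_group normal.r_coset_hom_Mod)

lemma quotient_one_iff: "\<lbrakk>K \<lhd> G; x \<in> carrier G\<rbrakk> \<Longrightarrow> K #> x = \<one>\<^bsub>G Mod K\<^esub> \<longleftrightarrow> x \<in> K"
  using coset_join1[of K x] coset_join2[of x K] normal_imp_subgroup[of K G] subgroup.subset[of K G] by auto

text \<open>The projection is injective on \<open>P\<close>, which meets \<open>K\<close> trivially.\<close>

lemma quotient_sylow:
  assumes p: "prime p" and K: "K \<lhd> G" "\<not> p dvd card K" and P: "sylow_in p (carrier G) P" "class2 P"
  shows "finite_group.sylow_in (G Mod K) p (carrier (G Mod K)) ((\<lambda>x. K #> x) ` P)"
    and "group.class2 (G Mod K) ((\<lambda>x. K #> x) ` P)"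
    and "card ((\<lambda>x. K #> x) ` P) = card P"
proof -
  let ?h = "\<lambda>x. K #> x"
  interpret B: finite_group "G Mod K" using K(1) by (rule finite_group_Mod)
  interpret h: group_hom G "G Mod K" ?h using K(1) by (rule quotient_hom)
  have PG: "subgroup P G" "card P = p ^ multiplicity p (card (carrier G))" using P(1) by (auto simp: sylow_in_def)
  have Pc: "x \<in> carrier G" if "x \<in> P" for x using subgroup.mem_carrier[OF PG(1) that] .
  have KG: "subgroup K G" using K(1) by (rule normal_imp_subgroup)
  have "inj_on ?h P"
  proof (rule inj_onI)
    fix x y assume xy: "x \<in> P" "y \<in> P" and eq: "K #> x = K #> y"
    have "?h (x \<otimes> inv y) = ?h x \<otimes>\<^bsub>G Mod K\<^esub> inv\<^bsub>G Mod K\<^esub> ?h y" using Pc[OF xy(1)] Pc[OF xy(2)] by (simp only: h.hom_inv h.hom_mult inv_closed)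
    also have "\<dots> = \<one>\<^bsub>G Mod K\<^esub>" unfolding eq using h.hom_closed[OF Pc[OF xy(2)]] by (rule B.r_inv)
    finally have e: "?h (x \<otimes> inv y) = \<one>\<^bsub>G Mod K\<^esub>" .
    have k: "x \<otimes> inv y \<in> K"
      by (rule iffD1[OF quotient_one_iff[OF K(1)] e]) (use Pc[OF xy(1)] Pc[OF xy(2)] in simp)
    have "x \<otimes> inv y \<in> P" using subgroup.m_closed[OF PG(1) xy(1) subgroup.m_inv_closed[OF PG(1) xy(2)]] .
    then have "x \<otimes> inv y = \<one>"
      using not_dvd_card_iff[OF p KG] K(2) k sylow_elements[OF P(1)] by blast
    then have "x \<otimes> inv y \<otimes> y = y" using Pc[OF xy(2)] by simp
    then show "x = y" using Pc[OF xy(1)] Pc[OF xy(2)] by (simp add: m_assoc)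
  qed
  then show card: "card (?h ` P) = card P" by (rule card_image)
  have sub: "subgroup (?h ` P) (G Mod K)" by (rule h.subgroup_img_is_subgroup[OF PG(1)])
  have "card (carrier (G Mod K)) * card K = card (carrier G)"
    using lagrange[OF KG] by (simp add: FactGroup_def order_def)
  moreover have "multiplicity p (card K) = 0" using K(2) by (rule not_dvd_imp_multiplicity_0)
  moreover have "card (carrier (G Mod K)) > 0" using B.card_sub_pos[OF B.subgroup_self] .
  ultimately have "multiplicity p (card (carrier G)) = multiplicity p (card (carrier (G Mod K)))"
    using prime_elem_multiplicity_mult_distrib[of p "card (carrier (G Mod K))" "card K"] p card_sub_pos[OF KG] by simp
  then show "B.sylow_in p (carrier (G Mod K)) (?h ` P)"
    using sub card PG(2) B.subgroup_self subgroup.subset[OF sub] by (simp add: B.sylow_in_def)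
  show "B.class2 (?h ` P)"
    unfolding B.class2_def
  proof (intro ballI)
    fix a b c assume "a \<in> ?h ` P" "b \<in> ?h ` P" "c \<in> ?h ` P"
    then obtain x y z where xyz: "x \<in> P" "y \<in> P" "z \<in> P" "a = ?h x" "b = ?h y" "c = ?h z" by blast
    have G: "x \<in> carrier G" "y \<in> carrier G" "z \<in> carrier G" using xyz Pc by auto
    have cm: "B.cmt a b = ?h (cmt x y)"
      unfolding xyz B.cmt_def cmt_def using G by (simp only: h.hom_mult h.hom_inv m_closed inv_closed)
    have "?h (cmt x y \<otimes> z) = ?h (z \<otimes> cmt x y)" using class2D[OF P(2) xyz(1-3)] by simp
    then show "B.cmt a b \<otimes>\<^bsub>G Mod K\<^esub> c = c \<otimes>\<^bsub>G Mod K\<^esub> B.cmt a b"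
      unfolding cm xyz(6) using G by (simp only: h.hom_mult cmt_closed)
  qed
qed

lemma odd_prime_cocycle_of_trivial_core:
  assumes sol: "solvable G" and p: "prime p" "odd p"
    and O: "subgroup O' G" "odd (card O')" "\<And>g y. \<lbrakk>g \<in> carrier G; y \<in> O'\<rbrakk> \<Longrightarrow> cj g y \<in> O'"
    and quot: "\<And>g. g \<in> carrier G \<Longrightarrow> \<exists>k :: nat. g [^] (2 ^ k :: nat) \<in> O'"
    and P: "sylow_in p (carrier G) P" "class2 P"
    and core: "\<And>K. normal_in K (carrier G) \<Longrightarrow> \<not> p dvd card K \<Longrightarrow> K = {\<one>}"
  shows "has_surj_cocycle G (card P)"
proof -
  have PG: "subgroup P G" "card P = p ^ multiplicity p (card (carrier G))" using P(1) by (auto simp: sylow_in_def)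
  have Pc: "x \<in> carrier G" if "x \<in> P" for x using subgroup.mem_carrier[OF PG(1) that] .
  have nP: "normal_in P (carrier G)" by (rule sylow_normal_in[OF sol p O quot subgroup_self P core])
  obtain H where H: "subgroup H G" "H \<subseteq> carrier G" "H \<inter> P = {\<one>}" "\<And>g. g \<in> carrier G \<Longrightarrow> \<exists>u\<in>P. \<exists>h\<in>H. g = u \<otimes> h"
    by (rule class2_complement[OF p(1) subgroup_self nP P]) blast
  have "odd (card P)" using PG(2) p(2) by simp
  then interpret \<beta>: central_form G P "\<lambda>x y. cmt x y [^] ((card P + 1) div 2)"
    by (rule odd_class2_form[OF PG(1) P(2)])
  show ?thesis
  proof (rule \<beta>.has_surj_cocycle_of_complement[OF fin H(1)])
    show "P \<inter> H = {\<one>}" using H(3) by blast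
    show "cj g s \<in> P" if "g \<in> carrier G" "s \<in> P" for g s using nP that by (simp add: normal_in_def)
    show "cmt (cj g x) (cj g y) [^] ((card P + 1) div 2) = cj g (cmt x y [^] ((card P + 1) div 2))"
      if "g \<in> carrier G" "x \<in> P" "y \<in> P" for g x y
      using that Pc by (simp add: cj_cmt cj_pow)
  qed (rule H(4))
qed

text \<open>
  Divide by the largest normal subgroup \<open>K\<close> of order prime to \<open>p\<close>. A nontrivial subgroup of this
  kind in the quotient would have a preimage of the same kind that is larger than \<open>K\<close>.
\<close>

theorem odd_prime_cocycle:
  assumes sol: "solvable G" and p: "prime p" "odd p"
    and O: "subgroup O' G" "odd (card O')" "\<And>g y. \<lbrakk>g \<in> carrier G; y \<in> O'\<rbrakk> \<Longrightarrow> cj g y \<in> O'"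
    and quot: "\<And>g. g \<in> carrier G \<Longrightarrow> \<exists>k :: nat. g [^] (2 ^ k :: nat) \<in> O'"
    and P: "sylow_in p (carrier G) P" "class2 P"
  shows "has_surj_cocycle G (card P)"
proof -
  obtain K where K: "normal_in K (carrier G)" "\<not> p dvd card K"
    and max: "\<And>L. normal_in L (carrier G) \<Longrightarrow> \<not> p dvd card L \<Longrightarrow> L \<subseteq> K"
    by (rule p'_core_exists[OF p(1) subgroup_self]) blast
  note KG = normal_in_imp_normal[OF K(1)]
  let ?h = "\<lambda>x. K #> x"
  interpret B: finite_group "G Mod K" using KG by (rule finite_group_Mod)
  interpret h: group_hom G "G Mod K" ?h using KG by (rule quotient_hom)
  have surj: "?h ` carrier G = carrier (G Mod K)" by (simp add: carrier_FactGroup)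
  have lift: "\<exists>x\<in>carrier G. C = ?h x" if "C \<in> carrier (G Mod K)" for C using that surj by blast
  have h_pow: "?h (x [^] (n :: nat)) = ?h x [^]\<^bsub>G Mod K\<^esub> n" if "x \<in> carrier G" for x n
    using h.hom_nat_pow[OF that] .
  have h_cj: "B.cj (?h g) (?h x) = ?h (cj g x)" if "g \<in> carrier G" "x \<in> carrier G" for g x
    unfolding B.cj_def cj_def using that by (simp only: h.hom_mult h.hom_inv m_closed inv_closed)
  have Oc: "x \<in> carrier G" if "x \<in> O'" for x using subgroup.mem_carrier[OF O(1) that] .
  note syl = quotient_sylow[OF p(1) KG K(2) P]
  have "has_surj_cocycle (G Mod K) (card (?h ` P))"
  proof (rule B.odd_prime_cocycle_of_trivial_core[OF _ p, of "?h ` O'"])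
    show "solvable (G Mod K)" by (rule h.surj_hom_imp_solvable[OF surj sol])
    show sO: "subgroup (?h ` O') (G Mod K)" by (rule h.subgroup_img_is_subgroup[OF O(1)])
    have "C = \<one>\<^bsub>G Mod K\<^esub>" if C: "C \<in> ?h ` O'" "B.p_element 2 C" for C
    proof -
      obtain x where x: "x \<in> O'" "C = ?h x" using C(1) by blast
      obtain k where k: "C [^]\<^bsub>G Mod K\<^esub> ((2::nat) ^ k) = \<one>\<^bsub>G Mod K\<^esub>" using C(2) by (auto simp: B.p_element_def)
      have "C [^]\<^bsub>G Mod K\<^esub> card O' = ?h (x [^] card O')" using h_pow[OF Oc[OF x(1)]] x(2) by simp
      also have "\<dots> = \<one>\<^bsub>G Mod K\<^esub>" unfolding sub_pow_card[OF O(1) x(1)] by (rule h.hom_one)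
      finally have "C [^]\<^bsub>G Mod K\<^esub> card O' = \<one>\<^bsub>G Mod K\<^esub>" .
      then show ?thesis
        using B.coprime_pow_eq_one[OF _ k] O(2) subgroup.mem_carrier[OF sO C(1)] by simp
    qed
    then show "odd (card (?h ` O'))" using B.not_dvd_card_iff[OF two_is_prime_nat sO] by blast
    show "B.cj C D \<in> ?h ` O'" if CD: "C \<in> carrier (G Mod K)" "D \<in> ?h ` O'" for C D
    proof -
      obtain g where g: "g \<in> carrier G" "C = ?h g" using lift[OF CD(1)] by blast
      obtain y where y: "y \<in> O'" "D = ?h y" using CD(2) by blast
      show ?thesis using h_cj[OF g(1) Oc[OF y(1)]] O(3)[OF g(1) y(1)] g(2) y(2) by simp
    qed
    show "\<exists>k :: nat. C [^]\<^bsub>G Mod K\<^esub> (2 ^ k :: nat) \<in> ?h ` O'" if C: "C \<in> carrier (G Mod K)" for C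
    proof -
      obtain g where g: "g \<in> carrier G" "C = ?h g" using lift[OF C] by blast
      obtain k :: nat where "g [^] (2 ^ k :: nat) \<in> O'" using quot[OF g(1)] by blast
      then have "?h (g [^] (2 ^ k :: nat)) \<in> ?h ` O'" by (rule imageI)
      then have "C [^]\<^bsub>G Mod K\<^esub> (2 ^ k :: nat) \<in> ?h ` O'" unfolding h_pow[OF g(1)] g(2) .
      then show ?thesis by blast
    qed
    show "B.sylow_in p (carrier (G Mod K)) (?h ` P)" "B.class2 (?h ` P)" by (rule syl)+
    show "L = {\<one>\<^bsub>G Mod K\<^esub>}" if L: "B.normal_in L (carrier (G Mod K))" "\<not> p dvd card L" for L
    proof -
      have LG: "subgroup L (G Mod K)" using L(1) by (simp add: B.normal_in_def)
      define L' where "L' = {x \<in> carrier G. ?h x \<in> L}"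
      have "normal_in L' (carrier G)"
        unfolding normal_in_def
      proof (intro conjI ballI)
        show "subgroup L' G"
        proof (rule subgroupI)
          show "L' \<subseteq> carrier G" unfolding L'_def by blast
          have "\<one> \<in> L'" using subgroup.one_closed[OF LG] h.hom_one unfolding L'_def by simp
          then show "L' \<noteq> {}" by blast
          show "inv a \<in> L'" if "a \<in> L'" for a
            using that subgroup.m_inv_closed[OF LG] h.hom_inv unfolding L'_def by auto
          show "a \<otimes> b \<in> L'" if "a \<in> L'" "b \<in> L'" for a b
            using that subgroup.m_closed[OF LG] h.hom_mult[of a b] unfolding L'_def by auto
        qed
        show "L' \<subseteq> carrier G" unfolding L'_def by blast
        show "cj g x \<in> L'" if "g \<in> carrier G" "x \<in> L'" for g x
        proof -
          have x: "x \<in> carrier G" "?h x \<in> L" using that(2) unfolding L'_def by blast+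
          have "B.cj (?h g) (?h x) \<in> L" using L(1) h.hom_closed[OF that(1)] x(2) unfolding B.normal_in_def by blast
          then show ?thesis using h_cj[OF that(1) x(1)] that(1) x(1) unfolding L'_def by simp
        qed
      qed
      moreover have "\<not> p dvd card L'"
      proof -
        have "x = \<one>" if x: "x \<in> L'" "p_element p x" for x
        proof -
          have xG: "x \<in> carrier G" "?h x \<in> L" using x(1) unfolding L'_def by blast+
          obtain k where "x [^] (p ^ k) = \<one>" using x(2) by (auto simp: p_element_def)
          then have "?h x [^]\<^bsub>G Mod K\<^esub> (p ^ k) = \<one>\<^bsub>G Mod K\<^esub>" using h_pow[OF xG(1), of "p ^ k"] h.hom_one by simp
          then have "B.p_element p (?h x)" unfolding B.p_element_def by blast
          then have "?h x = \<one>\<^bsub>G Mod K\<^esub>" using B.not_dvd_card_iff[OF p(1) LG] L(2) xG(2) by blast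
          then have "x \<in> K" using quotient_one_iff[OF KG xG(1)] by simp
          then show ?thesis using not_dvd_card_iff[OF p(1) normal_imp_subgroup[OF KG]] K(2) x(2) by blast
        qed
        then show ?thesis using not_dvd_card_iff[OF p(1)] \<open>normal_in L' (carrier G)\<close> by (simp add: normal_in_def)
      qed
      ultimately have LK: "L' \<subseteq> K" by (rule max)
      have "C = \<one>\<^bsub>G Mod K\<^esub>" if C: "C \<in> L" for C
      proof -
        obtain x where x: "x \<in> carrier G" "C = ?h x" using lift[OF subgroup.mem_carrier[OF LG C]] by blast
        then have "x \<in> K" using C LK unfolding L'_def by blast
        then show ?thesis using quotient_one_iff[OF KG x(1)] x(2) by simp
      qed
      then show ?thesis using subgroup.one_closed[OF LG] by blast
    qed
  qed
  then have "has_surj_cocycle G (card (?h ` P))" by (rule h.has_surj_cocycle_inflate[OF fin surj])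
  then show ?thesis using syl(3) by simp
qed

text \<open>\<open>P\<close> maps isomorphically onto the quotient by the normal 2-complement.\<close>

theorem two_cocycle:
  assumes O: "O' \<lhd> G" "odd (card O')" and index: "card (carrier (G Mod O')) = 2 ^ k"
    and P: "sylow_in 2 (carrier G) P" "class2 P"
  shows "has_surj_cocycle G (card P)"
proof -
  let ?h = "\<lambda>x. O' #> x"
  interpret B: finite_group "G Mod O'" using O(1) by (rule finite_group_Mod)
  interpret h: group_hom G "G Mod O'" ?h using O(1) by (rule quotient_hom)
  have surj: "?h ` carrier G = carrier (G Mod O')" by (simp add: carrier_FactGroup)
  note syl = quotient_sylow[OF two_is_prime_nat O(1) O(2) P]
  have "?h ` P \<subseteq> carrier (G Mod O')" "card (?h ` P) = card (carrier (G Mod O'))"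
    using syl(1) index by (simp_all add: B.sylow_in_def multiplicity_same_power)
  then have eq: "?h ` P = carrier (G Mod O')" using card_subset_eq B.fin by blast
  have "has_surj_cocycle (G Mod O') (card (carrier (G Mod O')))"
    by (rule B.class2_p_group_cocycle[OF two_is_prime_nat _ index]) (use syl(2) eq in simp)
  then have "has_surj_cocycle G (card (carrier (G Mod O')))" by (rule h.has_surj_cocycle_inflate[OF fin surj])
  then show ?thesis using syl(3) eq by simp
qed

end

section \<open>Two-nilpotent groups\<close>

lemma (in finite_group) class2_of_nilpotency_class:
  assumes P: "subgroup P G" and nil: "nilpotency_class_le (G\<lparr>carrier := P\<rparr>) 2"
  shows "class2 P"
  unfolding class2_def
proof (intro ballI)
  fix a b c assume abc: "a \<in> P" "b \<in> P" "c \<in> P"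
  let ?P = "G\<lparr>carrier := P\<rparr>"
  have inv_eq: "inv\<^bsub>?P\<^esub> x = inv x" if "x \<in> P" for x using m_inv_consistent[OF P that] .
  have step: "cmt x y \<in> commutator_subgroup ?P H P" if "x \<in> H" "y \<in> P" "x \<in> P" for x y H
  proof -
    have "cmt x y = x \<otimes>\<^bsub>?P\<^esub> y \<otimes>\<^bsub>?P\<^esub> inv\<^bsub>?P\<^esub> x \<otimes>\<^bsub>?P\<^esub> inv\<^bsub>?P\<^esub> y"
      using that by (simp add: cmt_def inv_eq)
    then show ?thesis unfolding commutator_subgroup_def using that(1,2) by (intro generate.incl) blast
  qed
  have "cmt a b \<in> lower_central ?P 1" using step[of a P b] abc by simp
  then have "cmt (cmt a b) c \<in> lower_central ?P 2"
    using step[of "cmt a b" "lower_central ?P 1" c] abc cmt_in_subgroup[OF P abc(1,2)]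
    by (simp add: numeral_2_eq_2)
  then have "cmt (cmt a b) c = \<one>" using nil by (simp add: nilpotency_class_le_def)
  moreover have "a \<in> carrier G" "b \<in> carrier G" "c \<in> carrier G"
    using subgroup.mem_carrier[OF P] abc by simp_all
  ultimately show "cmt a b \<otimes> c = c \<otimes> cmt a b" using cmt_eq_one_iff[of "cmt a b" c] by simp
qed

theorem corollary3:
  fixes G :: "('a, 'b) monoid_scheme"
  assumes "group G"
    and "finite (carrier G)"
    and "solvable G"
    and "\<And>p P. sylow_subgroup p P G \<Longrightarrow> nilpotency_class_le (G\<lparr>carrier := P\<rparr>) 2"
    and "two_nilpotent G"
  shows "IYB_group G"
proof -
  interpret finite_group G using assms(1,2) by (simp add: finite_group_def finite_group_axioms_def)
  obtain N k where N: "N \<lhd> G" "odd (card N)" and index: "card (rcosets\<^bsub>G\<^esub> N) = 2 ^ k"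
    using assms(5) unfolding two_nilpotent_def by blast
  have NG: "subgroup N G" using N(1) by (rule normal_imp_subgroup)
  have indexM: "card (carrier (G Mod N)) = 2 ^ k" using index by (simp add: FactGroup_def)
  interpret B: finite_group "G Mod N" using N(1) by (rule finite_group_Mod)
  interpret h: group_hom G "G Mod N" "\<lambda>x. N #>\<^bsub>G\<^esub> x" using N(1) by (rule quotient_hom)
  have cjN: "cj g y \<in> N" if "g \<in> carrier G" "y \<in> N" for g y
    using N(1) that unfolding normal_inv_iff cj_def by blast
  have quot: "\<exists>k :: nat. g [^]\<^bsub>G\<^esub> (2 ^ k :: nat) \<in> N" if g: "g \<in> carrier G" for g
  proof -
    have "N #>\<^bsub>G\<^esub> (g [^]\<^bsub>G\<^esub> (2 ^ k :: nat)) = (N #>\<^bsub>G\<^esub> g) [^]\<^bsub>G Mod N\<^esub> (2 ^ k :: nat)" using h.hom_nat_pow[OF g] .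
    also have "\<dots> = \<one>\<^bsub>G Mod N\<^esub>"
      using B.sub_pow_card[OF B.subgroup_self h.hom_closed[OF g]] indexM by simp
    finally show ?thesis using quotient_one_iff[OF N(1)] g by blast
  qed
  show ?thesis
  proof (rule IYB_group_of_primewise_cocycles[OF fin])
    fix p :: nat assume p: "prime p"
    obtain P where P: "sylow_in p (carrier G) P" by (rule exists_sylow_in[OF p subgroup_self])
    have PG: "subgroup P G" "card P = p ^ multiplicity p (card (carrier G))" using P by (auto simp: sylow_in_def)
    have "sylow_subgroup p P G" using p PG by (simp add: sylow_subgroup_def order_def)
    then have c2: "class2 P" by (intro class2_of_nilpotency_class[OF PG(1)] assms(4))
    have "has_surj_cocycle G (card P)"
    proof (cases "p = 2")
      case True
      then show ?thesis using two_cocycle[OF N indexM] P c2 by simp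
    next
      case False
      then have "odd p" using p primes_dvd_imp_eq two_is_prime_nat by blast
      then show ?thesis using odd_prime_cocycle[OF assms(3) p _ NG N(2) cjN quot P c2] by blast
    qed
    then show "has_surj_cocycle G (p ^ multiplicity p (card (carrier G)))" using PG(2) by simp
  qed
qed

end
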